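(* Let $k\geq 2$ be an integer. The problem $\textsc{LHom}(C_{2k+1})$ can be solved in polynomial time on input graphs $G$ of diameter at most $k+1$.
   Context: All graphs are finite and simple. $C_{2k+1}$ is the cycle on $2k+1$ vertices. For a fixed graph $H$, in the list homomorphism problem $\textsc{LHom}(H)$ the input is a graph $G$ together with lists $L: V(G)\to 2^{V(H)}$, and the question is whether there is a mapping $\varphi: V(G)\to V(H)$ with $\varphi(v)\in L(v)$ for all $v\in V(G)$ and $\varphi(u)\varphi(v)\in E(H)$ for every edge $uv\in E(G)$. The diameter of $G$ is the maximum over pairs $u,v\in V(G)$ of the number of edges of a shortest $u$-$v$ path. *)

theory Defs
  imports "Graph_Theory.Graph_Theory" "HOL-Computational_Algebra.Polynomial"
begin

section \<open>Polynomial time\<close>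

text \<open>
  The machine model is a random access machine whose programs are given in structured form. The
  memory consists of cells indexed by natural numbers, each holding a natural number;
  \<open>Mem e\<close> reads the cell whose address is the value of \<open>e\<close>, so nesting gives indirect
  addressing. Every elementary operation has unit cost. Since the only arithmetic is addition and
  truncated subtraction, the bit length of every cell and address is bounded linearly in
  the running time and the input length (for a fixed program), and hence polynomial time on this
  machine coincides with polynomial time on Turing machines.
\<close>

datatype ram_exp =
    Const nat
  | Mem ram_exp
  | Plus ram_exp ram_exp
  | Minus ram_exp ram_exp

datatype ram_prog =
    Skip
  | Assign ram_exp ram_exp \<comment> \<open>\<open>Assign a e\<close> writes the value of \<open>e\<close> to the cell with address \<open>a\<close>\<close>
  | Seq ram_prog ram_prog
  | IfNZ ram_exp ram_prog ram_prog
  | WhileNZ ram_exp ram_prog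

type_synonym memory = "nat \<Rightarrow> nat"

primrec ram_val :: "ram_exp \<Rightarrow> memory \<Rightarrow> nat" where
  "ram_val (Const n) s = n"
| "ram_val (Mem e) s = s (ram_val e s)"
| "ram_val (Plus e f) s = ram_val e s + ram_val f s"
| "ram_val (Minus e f) s = ram_val e s - ram_val f s"

primrec exp_cost :: "ram_exp \<Rightarrow> nat" where
  "exp_cost (Const n) = 1"
| "exp_cost (Mem e) = exp_cost e + 1"
| "exp_cost (Plus e f) = exp_cost e + exp_cost f + 1"
| "exp_cost (Minus e f) = exp_cost e + exp_cost f + 1"

text \<open>\<open>ram_exec c s t s'\<close>: started in memory \<open>s\<close>, program \<open>c\<close> halts after exactly \<open>t\<close> elementary
  operations in memory \<open>s'\<close>. Tests succeed on nonzero values.\<close>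

inductive ram_exec :: "ram_prog \<Rightarrow> memory \<Rightarrow> nat \<Rightarrow> memory \<Rightarrow> bool" where
  Skip: "ram_exec Skip s 1 s"
| Assign: "ram_exec (Assign a e) s (exp_cost a + exp_cost e + 1) (s(ram_val a s := ram_val e s))"
| Seq: "ram_exec c s t s' \<Longrightarrow> ram_exec d s' u s'' \<Longrightarrow> ram_exec (Seq c d) s (t + u) s''"
| IfTrue: "ram_val e s \<noteq> 0 \<Longrightarrow> ram_exec c s t s' \<Longrightarrow>
    ram_exec (IfNZ e c d) s (exp_cost e + 1 + t) s'"
| IfFalse: "ram_val e s = 0 \<Longrightarrow> ram_exec d s t s' \<Longrightarrow>
    ram_exec (IfNZ e c d) s (exp_cost e + 1 + t) s'"
| WhileFalse: "ram_val e s = 0 \<Longrightarrow> ram_exec (WhileNZ e c) s (exp_cost e + 1) s"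
| WhileTrue: "ram_val e s \<noteq> 0 \<Longrightarrow> ram_exec c s t s' \<Longrightarrow> ram_exec (WhileNZ e c) s' u s'' \<Longrightarrow>
    ram_exec (WhileNZ e c) s (exp_cost e + 1 + t + u) s''"

inductive_cases SkipE: "ram_exec Skip s t s'"
inductive_cases AssignE: "ram_exec (Assign a e) s t s'"
inductive_cases SeqE: "ram_exec (Seq c d) s t s'"
inductive_cases IfE: "ram_exec (IfNZ e c d) s t s'"
inductive_cases WhileE: "ram_exec (WhileNZ e c) s t s'"

lemma ram_exec_deterministic:
  "ram_exec c s t s' \<Longrightarrow> ram_exec c s u s'' \<Longrightarrow> u = t \<and> s'' = s'"
proof (induction arbitrary: u s'' rule: ram_exec.induct)
  case (Skip s)
  then show ?case by (auto elim: SkipE)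
next
  case (Assign a e s)
  then show ?case by (auto elim: AssignE)
next
  case (Seq c s t s' d u s'')
  from Seq.prems show ?case by (rule SeqE) (metis Seq.IH)
next
  case (IfTrue e s c t s' d)
  from IfTrue.prems show ?case by (rule IfE) (use IfTrue.hyps(1) in \<open>auto dest: IfTrue.IH\<close>)
next
  case (IfFalse e s d t s' c)
  from IfFalse.prems show ?case by (rule IfE) (use IfFalse.hyps(1) in \<open>auto dest: IfFalse.IH\<close>)
next
  case (WhileFalse e s c)
  from WhileFalse.prems show ?case by (rule WhileE) (use WhileFalse in auto)
next
  case (WhileTrue e s c t s' u s'')
  from WhileTrue.prems show ?case by (rule WhileE) (use WhileTrue.hyps(1) in \<open>auto dest!: WhileTrue.IH\<close>)
qed

text \<open>Cell \<open>0\<close> holds the length of the input word, the following cells hold its bits.\<close>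

definition initial_memory :: "bool list \<Rightarrow> memory" where
  "initial_memory w a =
     (if a = 0 then length w else if a \<le> length w then of_bool (w ! (a - 1)) else 0)"

text \<open>
  A problem is given by a set \<open>I\<close> of admissible inputs, an encoding of inputs as bit strings and the
  set \<open>Y\<close> of inputs with answer ``yes''. Nothing is required of the program on inputs outside \<open>I\<close>.
\<close>

definition poly_time_solvable :: "('i \<Rightarrow> bool list) \<Rightarrow> 'i set \<Rightarrow> 'i set \<Rightarrow> bool" where
  "poly_time_solvable enc I Y \<longleftrightarrow>
     (\<exists>c. \<exists>p :: nat poly. \<forall>x\<in>I. \<exists>t s.
        ram_exec c (initial_memory (enc x)) t s \<and>
        t \<le> poly p (length (enc x)) \<and>
        (s 0 \<noteq> 0 \<longleftrightarrow> x \<in> Y))"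


section \<open>Graphs and list homomorphisms\<close>

text \<open>
  Finite simple graphs are those \<open>G\<close> with \<^const>\<open>pair_graph\<close> \<open>G\<close>: finite, loopless and symmetric,
  an edge \<open>uv\<close> being represented by the two arcs \<open>(u, v)\<close> and \<open>(v, u)\<close>.
\<close>

definition cycle_graph :: "nat \<Rightarrow> nat pair_pre_digraph" where
  "cycle_graph m = \<lparr> pverts = {..<m},
     parcs = {(i, j). i < m \<and> j < m \<and> (j = Suc i mod m \<or> i = Suc j mod m)} \<rparr>"

lemma pair_graph_cycle_graph:
  assumes "3 \<le> m"
  shows "pair_graph (cycle_graph m)"
proof
  have "parcs (cycle_graph m) \<subseteq> {..<m} \<times> {..<m}"
    unfolding cycle_graph_def by auto
  then show "finite (parcs (cycle_graph m))"
    by (rule finite_subset) simp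
  show "finite (pverts (cycle_graph m))"
    unfolding cycle_graph_def by simp
  have "Suc i mod m \<noteq> i" if "i < m" for i
    using that assms by (cases "Suc i = m") auto
  then show "fst e \<noteq> snd e" if "e \<in> parcs (cycle_graph m)" for e
    using that unfolding cycle_graph_def by (simp add: case_prod_beta) metis
  show "fst e \<in> pverts (cycle_graph m)" "snd e \<in> pverts (cycle_graph m)"
    if "e \<in> parcs (cycle_graph m)" for e
    using that unfolding cycle_graph_def by (simp_all add: case_prod_beta)
  have "sym (parcs (cycle_graph m))"
    unfolding cycle_graph_def sym_def by simp blast
  then show "symmetric (with_proj (cycle_graph m))"
    unfolding symmetric_def by simp
qed

text \<open>With unit weights, \<open>\<mu>\<close> is the number of edges of a shortest \<open>u\<close>-\<open>v\<close> path (\<open>\<infinity>\<close> if there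
  is none).\<close>

definition graph_diameter :: "'a pair_pre_digraph \<Rightarrow> ereal" where
  "graph_diameter G = (SUP u\<in>pverts G. SUP v\<in>pverts G. wf_digraph.\<mu> (with_proj G) (\<lambda>_. 1) u v)"

definition list_homomorphism ::
  "'b pair_pre_digraph \<Rightarrow> 'a pair_pre_digraph \<Rightarrow> ('a \<Rightarrow> 'b set) \<Rightarrow> ('a \<Rightarrow> 'b) \<Rightarrow> bool" where
  "list_homomorphism H G L \<phi> \<longleftrightarrow>
     \<phi> ` pverts G \<subseteq> pverts H \<and>
     (\<forall>v\<in>pverts G. \<phi> v \<in> L v) \<and>
     (\<forall>(u, v)\<in>parcs G. (\<phi> u, \<phi> v) \<in> parcs H)"

type_synonym lhom_input = "nat pair_pre_digraph \<times> (nat \<Rightarrow> nat set)"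

text \<open>As usual for algorithmic graph problems, the vertices of an input graph are
  \<open>0, \<dots>, n - 1\<close>.\<close>

definition lhom_inputs :: "nat pair_pre_digraph \<Rightarrow> lhom_input set" where
  "lhom_inputs H = {(G, L). pair_graph G \<and> pverts G = {..<card (pverts G)} \<and>
     (\<forall>v\<in>pverts G. L v \<subseteq> pverts H)}"

definition lhom_yes :: "nat pair_pre_digraph \<Rightarrow> lhom_input set" where
  "lhom_yes H = {(G, L). \<exists>\<phi>. list_homomorphism H G L \<phi>}"

text \<open>
  The number \<open>n\<close> of vertices in unary, followed by the adjacency matrix and, for each vertex, the
  characteristic vector of its list. This is meant for graphs \<open>H\<close> with vertices \<open>0, \<dots>, h - 1\<close>.
\<close>

definition lhom_encoding :: "nat pair_pre_digraph \<Rightarrow> lhom_input \<Rightarrow> bool list" where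
  "lhom_encoding H = (\<lambda>(G, L).
     let n = card (pverts G); h = card (pverts H) in
       replicate n True @ [False] @
       concat (map (\<lambda>u. map (\<lambda>v. (u, v) \<in> parcs G) [0..<n]) [0..<n]) @
       concat (map (\<lambda>v. map (\<lambda>a. a \<in> L v) [0..<h]) [0..<n]))"

end

theory Submission
  imports Defs
begin

text \<open>
  Let \<open>m = 2k + 1\<close>. The algorithm accepts iff for every choice of \<open>2k + 3\<close> vertices there are colours
  for them such that path consistency, started with these vertices precoloured, does not refute the
  instance. Path consistency is the least fixed point of a first-order definable operator, so it
  is computable in polynomial time.

  If the algorithm accepts, some choice of vertices leaves lists that admit a majority
  operation compatible with all edges, and then path consistency yields a solution (Baker--Pixley).
  Fix a vertex \<open>v\<^sub>0\<close>. If no edge joins two vertices at equal distance from \<open>v\<^sub>0\<close>, precolour \<open>v\<^sub>0\<close> only: a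
  vertex at distance \<open>d \<le> k + 1\<close> has a colour with a unique integer offset in \<open>[-d, d]\<close>, of the parity
  of \<open>d\<close>, from the colour of \<open>v\<^sub>0\<close>; colours at the ends of an edge are adjacent iff their offsets differ by one, and
  the median of the offsets is a majority operation. Otherwise there is a closed walk of
  odd length at most \<open>2k + 3\<close>; precolour it. The coloured walk has nonzero winding
  number in the cycle, and comparing winding numbers shows that every vertex is left with at most two colours.
\<close>

text \<open>Quantifying over all guesses spares the algorithm the search for a suitable
  \<open>v0\<close> or odd walk: a genuine solution survives every guess, and the guess that the
  argument needs is among those tested. The number 2k + 3 is the length of two paths of length at
  most k + 1 closed up by one edge; being constant, it leaves only polynomially many guesses.

  The bound k + 1 on distances decides the odd-walk case. If both ends of a walk edge have the same
  distance d from a vertex, parity forces the lifted colour of that vertex to jump by m or -m there.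
  This takes 2d + 1 >= m, so d is k or k + 1, and the colour must lie opposite the edge in the cycle
  or next to that place.

  No program for this particular algorithm is verified by hand: the machine part treats an arbitrary
  monotone operator given by a bounded formula. The guess is made part of the table index, so that
  one fixed point computation serves all guesses at once.\<close>

section \<open>Time-bounded execution of RAM programs\<close>

text \<open>Total correctness with a time budget. \<open>T\<close> is only an upper bound on the
  cost, so budgets may be rounded up freely.\<close>

definition runs :: "ram_prog \<Rightarrow> memory \<Rightarrow> nat \<Rightarrow> (memory \<Rightarrow> bool) \<Rightarrow> bool" where
  "runs c s T Q \<longleftrightarrow> (\<exists>t s'. ram_exec c s t s' \<and> t \<le> T \<and> Q s')"

lemma runs_mono: "runs c s T Q \<Longrightarrow> T \<le> T' \<Longrightarrow> (\<And>s'. Q s' \<Longrightarrow> Q' s') \<Longrightarrow> runs c s T' Q'"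
  unfolding runs_def by (meson order_trans)

lemma runs_Skip: "Q s \<Longrightarrow> 1 \<le> T \<Longrightarrow> runs Skip s T Q"
  unfolding runs_def by (meson ram_exec.Skip)

lemma runs_Assign:
  "Q (s(ram_val a s := ram_val e s)) \<Longrightarrow> exp_cost a + exp_cost e + 1 \<le> T \<Longrightarrow> runs (Assign a e) s T Q"
  unfolding runs_def by (meson ram_exec.Assign)

lemma runs_Seq:
  assumes "runs c s T P" "\<And>s'. P s' \<Longrightarrow> runs d s' U Q" "T + U \<le> W"
  shows "runs (Seq c d) s W Q"
proof -
  obtain t s' where 1: "ram_exec c s t s'" "t \<le> T" "P s'"
    using assms(1) unfolding runs_def by blast
  then obtain u s'' where 2: "ram_exec d s' u s''" "u \<le> U" "Q s''"
    using assms(2) unfolding runs_def by blast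
  then have "ram_exec (Seq c d) s (t + u) s''" using 1 by (blast intro: ram_exec.Seq)
  then show ?thesis using 1 2 assms(3) unfolding runs_def by (meson add_mono order_trans)
qed

lemma runs_If:
  assumes "ram_val e s \<noteq> 0 \<Longrightarrow> runs c s T Q" "ram_val e s = 0 \<Longrightarrow> runs d s T Q"
    "exp_cost e + 1 + T \<le> U"
  shows "runs (IfNZ e c d) s U Q"
proof (cases "ram_val e s = 0")
  case True
  then obtain t s' where "ram_exec d s t s'" "t \<le> T" "Q s'"
    using assms(2) unfolding runs_def by blast
  then have "ram_exec (IfNZ e c d) s (exp_cost e + 1 + t) s'" "exp_cost e + 1 + t \<le> U" "Q s'"
    using ram_exec.IfFalse[OF True] assms(3) by simp_all
  then show ?thesis unfolding runs_def by blast
next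
  case False
  then obtain t s' where "ram_exec c s t s'" "t \<le> T" "Q s'"
    using assms(1) unfolding runs_def by blast
  then have "ram_exec (IfNZ e c d) s (exp_cost e + 1 + t) s'" "exp_cost e + 1 + t \<le> U" "Q s'"
    using ram_exec.IfTrue[OF False] assms(3) by simp_all
  then show ?thesis unfolding runs_def by blast
qed

text \<open>The index of the invariant is the number of iterations still to come, so it serves as
  the loop variant too. The factor \<open>Suc i\<close> pays for the final failing test.\<close>

lemma runs_While:
  assumes "I i s"
    and guard: "\<And>i s. I i s \<Longrightarrow> ram_val e s = 0 \<longleftrightarrow> i = 0"
    and body: "\<And>i s. I (Suc i) s \<Longrightarrow> runs c s T (I i)"
    and "Suc i * (exp_cost e + 1 + T) \<le> U"
  shows "runs (WhileNZ e c) s U (I 0)"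
proof -
  have "runs (WhileNZ e c) s (Suc i * (exp_cost e + 1 + T)) (I 0)"
    using assms(1)
  proof (induction i arbitrary: s)
    case 0
    then have "ram_exec (WhileNZ e c) s (exp_cost e + 1) s"
      using guard[OF 0] ram_exec.WhileFalse by blast
    then show ?case unfolding runs_def by (rule_tac x="exp_cost e + 1" in exI) (use 0 in auto)
  next
    case (Suc i)
    obtain t s' where 1: "ram_exec c s t s'" "t \<le> T" "I i s'"
      using body[OF Suc.prems] unfolding runs_def by blast
    obtain u s'' where 2: "ram_exec (WhileNZ e c) s' u s''" "u \<le> Suc i * (exp_cost e + 1 + T)" "I 0 s''"
      using Suc.IH[OF 1(3)] unfolding runs_def by blast
    have "ram_exec (WhileNZ e c) s (exp_cost e + 1 + t + u) s''"
      using guard[OF Suc.prems] ram_exec.WhileTrue[OF _ 1(1) 2(1)] by blast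
    then show ?case unfolding runs_def
      by (rule_tac x="exp_cost e + 1 + t + u" in exI) (use 1 2 in auto)
  qed
  then show ?thesis by (rule runs_mono) (use assms(4) in auto)
qed

text \<open>Cell \<open>0\<close> keeps the length of the input during the whole computation, so that the cells behind
  the input can be addressed relative to it; they serve as registers.\<close>

definition reg_addr :: "nat \<Rightarrow> ram_exp" where
  "reg_addr j = Plus (Mem (Const 0)) (Const (Suc j))"

definition reg :: "nat \<Rightarrow> ram_exp" where
  "reg j = Mem (reg_addr j)"

definition set_reg :: "nat \<Rightarrow> ram_exp \<Rightarrow> ram_prog" where
  "set_reg j e = Assign (reg_addr j) e"

lemma reg_simps [simp]:
  "ram_val (reg_addr j) s = s 0 + Suc j" "exp_cost (reg_addr j) = 4"
  "ram_val (reg j) s = s (s 0 + Suc j)" "exp_cost (reg j) = 5"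
  by (simp_all add: reg_addr_def reg_def)

lemma runs_set_reg:
  "Q (s(s 0 + Suc j := ram_val e s)) \<Longrightarrow> exp_cost e + 5 \<le> T \<Longrightarrow> runs (set_reg j e) s T Q"
  unfolding set_reg_def by (rule runs_Assign) simp_all

text \<open>Frame condition of a stack discipline: code compiled at level \<open>t\<close> leaves
  its result in register \<open>t\<close> and uses the \<open>h\<close> registers from
  \<open>t\<close> on as scratch space. The input, the variables below \<open>t\<close> and the
  table above stay intact.\<close>

definition unchanged_outside :: "nat \<Rightarrow> nat \<Rightarrow> memory \<Rightarrow> memory \<Rightarrow> bool" where
  "unchanged_outside t h s s' \<longleftrightarrow> (\<forall>a. a \<notin> {s 0 + Suc t..<s 0 + Suc t + h} \<longrightarrow> s' a = s a)"

definition holds_env :: "nat \<Rightarrow> (nat \<Rightarrow> nat) \<Rightarrow> memory \<Rightarrow> bool" where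
  "holds_env q e s \<longleftrightarrow> (\<forall>j<q. s (s 0 + Suc j) = e j)"

lemma unchanged_outsideD: "unchanged_outside t h s s' \<Longrightarrow> a < s 0 + Suc t \<or> s 0 + Suc t + h \<le> a \<Longrightarrow> s' a = s a"
  unfolding unchanged_outside_def by auto

lemma unchanged_outside_0: "unchanged_outside t h s s' \<Longrightarrow> s' 0 = s 0"
  unfolding unchanged_outside_def by auto

lemma holds_env_unchanged: "holds_env q e s \<Longrightarrow> unchanged_outside t h s s' \<Longrightarrow> q \<le> t \<Longrightarrow> holds_env q e s'"
  unfolding holds_env_def unchanged_outside_def by auto

section \<open>Arithmetic terms and their compilation\<close>

datatype tm = Var nat | Cst nat | Add tm tm | Mul tm tm

primrec tval :: "(nat \<Rightarrow> nat) \<Rightarrow> tm \<Rightarrow> nat" where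
  "tval e (Var j) = e j"
| "tval e (Cst c) = c"
| "tval e (Add a b) = tval e a + tval e b"
| "tval e (Mul a b) = tval e a * tval e b"

primrec tvars_below :: "nat \<Rightarrow> tm \<Rightarrow> bool" where
  "tvars_below q (Var j) \<longleftrightarrow> j < q"
| "tvars_below q (Cst c) \<longleftrightarrow> True"
| "tvars_below q (Add a b) \<longleftrightarrow> tvars_below q a \<and> tvars_below q b"
| "tvars_below q (Mul a b) \<longleftrightarrow> tvars_below q a \<and> tvars_below q b"

primrec theight :: "tm \<Rightarrow> nat" where
  "theight (Var j) = 1"
| "theight (Cst c) = 1"
| "theight (Add a b) = theight a + theight b + 1"
| "theight (Mul a b) = theight a + theight b + 3"

text \<open>The machine cannot multiply, so a product is formed by repeated addition: register
  \<open>t\<close> accumulates, \<open>t + 1\<close> holds the factor being added and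
  \<open>t + 2\<close> counts down.\<close>

primrec compile_tm :: "nat \<Rightarrow> tm \<Rightarrow> ram_prog" where
  "compile_tm t (Var j) = set_reg t (reg j)"
| "compile_tm t (Cst c) = set_reg t (Const c)"
| "compile_tm t (Add a b) = Seq (compile_tm t a) (Seq (compile_tm (t + 1) b)
     (set_reg t (Plus (reg t) (reg (t + 1)))))"
| "compile_tm t (Mul a b) = Seq (compile_tm (t + 1) a) (Seq (compile_tm (t + 2) b)
     (Seq (set_reg t (Const 0))
       (WhileNZ (reg (t + 2)) (Seq (set_reg t (Plus (reg t) (reg (t + 1))))
          (set_reg (t + 2) (Minus (reg (t + 2)) (Const 1)))))))"

lemma theight_pos: "0 < theight a"
  by (induction a) auto

text \<open>A polynomial majorant of the value in terms of a bound on the variables; it bounds the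
  iterations of multiplication loops and of bounded quantifiers.\<close>

primrec tval_poly :: "tm \<Rightarrow> nat poly" where
  "tval_poly (Var j) = [:0, 1:]"
| "tval_poly (Cst c) = [:c:]"
| "tval_poly (Add a b) = tval_poly a + tval_poly b"
| "tval_poly (Mul a b) = tval_poly a * tval_poly b"

lemma tval_le_poly:
  "tvars_below q a \<Longrightarrow> \<forall>j<q. e j \<le> M \<Longrightarrow> tval e a \<le> poly (tval_poly a) M"
  by (induction a) (simp_all add: add_mono mult_mono)

definition tm_time :: "nat \<Rightarrow> tm \<Rightarrow> nat poly \<Rightarrow> bool" where
  "tm_time q a p \<longleftrightarrow> (\<forall>t s e M. holds_env q e s \<longrightarrow> (\<forall>j<q. e j \<le> M) \<longrightarrow> q \<le> t \<longrightarrow>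
    runs (compile_tm t a) s (poly p M)
      (\<lambda>s'. s' (s 0 + Suc t) = tval e a \<and> unchanged_outside t (theight a) s s'))"

lemma tm_timeD:
  assumes "tm_time q a p" "holds_env q e s" "\<forall>j<q. e j \<le> M" "q \<le> t"
  shows "runs (compile_tm t a) s (poly p M)
      (\<lambda>s'. s' (s 0 + Suc t) = tval e a \<and> unchanged_outside t (theight a) s s')"
  using assms unfolding tm_time_def by blast

lemma compile_tm_poly_time:
  assumes "tvars_below q a"
  shows "\<exists>p. tm_time q a p"
  using assms
proof (induction a)
  case (Var j)
  show ?case
    by (rule exI[of _ "[:10:]"])
      (use Var in \<open>auto intro!: runs_set_reg simp: tm_time_def holds_env_def unchanged_outside_def\<close>)
next
  case (Cst c)
  show ?case
    by (rule exI[of _ "[:6:]"]) (auto intro!: runs_set_reg simp: tm_time_def holds_env_def unchanged_outside_def)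
next
  case (Add a b)
  obtain p1 p2 where "tm_time q a p1" "tm_time q b p2"
    using Add by auto
  note p1 = tm_timeD[OF this(1)] and p2 = tm_timeD[OF this(2)]
  show ?case
  proof (rule exI[of _ "p1 + p2 + [:16:]"], unfold tm_time_def, intro allI impI)
    fix t s e M assume h: "holds_env q e s" "\<forall>j<q. e j \<le> M" "q \<le> t"
    let ?L = "s 0"
    show "runs (compile_tm t (Add a b)) s (poly (p1 + p2 + [:16:]) M)
      (\<lambda>s'. s' (s 0 + Suc t) = tval e (Add a b) \<and> unchanged_outside t (theight (Add a b)) s s')"
      unfolding compile_tm.simps
    proof (rule runs_Seq[OF p1[OF h]])
      fix s1 assume s1: "s1 (?L + Suc t) = tval e a \<and> unchanged_outside t (theight a) s s1"
      then have L1: "s1 0 = ?L" using unchanged_outside_0 by blast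
      have h1: "holds_env q e s1" using holds_env_unchanged h s1 by blast
      show "runs (Seq (compile_tm (t + 1) b) (set_reg t (Plus (reg t) (reg (t + 1))))) s1
          (poly p2 M + 16)
         (\<lambda>s'. s' (s 0 + Suc t) = tval e (Add a b) \<and> unchanged_outside t (theight (Add a b)) s s')"
      proof (rule runs_Seq[OF p2[OF h1 h(2), of "t + 1"]])
        fix s2 assume s2: "s2 (s1 0 + Suc (t + 1)) = tval e b \<and> unchanged_outside (t + 1) (theight b) s1 s2"
        then have L2: "s2 0 = ?L" using unchanged_outside_0 L1 by metis
        have t2: "s2 (?L + Suc t) = tval e a" using s1 s2 L1 unchanged_outsideD[of "t+1" "theight b" s1 s2 "?L + Suc t"] by auto
        show "runs (set_reg t (Plus (reg t) (reg (t + 1)))) s2 16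
         (\<lambda>s'. s' (s 0 + Suc t) = tval e (Add a b) \<and> unchanged_outside t (theight (Add a b)) s s')"
          by (rule runs_set_reg) (use L1 L2 t2 s1 s2 in \<open>auto simp: unchanged_outside_def\<close>)
      qed (use h in auto)
    qed auto
  qed
next
  case (Mul a b)
  obtain p1 p2 where "tm_time q a p1" "tm_time q b p2"
    using Mul by auto
  note p1 = tm_timeD[OF this(1)] and p2 = tm_timeD[OF this(2)]
  define p where "p = p1 + p2 + [:6:] + (tval_poly b + 1) * [:40:]"
  show ?case
  proof (rule exI[of _ p], unfold tm_time_def, intro allI impI)
    fix t s e M assume h: "holds_env q e s" "\<forall>j<q. e j \<le> M" "q \<le> t"
    let ?L = "s 0"
    let ?Q = "\<lambda>s'. s' (s 0 + Suc t) = tval e (Mul a b) \<and> unchanged_outside t (theight (Mul a b)) s s'"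
    let ?body = "Seq (set_reg t (Plus (reg t) (reg (t + 1))))
          (set_reg (t + 2) (Minus (reg (t + 2)) (Const 1)))"
    have bM: "tval e b \<le> poly (tval_poly b) M" using tval_le_poly Mul.prems h by auto
    show "runs (compile_tm t (Mul a b)) s (poly p M) ?Q"
      unfolding compile_tm.simps
    proof (rule runs_Seq[OF p1[OF h(1,2)]])
      show "q \<le> t + 1" using h by simp
      show "poly p1 M + (poly p2 M + (6 + (poly (tval_poly b) M + 1) * 40)) \<le> poly p M"
        by (simp add: p_def)
      fix s1 assume s1: "s1 (?L + Suc (t + 1)) = tval e a \<and> unchanged_outside (t + 1) (theight a) s s1"
      then have L1: "s1 0 = ?L" using unchanged_outside_0 by blast
      have h1: "holds_env q e s1" using holds_env_unchanged h s1 by (meson le_add1 order_trans)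
      show "runs (Seq (compile_tm (t + 2) b) (Seq (set_reg t (Const 0)) (WhileNZ (reg (t + 2)) ?body))) s1
         (poly p2 M + (6 + (poly (tval_poly b) M + 1) * 40)) ?Q"
      proof (rule runs_Seq[OF p2[OF h1 h(2), of "t + 2"]])
        fix s2 assume s2: "s2 (s1 0 + Suc (t + 2)) = tval e b \<and> unchanged_outside (t + 2) (theight b) s1 s2"
        then have L2: "s2 0 = ?L" using unchanged_outside_0 L1 by metis
        have t2: "s2 (?L + Suc (t + 1)) = tval e a"
          using s1 s2 L1 unchanged_outsideD[of "t+2" "theight b" s1 s2 "?L + Suc (t + 1)"] by auto
        define I where "I i s' \<longleftrightarrow> s' 0 = ?L \<and> s' (?L + Suc (t + 2)) = i \<and> i \<le> tval e b \<and>
          s' (?L + Suc (t + 1)) = tval e a \<and> s' (?L + Suc t) = (tval e b - i) * tval e a \<and>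
          unchanged_outside t (theight (Mul a b)) s s'" for i s'
        show "runs (Seq (set_reg t (Const 0)) (WhileNZ (reg (t + 2)) ?body)) s2
           (6 + (poly (tval_poly b) M + 1) * 40) ?Q"
        proof (rule runs_Seq[where P = "I (tval e b)" and T = 6])
          show "runs (set_reg t (Const 0)) s2 6 (I (tval e b))"
            by (rule runs_set_reg) (use L1 L2 t2 s1 s2 in \<open>auto simp: unchanged_outside_def I_def\<close>)
          fix s3 assume I3: "I (tval e b) s3"
          have "runs (WhileNZ (reg (t + 2)) ?body) s3 ((poly (tval_poly b) M + 1) * 40) (I 0)"
          proof (rule runs_While[where I = I, OF I3])
            show "ram_val (reg (t + 2)) s = 0 \<longleftrightarrow> i = 0" if "I i s" for i s
              using that by (auto simp: I_def)
            show "runs ?body s4 34 (I i)" if I4: "I (Suc i) s4" for i s4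
            proof -
              have e: "(tval e b - i) * tval e a = (tval e b - Suc i) * tval e a + tval e a"
                using I4 by (simp add: I_def Suc_diff_Suc[symmetric] algebra_simps)
              show ?thesis
                by (rule runs_Seq[where T = 16 and U = 12], rule runs_set_reg[where Q = "\<lambda>s'. s' = s4(s4 0 + Suc t := s4 (s4 0 + Suc t) + s4 (s4 0 + Suc (t + 1)))"])
                  (use I4 e in \<open>auto intro!: runs_set_reg simp: I_def unchanged_outside_def\<close>)
            qed
            show "Suc (tval e b) * (exp_cost (reg (t + 2)) + 1 + 34) \<le> (poly (tval_poly b) M + 1) * 40"
              using bM by simp
          qed
          then show "runs (WhileNZ (reg (t + 2)) ?body) s3 ((poly (tval_poly b) M + 1) * 40) ?Q"
            by (rule runs_mono) (auto simp: I_def)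
        qed simp
      qed (use h in auto)
    qed
  qed
qed

section \<open>Bounded first-order formulas with a table\<close>

datatype fm = Bit tm | Tab tm | Eq tm tm | Neg fm | Conj fm fm | Exists nat tm fm

primrec fval :: "(nat \<Rightarrow> nat) \<Rightarrow> nat set \<Rightarrow> (nat \<Rightarrow> nat) \<Rightarrow> fm \<Rightarrow> bool" where
  "fval inp X e (Bit a) \<longleftrightarrow> inp (tval e a) \<noteq> 0"
| "fval inp X e (Tab a) \<longleftrightarrow> tval e a \<in> X"
| "fval inp X e (Eq a b) \<longleftrightarrow> tval e a = tval e b"
| "fval inp X e (Neg f) \<longleftrightarrow> \<not> fval inp X e f"
| "fval inp X e (Conj f g) \<longleftrightarrow> fval inp X e f \<and> fval inp X e g"
| "fval inp X e (Exists j b f) \<longleftrightarrow> (\<exists>x<tval e b. fval inp X (e(j := x)) f)"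

primrec fvars_below :: "nat \<Rightarrow> fm \<Rightarrow> bool" where
  "fvars_below q (Bit a) \<longleftrightarrow> tvars_below q a"
| "fvars_below q (Tab a) \<longleftrightarrow> tvars_below q a"
| "fvars_below q (Eq a b) \<longleftrightarrow> tvars_below q a \<and> tvars_below q b"
| "fvars_below q (Neg f) \<longleftrightarrow> fvars_below q f"
| "fvars_below q (Conj f g) \<longleftrightarrow> fvars_below q f \<and> fvars_below q g"
| "fvars_below q (Exists j b f) \<longleftrightarrow> j < q \<and> tvars_below q b \<and> fvars_below q f"

primrec fheight :: "fm \<Rightarrow> nat" where
  "fheight (Bit a) = theight a"
| "fheight (Tab a) = theight a"
| "fheight (Eq a b) = theight a + theight b + 1"
| "fheight (Neg f) = fheight f + 1"
| "fheight (Conj f g) = fheight f + fheight g + 1"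
| "fheight (Exists j b f) = theight b + fheight f + 3"

definition tab_addr :: "nat \<Rightarrow> nat \<Rightarrow> ram_exp" where
  "tab_addr R j = Plus (reg_addr R) (reg j)"

definition table :: "nat \<Rightarrow> memory \<Rightarrow> nat set" where
  "table R s = {i. s (s 0 + Suc R + i) \<noteq> 0}"

text \<open>Truth is any nonzero result. \<open>Bit\<close> must test for addresses behind the
  input, because those cells hold registers and the table. \<open>Conj\<close> evaluates both parts.
  \<open>Exists\<close> tries the witnesses downwards, using the register of the bound variable
  itself, whose old value is saved in \<open>t + 2\<close> and restored at the end.\<close>

primrec compile_fm :: "nat \<Rightarrow> nat \<Rightarrow> fm \<Rightarrow> ram_prog" where
  "compile_fm R t (Bit a) = Seq (compile_tm t a)
     (IfNZ (Minus (reg t) (Mem (Const 0))) (set_reg t (Const 0)) (set_reg t (Mem (reg t))))"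
| "compile_fm R t (Tab a) = Seq (compile_tm t a) (set_reg t (Mem (tab_addr R t)))"
| "compile_fm R t (Eq a b) = Seq (compile_tm t a) (Seq (compile_tm (t + 1) b)
     (set_reg t (Minus (Const 1)
       (Plus (Minus (reg t) (reg (t + 1))) (Minus (reg (t + 1)) (reg t))))))"
| "compile_fm R t (Neg f) = Seq (compile_fm R t f) (set_reg t (Minus (Const 1) (reg t)))"
| "compile_fm R t (Conj f g) = Seq (compile_fm R t f) (Seq (compile_fm R (t + 1) g)
     (IfNZ (reg t) (set_reg t (reg (t + 1))) Skip))"
| "compile_fm R t (Exists j b f) = Seq (compile_tm (t + 1) b) (Seq (set_reg (t + 2) (reg j))
     (Seq (set_reg t (Const 0)) (Seq
       (WhileNZ (reg (t + 1)) (Seq (set_reg (t + 1) (Minus (reg (t + 1)) (Const 1)))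
         (Seq (set_reg j (reg (t + 1))) (Seq (compile_fm R (t + 3) f)
           (IfNZ (reg (t + 3)) (set_reg t (Const 1)) Skip)))))
       (set_reg j (reg (t + 2))))))"

text \<open>The memory agrees with \<open>inp\<close> only up to the end of the input, since the
  cells behind it are overwritten; there \<open>inp\<close> is zero, matching the address test in
  the code for \<open>Bit\<close>.\<close>

definition input_ok :: "(nat \<Rightarrow> nat) \<Rightarrow> memory \<Rightarrow> bool" where
  "input_ok inp s \<longleftrightarrow> (\<forall>a\<le>s 0. s a = inp a) \<and> (\<forall>a>s 0. inp a = 0)"

definition fm_time :: "nat \<Rightarrow> nat \<Rightarrow> fm \<Rightarrow> nat poly \<Rightarrow> bool" where
  "fm_time R q f p \<longleftrightarrow> (\<forall>inp t s e M. input_ok inp s \<longrightarrow> holds_env q e s \<longrightarrow> (\<forall>j<q. e j \<le> M) \<longrightarrow> q \<le> t \<longrightarrow>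
    t + fheight f \<le> R \<longrightarrow>
    runs (compile_fm R t f) s (poly p M)
      (\<lambda>s'. (s' (s 0 + Suc t) \<noteq> 0 \<longleftrightarrow> fval inp (table R s) e f) \<and> unchanged_outside t (fheight f) s s'))"

lemma fm_timeD:
  assumes "fm_time R q f p" "input_ok inp s" "holds_env q e s" "\<forall>j<q. e j \<le> M" "q \<le> t"
    "t + fheight f \<le> R"
  shows "runs (compile_fm R t f) s (poly p M)
      (\<lambda>s'. (s' (s 0 + Suc t) \<noteq> 0 \<longleftrightarrow> fval inp (table R s) e f) \<and> unchanged_outside t (fheight f) s s')"
  using assms unfolding fm_time_def by blast

lemma input_ok_unchanged:
  assumes "input_ok inp s" "unchanged_outside t h s s'"
  shows "input_ok inp s'"
proof -
  have "s' a = s a" if "a \<le> s 0" for a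
    using unchanged_outsideD[OF assms(2), of a] that by simp
  then show ?thesis
    using assms(1) unfolding input_ok_def unchanged_outside_0[OF assms(2)] by metis
qed

lemma table_unchanged: "unchanged_outside t h s s' \<Longrightarrow> t + h \<le> R \<Longrightarrow> table R s' = table R s"
  unfolding table_def unchanged_outside_def by auto

text \<open>The quantifier case of \<open>compile_fm_poly_time\<close>. The composition with
  \<open>tval_poly b + [:0, 1:]\<close> appears because the bound variable may exceed
  \<open>M\<close>: inside the loop, variables are bounded only by the majorant of \<open>b\<close>
  plus \<open>M\<close>.\<close>

lemma runs_compile_Ex:
  assumes b: "tm_time q b pb" "tvars_below q b" and f: "fm_time R q f pf" and j: "j < q"
    and h: "input_ok inp s" "holds_env q e s" "\<forall>j<q. e j \<le> M" "q \<le> t" "t + fheight (Exists j b f) \<le> R"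
  shows "runs (compile_fm R t (Exists j b f)) s
      (poly (pb + [:26:] + (tval_poly b + 1) * ([:46:] + pcompose pf (tval_poly b + [:0, 1:]))) M)
      (\<lambda>s'. (s' (s 0 + Suc t) \<noteq> 0 \<longleftrightarrow> fval inp (table R s) e (Exists j b f)) \<and>
        unchanged_outside t (fheight (Exists j b f)) s s')"
    (is "runs _ _ ?T ?Q")
proof -
  let ?L = "s 0"
  let ?X = "table R s"
  let ?P = "poly pf (poly (tval_poly b) M + M)"
  let ?body = "Seq (set_reg (t + 1) (Minus (reg (t + 1)) (Const 1)))
         (Seq (set_reg j (reg (t + 1))) (Seq (compile_fm R (t + 3) f)
           (IfNZ (reg (t + 3)) (set_reg t (Const 1)) Skip)))"
  have bM: "tval e b \<le> poly (tval_poly b) M" using tval_le_poly b(2) h(3) by blast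
  have T: "?T = poly pb M + 26 + (poly (tval_poly b) M + 1) * (46 + ?P)"
    by (simp add: poly_pcompose)
  \<comment> \<open>The frame condition relaxed at register \<open>j\<close>: the loop overwrites
    the bound variable, and the full frame condition returns only after its value has been
    restored.\<close>
  define rest where "rest s' \<longleftrightarrow>
    (\<forall>a. a \<notin> {?L + Suc t..<?L + Suc t + fheight (Exists j b f)} \<longrightarrow> a \<noteq> ?L + Suc j \<longrightarrow> s' a = s a)" for s'
  define I where "I i s' \<longleftrightarrow> rest s' \<and> s' (?L + Suc (t + 1)) = i \<and> i \<le> tval e b \<and>
    s' (?L + Suc (t + 2)) = e j \<and>
    (s' (?L + Suc t) \<noteq> 0 \<longleftrightarrow> (\<exists>x. i \<le> x \<and> x < tval e b \<and> fval inp ?X (e(j := x)) f))" for i s'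
  have restD: "s' a = s a" if "rest s'" "a < ?L + Suc t \<or> ?L + Suc t + fheight (Exists j b f) \<le> a" "a \<noteq> ?L + Suc j" for s' a
    using that unfolding rest_def by (meson atLeastLessThan_iff leD)
  have L0: "s' 0 = ?L" if "rest s'" for s' using restD[OF that, of 0] by simp
  have rest_input: "input_ok inp s'" if "rest s'" for s'
  proof -
    have "s' a = s a" if "a \<le> ?L" for a using restD[OF \<open>rest s'\<close>, of a] that by simp
    then show ?thesis using h(1) unfolding input_ok_def L0[OF that] by metis
  qed
  have rest_table: "table R s' = ?X" if "rest s'" for s'
  proof -
    have "s' (?L + Suc R + i) = s (?L + Suc R + i)" for i
      using restD[OF that, of "?L + Suc R + i"] h(4,5) j by simp
    then show ?thesis by (simp only: table_def L0[OF that])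
  qed
  have body: "runs ?body s1 (40 + ?P) (I i)" if I1: "I (Suc i) s1" for i s1
  proof -
    note L1 = L0[of s1]
    let ?s2 = "s1(?L + Suc (t + 1) := i)"
    let ?s3 = "?s2(?L + Suc j := i)"
    let ?e = "e(j := i)"
    have r1: "rest s1" and r3: "rest ?s3" and i: "i < tval e b"
      using I1 by (auto simp: I_def rest_def)
    have s30: "?s3 0 = ?L" using L0[OF r3] .
    note in3 = rest_input[OF r3] and X3 = rest_table[OF r3]
    have en3: "holds_env q ?e ?s3"
      unfolding holds_env_def s30
    proof (intro allI impI)
      fix j' assume j': "j' < q"
      have "s1 (?L + Suc j') = e j'" if "j' \<noteq> j"
        using restD[OF r1, of "?L + Suc j'"] that j' h(2,4) by (simp add: holds_env_def)
      then show "?s3 (?L + Suc j') = ?e j'" using j' h(4) by simp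
    qed
    have M3: "\<forall>j<q. ?e j \<le> poly (tval_poly b) M + M" using h(3) i bM by (auto simp: trans_le_add2)
    have th: "q \<le> t + 3" "t + 3 + fheight f \<le> R" using h(4,5) by simp_all
    have "runs (compile_fm R (t + 3) f) ?s3 ?P
      (\<lambda>s'. (s' (?L + Suc (t + 3)) \<noteq> 0 \<longleftrightarrow> fval inp ?X ?e f) \<and> unchanged_outside (t + 3) (fheight f) ?s3 s')"
      using fm_timeD[OF f in3 en3 M3 th] unfolding X3 s30 .
    then have run4: "runs (Seq (compile_fm R (t + 3) f)
           (IfNZ (reg (t + 3)) (set_reg t (Const 1)) Skip)) ?s3 (?P + 12) (I i)"
    proof (rule runs_Seq)
      fix s4 assume s4: "(s4 (?L + Suc (t + 3)) \<noteq> 0 \<longleftrightarrow> fval inp ?X ?e f) \<and> unchanged_outside (t + 3) (fheight f) ?s3 s4"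
      then have L4: "s4 0 = ?L" using unchanged_outside_0 s30 by metis
      have u4: "\<And>a. a < ?L + Suc (t + 3) \<or> ?L + Suc (t + 3) + fheight f \<le> a \<Longrightarrow> s4 a = ?s3 a"
        using unchanged_outsideD[of "t + 3" "fheight f" ?s3 s4] s4 s30 by metis
      have r4: "rest s4" using r3 u4 unfolding rest_def by (auto)
      have t4: "s4 (?L + Suc t) = s1 (?L + Suc t)" "s4 (?L + Suc (t + 1)) = i" "s4 (?L + Suc (t + 2)) = e j"
        using u4[of "?L + Suc t"] u4[of "?L + Suc (t + 1)"] u4[of "?L + Suc (t + 2)"] j h(4) I1
        by (auto simp: I_def)
      have ex: "(\<exists>x. i \<le> x \<and> x < tval e b \<and> fval inp ?X (e(j := x)) f) \<longleftrightarrow>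
        s1 (?L + Suc t) \<noteq> 0 \<or> fval inp ?X ?e f"
        using I1 i unfolding I_def by (metis Suc_leD Suc_leI le_neq_implies_less order_refl)
      show "runs (IfNZ (reg (t + 3)) (set_reg t (Const 1)) Skip) s4 12 (I i)"
      proof (rule runs_If[where T = 6])
        assume "ram_val (reg (t + 3)) s4 \<noteq> 0"
        then have "fval inp ?X ?e f" using s4 L4 by simp
        then have "I i (s4(?L + Suc t := 1))"
          using r4 t4 i unfolding I_def ex by (auto simp: rest_def)
        then show "runs (set_reg t (Const 1)) s4 6 (I i)"
          by (intro runs_set_reg) (simp_all add: L4)
      next
        assume "ram_val (reg (t + 3)) s4 = 0"
        then have "\<not> fval inp ?X ?e f" using s4 L4 by simp
        then have "I i s4"
          using r4 t4 i unfolding I_def ex by auto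
        then show "runs Skip s4 6 (I i)"
          by (intro runs_Skip) simp_all
      qed simp
    qed simp
    show ?thesis
    proof (rule runs_Seq[where P = "\<lambda>s'. s' = ?s2" and T = 12 and U = "?P + 22"])
      show "runs (set_reg (t + 1) (Minus (reg (t + 1)) (Const 1))) s1 12 (\<lambda>s'. s' = ?s2)"
        using I1 L1[OF r1] by (intro runs_set_reg) (auto simp: I_def)
      fix s' assume s': "s' = ?s2"
      show "runs (Seq (set_reg j (reg (t + 1))) (Seq (compile_fm R (t + 3) f)
           (IfNZ (reg (t + 3)) (set_reg t (Const 1)) Skip))) s' (?P + 22) (I i)"
      proof (rule runs_Seq[where P = "\<lambda>s'. s' = ?s3" and T = 10])
        show "runs (set_reg j (reg (t + 1))) s' 10 (\<lambda>s'. s' = ?s3)"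
          using L1[OF r1] by (intro runs_set_reg) (auto simp: s')
      qed (use run4 in auto)
    qed simp
  qed
  have "runs (compile_tm (t + 1) b) s (poly pb M)
      (\<lambda>s'. s' (s 0 + Suc (t + 1)) = tval e b \<and> unchanged_outside (t + 1) (theight b) s s')"
    using tm_timeD[OF b(1) h(2,3), of "t + 1"] h(4) by simp
  then show ?thesis unfolding T compile_fm.simps
  proof (rule runs_Seq[where U = "26 + (poly (tval_poly b) M + 1) * (46 + ?P)"])
    fix s1 assume s1: "s1 (s 0 + Suc (t + 1)) = tval e b \<and> unchanged_outside (t + 1) (theight b) s s1"
    have r1: "rest s1" using s1 by (auto simp: unchanged_outside_def rest_def)
    note L1 = L0[OF r1]
    have ej: "s1 (?L + Suc j) = e j"
      using h(2,4) j s1 unfolding holds_env_def unchanged_outside_def by auto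
    let ?s2 = "s1(?L + Suc (t + 2) := e j)"
    have L2: "?s2 0 = ?L" using L1 by simp
    have I2: "I (tval e b) (?s2(?L + Suc t := 0))"
      using r1 s1 unfolding I_def rest_def by auto
    show "runs (Seq (set_reg (t + 2) (reg j)) (Seq (set_reg t (Const 0)) (Seq
       (WhileNZ (reg (t + 1)) ?body) (set_reg j (reg (t + 2)))))) s1
      (26 + (poly (tval_poly b) M + 1) * (46 + ?P)) ?Q"
    proof (rule runs_Seq[where P = "\<lambda>s'. s' = ?s2" and T = 10])
      show "runs (set_reg (t + 2) (reg j)) s1 10 (\<lambda>s'. s' = ?s2)"
        using ej L1 by (intro runs_set_reg) auto
      fix s' assume s': "s' = ?s2"
      show "runs (Seq (set_reg t (Const 0)) (Seq
       (WhileNZ (reg (t + 1)) ?body) (set_reg j (reg (t + 2))))) s'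
         (16 + (poly (tval_poly b) M + 1) * (46 + ?P)) ?Q"
      proof (rule runs_Seq[where P = "I (tval e b)" and T = 6])
        show "runs (set_reg t (Const 0)) s' 6 (I (tval e b))"
          unfolding s' using I2 L1 by (intro runs_set_reg) auto
        fix s3 assume I3: "I (tval e b) s3"
        have "runs (WhileNZ (reg (t + 1)) ?body) s3 ((poly (tval_poly b) M + 1) * (46 + ?P)) (I 0)"
        proof (rule runs_While[where I = I, OF I3])
          show "ram_val (reg (t + 1)) s' = 0 \<longleftrightarrow> i = 0" if "I i s'" for i s'
            using that L0[of s'] by (auto simp: I_def)
          show "runs ?body s1 (40 + ?P) (I i)" if "I (Suc i) s1" for i s1
            using body[OF that] .
          have "Suc (tval e b) * (46 + ?P) \<le> (poly (tval_poly b) M + 1) * (46 + ?P)"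
            using bM by (intro mult_right_mono) auto
          then show "Suc (tval e b) * (exp_cost (reg (t + 1)) + 1 + (40 + ?P)) \<le> (poly (tval_poly b) M + 1) * (46 + ?P)"
            by simp
        qed
        then show "runs (Seq (WhileNZ (reg (t + 1)) ?body) (set_reg j (reg (t + 2)))) s3
          (10 + (poly (tval_poly b) M + 1) * (46 + ?P)) ?Q"
        proof (rule runs_Seq[where U = 10])
          fix s4 assume I4: "I 0 s4"
          then have r4: "rest s4" by (simp add: I_def)
          note L4 = L0[OF r4]
          have ej': "s (?L + Suc j) = e j" using h(2) j unfolding holds_env_def by auto
          have "?Q (s4(?L + Suc j := e j))"
            using I4 r4 ej' j h(4) by (auto simp: I_def rest_def unchanged_outside_def)
          then show "runs (set_reg j (reg (t + 2))) s4 10 ?Q"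
            using I4 by (intro runs_set_reg) (simp_all add: L4 I_def)
        qed simp
      qed simp
    qed simp
  qed simp
qed

lemma compile_fm_poly_time:
  assumes "fvars_below q f"
  shows "\<exists>p. fm_time R q f p"
  using assms
proof (induction f)
  case (Bit a)
  then obtain p where "tm_time q a p" using compile_tm_poly_time by auto
  note p = tm_timeD[OF this]
  have "fm_time R q (Bit a) (p + [:20:])"
    unfolding fm_time_def
  proof (intro allI impI)
    fix inp t s e M assume h: "input_ok inp s" "holds_env q e s" "\<forall>j<q. e j \<le> M" "q \<le> t" "t + fheight (Bit a) \<le> R"
    show "runs (compile_fm R t (Bit a)) s (poly (p + [:20:]) M)
      (\<lambda>s'. (s' (s 0 + Suc t) \<noteq> 0 \<longleftrightarrow> fval inp (table R s) e (Bit a)) \<and> unchanged_outside t (fheight (Bit a)) s s')"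
      (is "runs _ _ _ ?Q")
      unfolding compile_fm.simps
    proof (rule runs_Seq[OF p[OF h(2-4)]])
      fix s1 assume s1: "s1 (s 0 + Suc t) = tval e a \<and> unchanged_outside t (theight a) s s1"
      then have L1: "s1 0 = s 0" using unchanged_outside_0 by blast
      have "input_ok inp s1" using input_ok_unchanged h(1) s1 by blast
      then have val: "tval e a \<le> s 0 \<Longrightarrow> s1 (tval e a) = inp (tval e a)" "s 0 < tval e a \<Longrightarrow> inp (tval e a) = 0"
        unfolding input_ok_def L1 by blast+
      show "runs (IfNZ (Minus (reg t) (Mem (Const 0))) (set_reg t (Const 0)) (set_reg t (Mem (reg t)))) s1 20 ?Q"
        by (rule runs_If[where T = 11]; (rule runs_set_reg)?)
          (use s1 val L1 theight_pos[of a] in \<open>auto simp: unchanged_outside_def\<close>)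
    qed auto
  qed
  then show ?case by blast
next
  case (Tab a)
  then obtain p where "tm_time q a p" using compile_tm_poly_time by auto
  note p = tm_timeD[OF this]
  have "fm_time R q (Tab a) (p + [:20:])"
    unfolding fm_time_def
  proof (intro allI impI)
    fix inp t s e M assume h: "input_ok inp s" "holds_env q e s" "\<forall>j<q. e j \<le> M" "q \<le> t" "t + fheight (Tab a) \<le> R"
    show "runs (compile_fm R t (Tab a)) s (poly (p + [:20:]) M)
      (\<lambda>s'. (s' (s 0 + Suc t) \<noteq> 0 \<longleftrightarrow> fval inp (table R s) e (Tab a)) \<and> unchanged_outside t (fheight (Tab a)) s s')"
      (is "runs _ _ _ ?Q")
      unfolding compile_fm.simps
    proof (rule runs_Seq[OF p[OF h(2-4)]])
      fix s1 assume s1: "s1 (s 0 + Suc t) = tval e a \<and> unchanged_outside t (theight a) s s1"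
      then have L1: "s1 0 = s 0" using unchanged_outside_0 by blast
      have X1: "table R s1 = table R s" using table_unchanged[of t "theight a" s s1 R] s1 h(5) by simp
      have "s1 (s 0 + Suc R + tval e a) \<noteq> 0 \<longleftrightarrow> tval e a \<in> table R s"
        unfolding X1[symmetric] by (simp add: table_def L1)
      then show "runs (set_reg t (Mem (tab_addr R t))) s1 20 ?Q"
        by (intro runs_set_reg)
          (use s1 L1 theight_pos[of a] in \<open>auto simp: tab_addr_def unchanged_outside_def\<close>)
    qed auto
  qed
  then show ?case by blast
next
  case (Eq a b)
  then obtain p1 p2 where "tm_time q a p1" "tm_time q b p2"
    using compile_tm_poly_time[of q a] compile_tm_poly_time[of q b] by auto
  note p1 = tm_timeD[OF this(1)] and p2 = tm_timeD[OF this(2)]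
  have "fm_time R q (Eq a b) (p1 + p2 + [:40:])"
    unfolding fm_time_def
  proof (intro allI impI)
    fix inp t s e M assume h: "input_ok inp s" "holds_env q e s" "\<forall>j<q. e j \<le> M" "q \<le> t" "t + fheight (Eq a b) \<le> R"
    show "runs (compile_fm R t (Eq a b)) s (poly (p1 + p2 + [:40:]) M)
      (\<lambda>s'. (s' (s 0 + Suc t) \<noteq> 0 \<longleftrightarrow> fval inp (table R s) e (Eq a b)) \<and> unchanged_outside t (fheight (Eq a b)) s s')"
      (is "runs _ _ _ ?Q")
      unfolding compile_fm.simps
    proof (rule runs_Seq[OF p1[OF h(2-4)]])
      fix s1 assume s1: "s1 (s 0 + Suc t) = tval e a \<and> unchanged_outside t (theight a) s s1"
      then have L1: "s1 0 = s 0" using unchanged_outside_0 by blast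
      have h1: "holds_env q e s1" using holds_env_unchanged h s1 by blast
      show "runs (Seq (compile_tm (t + 1) b) (set_reg t (Minus (Const 1)
       (Plus (Minus (reg t) (reg (t + 1))) (Minus (reg (t + 1)) (reg t)))))) s1 (poly p2 M + 40) ?Q"
      proof (rule runs_Seq[OF p2[OF h1 h(3), of "t + 1"]])
        fix s2 assume s2: "s2 (s1 0 + Suc (t + 1)) = tval e b \<and> unchanged_outside (t + 1) (theight b) s1 s2"
        then have L2: "s2 0 = s 0" using unchanged_outside_0 L1 by metis
        have t2: "s2 (s 0 + Suc t) = tval e a"
          using s1 s2 L1 unchanged_outsideD[of "t+1" "theight b" s1 s2 "s 0 + Suc t"] by auto
        show "runs (set_reg t (Minus (Const 1)
           (Plus (Minus (reg t) (reg (t + 1))) (Minus (reg (t + 1)) (reg t))))) s2 40 ?Q"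
          by (rule runs_set_reg) (use L1 L2 t2 s1 s2 in \<open>auto simp: unchanged_outside_def\<close>)
      qed (use h in auto)
    qed auto
  qed
  then show ?case by blast
next
  case (Neg f)
  then obtain p where "fm_time R q f p" by auto
  note p = fm_timeD[OF this]
  have "fm_time R q (Neg f) (p + [:20:])"
    unfolding fm_time_def
  proof (intro allI impI)
    fix inp t s e M assume h: "input_ok inp s" "holds_env q e s" "\<forall>j<q. e j \<le> M" "q \<le> t" "t + fheight (Neg f) \<le> R"
    show "runs (compile_fm R t (Neg f)) s (poly (p + [:20:]) M)
      (\<lambda>s'. (s' (s 0 + Suc t) \<noteq> 0 \<longleftrightarrow> fval inp (table R s) e (Neg f)) \<and> unchanged_outside t (fheight (Neg f)) s s')"
      (is "runs _ _ _ ?Q")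
      unfolding compile_fm.simps
    proof (rule runs_Seq[OF p[OF h(1-4)]])
      fix s1 assume s1: "(s1 (s 0 + Suc t) \<noteq> 0 \<longleftrightarrow> fval inp (table R s) e f) \<and> unchanged_outside t (fheight f) s s1"
      then have L1: "s1 0 = s 0" using unchanged_outside_0 by blast
      show "runs (set_reg t (Minus (Const 1) (reg t))) s1 20 ?Q"
        by (intro runs_set_reg) (use s1 L1 in \<open>auto simp: unchanged_outside_def\<close>)
    qed (use h in auto)
  qed
  then show ?case by blast
next
  case (Conj f g)
  then obtain p1 p2 where "fm_time R q f p1" "fm_time R q g p2" by auto
  note p1 = fm_timeD[OF this(1)] and p2 = fm_timeD[OF this(2)]
  have "fm_time R q (Conj f g) (p1 + p2 + [:20:])"
    unfolding fm_time_def
  proof (intro allI impI)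
    fix inp t s e M assume h: "input_ok inp s" "holds_env q e s" "\<forall>j<q. e j \<le> M" "q \<le> t" "t + fheight (Conj f g) \<le> R"
    show "runs (compile_fm R t (Conj f g)) s (poly (p1 + p2 + [:20:]) M)
      (\<lambda>s'. (s' (s 0 + Suc t) \<noteq> 0 \<longleftrightarrow> fval inp (table R s) e (Conj f g)) \<and> unchanged_outside t (fheight (Conj f g)) s s')"
      (is "runs _ _ _ ?Q")
      unfolding compile_fm.simps
    proof (rule runs_Seq[OF p1[OF h(1-4)]])
      fix s1 assume s1: "(s1 (s 0 + Suc t) \<noteq> 0 \<longleftrightarrow> fval inp (table R s) e f) \<and> unchanged_outside t (fheight f) s s1"
      then have L1: "s1 0 = s 0" using unchanged_outside_0 by blast
      have h1: "input_ok inp s1" "holds_env q e s1" using holds_env_unchanged input_ok_unchanged h s1 by blast+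
      have X1: "table R s1 = table R s" using table_unchanged[of t "fheight f" s s1 R] s1 h(5) by simp
      show "runs (Seq (compile_fm R (t + 1) g) (IfNZ (reg t) (set_reg t (reg (t + 1))) Skip)) s1 (poly p2 M + 20) ?Q"
      proof (rule runs_Seq[OF p2[OF h1 h(3), of "t + 1"]])
        fix s2 assume s2: "(s2 (s1 0 + Suc (t + 1)) \<noteq> 0 \<longleftrightarrow> fval inp (table R s1) e g) \<and> unchanged_outside (t + 1) (fheight g) s1 s2"
        then have L2: "s2 0 = s 0" using unchanged_outside_0 L1 by metis
        have t2: "s2 (s 0 + Suc t) = s1 (s 0 + Suc t)"
          using s2 L1 unchanged_outsideD[of "t+1" "fheight g" s1 s2 "s 0 + Suc t"] by auto
        have u: "unchanged_outside t (fheight (Conj f g)) s s2"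
          using s1 s2 L1 by (auto simp: unchanged_outside_def)
        show "runs (IfNZ (reg t) (set_reg t (reg (t + 1))) Skip) s2 20 ?Q"
          by (rule runs_If[where T = 10]; (rule runs_set_reg runs_Skip)?)
            (use u L1 L2 X1 t2 s1 s2 in \<open>auto simp: unchanged_outside_def\<close>)
      qed (use h in auto)
    qed (use h in auto)
  qed
  then show ?case by blast
next
  case (Exists j b f)
  then obtain pb pf where *: "tm_time q b pb" "fm_time R q f pf" using compile_tm_poly_time[of q b] by auto
  then have "fm_time R q (Exists j b f)
    (pb + [:26:] + (tval_poly b + 1) * ([:46:] + pcompose pf (tval_poly b + [:0, 1:])))"
    unfolding fm_time_def[of _ _ "Exists j b f"] using Exists.prems by (intro allI impI runs_compile_Ex) simp_all
  then show ?case by blast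
qed

section \<open>Least fixed points\<close>

definition init_env :: "nat \<Rightarrow> nat \<Rightarrow> nat \<Rightarrow> nat" where
  "init_env n p = (\<lambda>_. 0)(0 := n, 1 := p)"

text \<open>Pre-fixed points of the operator that \<open>f\<close> defines on sets of indices below
  the value of \<open>b\<close>. Variable 0 is the number of vertices and variable 1 the
  index.\<close>

definition closed_under :: "(nat \<Rightarrow> nat) \<Rightarrow> nat \<Rightarrow> tm \<Rightarrow> fm \<Rightarrow> nat set \<Rightarrow> bool" where
  "closed_under inp n b f X \<longleftrightarrow> (\<forall>p<tval (init_env n 0) b. fval inp X (init_env n p) f \<longrightarrow> p \<in> X)"

definition lfp_body :: "nat \<Rightarrow> nat \<Rightarrow> fm \<Rightarrow> ram_prog" where
  "lfp_body q R f = Seq (set_reg 1 (Minus (reg 1) (Const 1))) (Seq (compile_fm R (q + 2) f)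
     (IfNZ (reg (q + 2)) (Assign (tab_addr R 1) (Const 1)) Skip))"

definition lfp_round :: "nat \<Rightarrow> nat \<Rightarrow> fm \<Rightarrow> ram_prog" where
  "lfp_round q R f = Seq (set_reg q (Minus (reg q) (Const 1))) (Seq (set_reg 1 (reg (q + 1)))
     (WhileNZ (reg 1) (lfp_body q R f)))"

text \<open>Register 0 first counts the leading ones of the input, which gives n. Registers
  \<open>q\<close> and \<open>q + 1\<close> hold the remaining rounds and the table size, register 1
  the current index; scratch space starts at \<open>q + 2\<close> and the table at \<open>R\<close>.
  Cells behind the input are initially 0, so the table starts empty. The answer overwrites the input
  length only in the last assignment.\<close>

definition lfp_prog :: "nat \<Rightarrow> nat \<Rightarrow> tm \<Rightarrow> fm \<Rightarrow> fm \<Rightarrow> ram_prog" where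
  "lfp_prog q R b f g =
     Seq (WhileNZ (Mem (Plus (reg 0) (Const 1))) (set_reg 0 (Plus (reg 0) (Const 1))))
    (Seq (compile_tm (q + 1) b)
    (Seq (set_reg q (reg (q + 1)))
    (Seq (WhileNZ (reg q) (lfp_round q R f))
    (Seq (compile_fm R (q + 2) g) (Assign (Const 0) (reg (q + 2)))))))"

definition lfp_state :: "(nat \<Rightarrow> nat) \<Rightarrow> nat \<Rightarrow> nat \<Rightarrow> nat \<Rightarrow> nat \<Rightarrow> nat \<Rightarrow> nat \<Rightarrow> nat \<Rightarrow> nat set \<Rightarrow> memory \<Rightarrow> bool" where
  "lfp_state inp l q R n p r B X s \<longleftrightarrow> s 0 = l \<and> input_ok inp s \<and> holds_env q (init_env n p) s \<and>
     s (l + Suc q) = r \<and> s (l + Suc (q + 1)) = B \<and> table R s = X"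

lemma input_ok_upd:
  assumes "input_ok inp s" "s 0 < a"
  shows "input_ok inp (s(a := v))"
proof -
  have "(s(a := v)) a' = s a'" if "a' \<le> s 0" for a' using that assms(2) by auto
  moreover have "(s(a := v)) 0 = s 0" using assms(2) by simp
  ultimately show ?thesis using assms(1) unfolding input_ok_def by metis
qed

lemma table_upd_reg: "j < R \<Longrightarrow> table R (s(s 0 + Suc j := v)) = table R s"
  unfolding table_def by auto

lemma table_upd_insert: "table R (s(s 0 + Suc R + i := 1)) = insert i (table R s)"
  unfolding table_def by auto

lemma holds_env_upd: "holds_env q e s \<Longrightarrow> holds_env q (e(j := v)) (s(s 0 + Suc j := v))"
  unfolding holds_env_def by simp

lemma holds_env_upd_above: "holds_env q e s \<Longrightarrow> s 0 + q < a \<Longrightarrow> holds_env q e (s(a := v))"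
  unfolding holds_env_def by simp

lemma init_env_upd: "(init_env n p)(1 := p') = init_env n p'"
  by (simp add: init_env_def)

lemma init_env_simps [simp]: "init_env n p 0 = n" "init_env n p (Suc 0) = p"
  by (simp_all add: init_env_def)

lemma lfp_state_p:
  assumes "lfp_state inp l q R n p r B X s" "2 \<le> q"
  shows "s 0 = l" "s (l + Suc 1) = p"
proof -
  show l: "s 0 = l" using assms(1) by (simp add: lfp_state_def)
  have "\<forall>j<q. s (s 0 + Suc j) = init_env n p j"
    using assms(1) unfolding lfp_state_def holds_env_def by blast
  from this[rule_format, of 1] show "s (l + Suc 1) = p" using assms(2) l by simp
qed

lemma lfp_state_set_p:
  assumes "lfp_state inp l q R n p r B X s" "2 \<le> q" "q < R"
  shows "lfp_state inp l q R n p' r B X (s(l + Suc 1 := p'))"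
  using assms input_ok_upd[of inp s "l + Suc 1" p'] table_upd_reg[of 1 R s p']
    holds_env_upd[of q "init_env n p" s 1 p']
  unfolding lfp_state_def init_env_upd by auto

lemma lfp_state_set_r:
  assumes "lfp_state inp l q R n p r B X s" "2 \<le> q" "q < R"
  shows "lfp_state inp l q R n p r' B X (s(l + Suc q := r'))"
  using assms input_ok_upd[of inp s "l + Suc q" r'] table_upd_reg[of q R s r']
    holds_env_upd_above[of q "init_env n p" s "l + Suc q" r']
  unfolding lfp_state_def by auto

lemma lfp_state_insert:
  assumes "lfp_state inp l q R n p r B X s" "q + 1 < R"
  shows "lfp_state inp l q R n p r B (insert i X) (s(l + Suc R + i := 1))"
  using assms input_ok_upd[of inp s "l + Suc R + i" 1] table_upd_insert[of R s i]
    holds_env_upd_above[of q "init_env n p" s "l + Suc R + i" 1]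
  unfolding lfp_state_def by auto

lemma lfp_state_unchanged:
  assumes "lfp_state inp l q R n p r B X s" "unchanged_outside (q + 2) h s s'" "q + 2 + h \<le> R"
  shows "lfp_state inp l q R n p r B X s'"
proof -
  have l: "s 0 = l" using assms(1) by (simp add: lfp_state_def)
  have "s' (l + Suc q) = s (l + Suc q)" "s' (l + Suc (q + 1)) = s (l + Suc (q + 1))"
    using unchanged_outsideD[OF assms(2)] l by simp_all
  then show ?thesis
    using assms(1) input_ok_unchanged[OF _ assms(2)] holds_env_unchanged[OF _ assms(2)]
      table_unchanged[OF assms(2,3)] unchanged_outside_0[OF assms(2)]
    unfolding lfp_state_def by simp
qed

lemma runs_lfp_body:
  assumes f: "fm_time R q f pf" and q: "2 \<le> q" and R: "q + 2 + fheight f \<le> R"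
    and st: "lfp_state inp l q R n (Suc p) r B X s" and M: "n \<le> M" "p \<le> M"
  shows "runs (lfp_body q R f) s (poly pf M + 40)
    (lfp_state inp l q R n p r B (if fval inp X (init_env n p) f then insert p X else X))"
proof -
  have Rq: "q < R" "q + 1 < R" using R by simp_all
  let ?s1 = "s(l + Suc 1 := p)"
  have st1: "lfp_state inp l q R n p r B X ?s1" by (rule lfp_state_set_p[OF st q Rq(1)])
  have l: "s 0 = l" "s (l + Suc 1) = Suc p"
    by (rule lfp_state_p[OF st q])+
  have l1: "?s1 0 = l" using st1 by (simp add: lfp_state_def)
  have X1: "table R ?s1 = X" using st1 by (simp add: lfp_state_def)
  have run1: "runs (set_reg 1 (Minus (reg 1) (Const 1))) s 12 (\<lambda>s'. s' = ?s1)"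
    using l by (intro runs_set_reg) auto
  have eM: "\<forall>j<q. init_env n p j \<le> M" using M by (auto simp: init_env_def)
  have run2: "runs (compile_fm R (q + 2) f) ?s1 (poly pf M)
      (\<lambda>s'. (s' (l + Suc (q + 2)) \<noteq> 0 \<longleftrightarrow> fval inp X (init_env n p) f) \<and> unchanged_outside (q + 2) (fheight f) ?s1 s')"
    using fm_timeD[OF f _ _ eM _ R, of inp ?s1] st1 unfolding l1 X1 lfp_state_def by simp
  show ?thesis unfolding lfp_body_def
  proof (rule runs_Seq[OF run1])
    fix s1 assume "s1 = ?s1"
    then show "runs (Seq (compile_fm R (q + 2) f) (IfNZ (reg (q + 2)) (Assign (tab_addr R 1) (Const 1)) Skip)) s1
      (poly pf M + 28) (lfp_state inp l q R n p r B (if fval inp X (init_env n p) f then insert p X else X))"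
    proof (simp only:, intro runs_Seq[OF run2])
      fix s2 assume s2: "(s2 (l + Suc (q + 2)) \<noteq> 0 \<longleftrightarrow> fval inp X (init_env n p) f) \<and> unchanged_outside (q + 2) (fheight f) ?s1 s2"
      then have st2: "lfp_state inp l q R n p r B X s2" using lfp_state_unchanged[OF st1 _ R] by blast
      have l2: "s2 0 = l" "s2 (l + Suc 1) = p"
        by (rule lfp_state_p[OF st2 q])+
      show "runs (IfNZ (reg (q + 2)) (Assign (tab_addr R 1) (Const 1)) Skip) s2 28
        (lfp_state inp l q R n p r B (if fval inp X (init_env n p) f then insert p X else X))"
      proof (rule runs_If[where T = 20])
        assume "ram_val (reg (q + 2)) s2 \<noteq> 0"
        then have "fval inp X (init_env n p) f" using s2 l2(1) by simp
        then show "runs (Assign (tab_addr R 1) (Const 1)) s2 20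
          (lfp_state inp l q R n p r B (if fval inp X (init_env n p) f then insert p X else X))"
          using lfp_state_insert[OF st2 Rq(2), of p] l2 by (intro runs_Assign) (simp_all add: tab_addr_def)
      next
        assume "ram_val (reg (q + 2)) s2 = 0"
        then have "\<not> fval inp X (init_env n p) f" using s2 l2(1) by simp
        then show "runs Skip s2 20
          (lfp_state inp l q R n p r B (if fval inp X (init_env n p) f then insert p X else X))"
          using st2 by (intro runs_Skip) simp_all
      qed simp
    qed simp
  qed simp
qed

text \<open>The table is updated in place: a round that changes nothing shows that the table is closed.\<close>

lemma runs_lfp_round:
  fixes b n
  defines "B \<equiv> tval (init_env n 0) b"
  assumes f: "fm_time R q f pf" and q: "2 \<le> q" and R: "q + 2 + fheight f \<le> R"
    and mono: "\<And>X Y p. X \<subseteq> Y \<Longrightarrow> fval inp X (init_env n p) f \<Longrightarrow> fval inp Y (init_env n p) f"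
    and st: "lfp_state inp l q R n 0 (Suc r) B X s" and X: "X \<subseteq> {..<B}" and M: "n \<le> M" "B \<le> M"
  shows "runs (lfp_round q R f) s (22 + Suc B * (poly pf M + 46))
    (\<lambda>s'. \<exists>X'. lfp_state inp l q R n 0 r B X' s' \<and> X \<subseteq> X' \<and> X' \<subseteq> {..<B} \<and>
      (\<forall>Y. closed_under inp n b f Y \<longrightarrow> X \<subseteq> Y \<longrightarrow> X' \<subseteq> Y) \<and> (X' = X \<longrightarrow> closed_under inp n b f X))"
proof -
  have Rq: "q < R" using R by simp
  let ?s1 = "s(l + Suc q := r)"
  let ?s2 = "?s1(l + Suc 1 := B)"
  have st1: "lfp_state inp l q R n 0 r B X ?s1" by (rule lfp_state_set_r[OF st q Rq])
  have st2: "lfp_state inp l q R n B r B X ?s2" by (rule lfp_state_set_p[OF st1 q Rq])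
  have l: "s 0 = l" "s (l + Suc q) = Suc r" using st unfolding lfp_state_def by auto
  have l1: "?s1 0 = l" "?s1 (l + Suc (q + 1)) = B" using st1 unfolding lfp_state_def by auto
  \<comment> \<open>The last conjunct records that, as long as nothing has been inserted, all
    indices from \<open>i\<close> on were tested against the original table \<open>X\<close>; at
    \<open>i = 0\<close> this is closedness.\<close>
  define I where "I i s' \<longleftrightarrow> i \<le> B \<and> (\<exists>X'. lfp_state inp l q R n i r B X' s' \<and> X \<subseteq> X' \<and> X' \<subseteq> {..<B} \<and>
      (\<forall>Y. closed_under inp n b f Y \<longrightarrow> X \<subseteq> Y \<longrightarrow> X' \<subseteq> Y) \<and>
      (X' = X \<longrightarrow> (\<forall>p. i \<le> p \<longrightarrow> p < B \<longrightarrow> fval inp X (init_env n p) f \<longrightarrow> p \<in> X)))" for i s'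
  have run1: "runs (set_reg q (Minus (reg q) (Const 1))) s 12 (\<lambda>s'. s' = ?s1)"
    using l by (intro runs_set_reg) auto
  have run2: "runs (set_reg 1 (reg (q + 1))) ?s1 10 (\<lambda>s'. s' = ?s2)"
    using l1 by (intro runs_set_reg) auto
  have I2: "I B ?s2" unfolding I_def using st2 X by auto
  have "runs (WhileNZ (reg 1) (lfp_body q R f)) ?s2 (Suc B * (poly pf M + 46)) (I 0)"
  proof (rule runs_While[where I = I, OF I2])
    show "ram_val (reg 1) s' = 0 \<longleftrightarrow> i = 0" if "I i s'" for i s'
      using that lfp_state_p[OF _ q] unfolding I_def by fastforce
    show "runs (lfp_body q R f) s' (poly pf M + 40) (I i)" if Is: "I (Suc i) s'" for i s'
    proof -
      obtain X' where i: "Suc i \<le> B" and st': "lfp_state inp l q R n (Suc i) r B X' s'"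
        and X': "X \<subseteq> X'" "X' \<subseteq> {..<B}" "\<And>Y. closed_under inp n b f Y \<Longrightarrow> X \<subseteq> Y \<Longrightarrow> X' \<subseteq> Y"
        "X' = X \<Longrightarrow> (\<forall>p. Suc i \<le> p \<longrightarrow> p < B \<longrightarrow> fval inp X (init_env n p) f \<longrightarrow> p \<in> X)"
        using Is unfolding I_def by blast
      define X'' where "X'' = (if fval inp X' (init_env n i) f then insert i X' else X')"
      have "X'' \<subseteq> Y" if "closed_under inp n b f Y" "X \<subseteq> Y" for Y
      proof -
        have "X' \<subseteq> Y" using X'(3) that by blast
        moreover have "i \<in> Y" if "fval inp X' (init_env n i) f"
          using mono[OF \<open>X' \<subseteq> Y\<close> that] \<open>closed_under inp n b f Y\<close> i unfolding closed_under_def B_def by auto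
        ultimately show ?thesis unfolding X''_def by simp
      qed
      moreover have "p \<in> X" if "X'' = X" "i \<le> p" "p < B" "fval inp X (init_env n p) f" for p
      proof -
        have "X' = X" using that(1) X'(1) unfolding X''_def by (auto split: if_splits)
        then show ?thesis using X'(4) that unfolding X''_def
          by (cases "p = i") (auto split: if_splits)
      qed
      moreover have "X \<subseteq> X''" "X'' \<subseteq> {..<B}" using X'(1,2) i unfolding X''_def by auto
      ultimately have "I i s''" if "lfp_state inp l q R n i r B X'' s''" for s''
        unfolding I_def using that i by auto
      then show ?thesis
        using runs_lfp_body[OF f q R st' M(1), folded X''_def] i M(2) runs_mono by (metis Suc_leD order_refl order_trans)
    qed
  qed simp
  then have run3: "runs (WhileNZ (reg 1) (lfp_body q R f)) ?s2 (Suc B * (poly pf M + 46))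
    (\<lambda>s'. \<exists>X'. lfp_state inp l q R n 0 r B X' s' \<and> X \<subseteq> X' \<and> X' \<subseteq> {..<B} \<and>
      (\<forall>Y. closed_under inp n b f Y \<longrightarrow> X \<subseteq> Y \<longrightarrow> X' \<subseteq> Y) \<and> (X' = X \<longrightarrow> closed_under inp n b f X))"
    by (rule runs_mono) (auto simp: I_def closed_under_def B_def)
  show ?thesis unfolding lfp_round_def
    by (rule runs_Seq[OF run1], hypsubst, rule runs_Seq[OF run2], hypsubst, rule run3, rule order_refl) simp_all
qed

text \<open>A round that starts from a table not yet closed inserts at least one index, so as many
  rounds as there are indices suffice. The assumptions on \<open>w\<close> and \<open>n\<close> say
  that the input starts with n in unary; program and polynomial are chosen before them.\<close>

lemma lfp_poly_time:
  assumes q: "2 \<le> q" and b: "tvars_below q b" and f: "fvars_below q f" and g: "fvars_below q g"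
  shows "\<exists>c P. \<forall>w n. n < length w \<longrightarrow> (\<forall>i<n. w ! i) \<longrightarrow> \<not> w ! n \<longrightarrow>
    (\<forall>X Y p. X \<subseteq> Y \<longrightarrow> fval (initial_memory w) X (init_env n p) f \<longrightarrow> fval (initial_memory w) Y (init_env n p) f) \<longrightarrow>
    (\<exists>t s X. ram_exec c (initial_memory w) t s \<and> t \<le> poly P (length w) \<and>
       (s 0 \<noteq> 0 \<longleftrightarrow> fval (initial_memory w) X (init_env n 0) g) \<and>
       closed_under (initial_memory w) n b f X \<and>
       (\<forall>Y. closed_under (initial_memory w) n b f Y \<longrightarrow> X \<subseteq> Y))"
proof -
  define R where "R = q + 2 + theight b + fheight f + fheight g"
  obtain pb where pb: "tm_time q b pb" using compile_tm_poly_time[OF b] by blast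
  obtain pf where pf: "fm_time R q f pf" using compile_fm_poly_time[OF f] by blast
  obtain pg where pg: "fm_time R q g pg" using compile_fm_poly_time[OF g] by blast
  define PM where "PM = [:0, 1:] + tval_poly b"
  define P where "P = [:21, 21:] + pb + [:40:] + (1 + PM) * ([:40:] + (1 + PM) * (pcompose pf PM + [:46:])) + pcompose pg PM"
  define c where "c = lfp_prog q R b f g"
  have main: "\<exists>t s X. ram_exec c (initial_memory w) t s \<and> t \<le> poly P (length w) \<and>
       (s 0 \<noteq> 0 \<longleftrightarrow> fval (initial_memory w) X (init_env n 0) g) \<and>
       closed_under (initial_memory w) n b f X \<and>
       (\<forall>Y. closed_under (initial_memory w) n b f Y \<longrightarrow> X \<subseteq> Y)"
    if n: "n < length w" and w: "\<forall>i<n. w ! i" "\<not> w ! n"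
      and mono: "\<forall>X Y p. X \<subseteq> Y \<longrightarrow> fval (initial_memory w) X (init_env n p) f \<longrightarrow> fval (initial_memory w) Y (init_env n p) f"
    for w n
  proof -
    define l where "l = length w"
    define inp where "inp = initial_memory w"
    define B where "B = tval (init_env n 0) b"
    define M where "M = poly PM l"
    have Rq: "q < R" "q + 2 + fheight f \<le> R" "q + 2 + fheight g \<le> R" by (auto simp: R_def)
    have inp0: "inp 0 = l" "\<And>a. l < a \<Longrightarrow> inp a = 0" by (auto simp: inp_def initial_memory_def l_def)
    have inpn: "inp (Suc i) \<noteq> 0 \<longleftrightarrow> i \<noteq> n" if "i \<le> n" for i
      using that n w by (cases "i = n") (auto simp: inp_def initial_memory_def)
    have nM: "n \<le> M" using n by (simp add: M_def PM_def l_def)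
    have e0: "\<forall>j<q. init_env n 0 j \<le> l" using n by (auto simp: init_env_def l_def)
    have BM: "B \<le> M" using tval_le_poly[OF b e0] by (simp add: B_def M_def PM_def)
    have sn: "input_ok inp (inp(l + Suc 0 := v))" for v
      by (rule input_ok_upd) (auto simp: input_ok_def inp0)
    let ?s1 = "inp(l + Suc 0 := n)"
    define I where "I i s \<longleftrightarrow> i \<le> n \<and> s = inp(l + Suc 0 := n - i)" for i s
    have run1: "runs (WhileNZ (Mem (Plus (reg 0) (Const 1))) (set_reg 0 (Plus (reg 0) (Const 1)))) inp
      (21 * l + 21) (\<lambda>s. s = ?s1)"
    proof (rule runs_mono[OF runs_While[where I = I and i = n and T = 12]])
      show "I n inp" using inp0 by (auto simp: I_def fun_upd_idem)
      show "ram_val (Mem (Plus (reg 0) (Const 1))) s = 0 \<longleftrightarrow> i = 0" if "I i s" for i s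
        using that inpn[of "n - i"] inp0 n by (auto simp: I_def l_def)
      show "runs (set_reg 0 (Plus (reg 0) (Const 1))) s 12 (I i)" if "I (Suc i) s" for i s
        using that inp0 by (intro runs_set_reg) (auto simp: I_def Suc_diff_Suc)
      show "Suc n * (exp_cost (Mem (Plus (reg 0) (Const 1))) + 1 + 12) \<le> 21 * l + 21"
        using n by (simp add: l_def)
    qed (use n in \<open>auto simp: I_def l_def\<close>)
    have l1: "?s1 0 = l" using inp0 by simp
    have env1: "holds_env q (init_env n 0) ?s1"
      using inp0 by (auto simp: holds_env_def init_env_def)
    have run2: "runs (compile_tm (q + 1) b) ?s1 (poly pb l)
      (\<lambda>s'. s' (l + Suc (q + 1)) = B \<and> unchanged_outside (q + 1) (theight b) ?s1 s')"
      using tm_timeD[OF pb env1 e0, of "q + 1"] unfolding l1 B_def by simp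
    have run3: "runs (set_reg q (reg (q + 1))) s 10 (lfp_state inp l q R n 0 B B {})"
      if s: "s (l + Suc (q + 1)) = B \<and> unchanged_outside (q + 1) (theight b) ?s1 s" for s
    proof -
      have l2: "s 0 = l" using s unchanged_outside_0 l1 by metis
      have in2: "input_ok inp s" using input_ok_unchanged[OF sn] s by blast
      have en2: "holds_env q (init_env n 0) s" using holds_env_unchanged[OF env1] s by auto
      have "table R s = table R ?s1" using table_unchanged[of "q + 1" "theight b" ?s1 s R] s by (simp add: R_def)
      also have "\<dots> = {}" using inp0 Rq(1) by (auto simp: table_def)
      finally have "lfp_state inp l q R n 0 (s (l + Suc q)) B {} s"
        using l2 in2 en2 s unfolding lfp_state_def by simp
      then have "lfp_state inp l q R n 0 B B {} (s(l + Suc q := B))" by (rule lfp_state_set_r[OF _ q Rq(1)])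
      then show ?thesis using l2 s by (intro runs_set_reg) auto
    qed
    \<comment> \<open>With \<open>i\<close> rounds left, either \<open>B - i\<close> indices have
      been inserted or the table is closed already. At \<open>i = 0\<close> the first alternative
      means that the table is full, hence closed.\<close>
    define J where "J i s \<longleftrightarrow> i \<le> B \<and> (\<exists>X. lfp_state inp l q R n 0 i B X s \<and> X \<subseteq> {..<B} \<and>
      (\<forall>Y. closed_under inp n b f Y \<longrightarrow> X \<subseteq> Y) \<and> (B - i \<le> card X \<or> closed_under inp n b f X))" for i s
    define K where "K s \<longleftrightarrow> (\<exists>X. lfp_state inp l q R n 0 0 B X s \<and> closed_under inp n b f X \<and>
      (\<forall>Y. closed_under inp n b f Y \<longrightarrow> X \<subseteq> Y))" for s
    have run4: "runs (WhileNZ (reg q) (lfp_round q R f)) s (Suc B * (28 + Suc B * (poly pf M + 46))) K"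
      if st: "lfp_state inp l q R n 0 B B {} s" for s
    proof (rule runs_mono[OF runs_While[where I = J and i = B and T = "22 + Suc B * (poly pf M + 46)"]])
      show "J B s" using st by (auto simp: J_def)
      show "ram_val (reg q) s = 0 \<longleftrightarrow> i = 0" if "J i s" for i s
        using that by (auto simp: J_def lfp_state_def)
      show "runs (lfp_round q R f) s (22 + Suc B * (poly pf M + 46)) (J i)" if Js: "J (Suc i) s" for i s
      proof -
        obtain X where X: "lfp_state inp l q R n 0 (Suc i) B X s" "X \<subseteq> {..<B}"
          "\<And>Y. closed_under inp n b f Y \<Longrightarrow> X \<subseteq> Y" "B - Suc i \<le> card X \<or> closed_under inp n b f X" and i: "Suc i \<le> B"
          using Js unfolding J_def by blast
        have "runs (lfp_round q R f) s (22 + Suc B * (poly pf M + 46))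
          (\<lambda>s'. \<exists>X'. lfp_state inp l q R n 0 i B X' s' \<and> X \<subseteq> X' \<and> X' \<subseteq> {..<B} \<and>
            (\<forall>Y. closed_under inp n b f Y \<longrightarrow> X \<subseteq> Y \<longrightarrow> X' \<subseteq> Y) \<and> (X' = X \<longrightarrow> closed_under inp n b f X))"
          unfolding B_def
          by (rule runs_lfp_round[OF pf q Rq(2)])
            (use mono X(1,2) nM BM in \<open>auto simp: B_def inp_def\<close>)
        then show ?thesis
        proof (rule runs_mono)
          fix s' assume "\<exists>X'. lfp_state inp l q R n 0 i B X' s' \<and> X \<subseteq> X' \<and> X' \<subseteq> {..<B} \<and>
            (\<forall>Y. closed_under inp n b f Y \<longrightarrow> X \<subseteq> Y \<longrightarrow> X' \<subseteq> Y) \<and> (X' = X \<longrightarrow> closed_under inp n b f X)"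
          then obtain X' where X': "lfp_state inp l q R n 0 i B X' s'" "X \<subseteq> X'" "X' \<subseteq> {..<B}"
            "\<And>Y. closed_under inp n b f Y \<Longrightarrow> X \<subseteq> Y \<Longrightarrow> X' \<subseteq> Y" "X' = X \<Longrightarrow> closed_under inp n b f X" by blast
          have "B - i \<le> card X' \<or> closed_under inp n b f X'"
          proof (cases "X' = X")
            case False
            then have ncl: "\<not> closed_under inp n b f X" using X'(2) X'(4)[of X] by blast
            have "card X < card X'" using False X'(2,3) by (intro psubset_card_mono) (auto intro: finite_subset)
            then show ?thesis using X(4) ncl by linarith
          qed (use X'(5) in simp)
          then show "J i s'" unfolding J_def using X' X(3) i by auto
        qed simp
      qed
      show "K s'" if J0: "J 0 s'" for s'
      proof -
        obtain X where X: "lfp_state inp l q R n 0 0 B X s'" "X \<subseteq> {..<B}"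
          "\<forall>Y. closed_under inp n b f Y \<longrightarrow> X \<subseteq> Y" "B \<le> card X \<or> closed_under inp n b f X"
          using J0 unfolding J_def by auto
        have "X = {..<B}" if "B \<le> card X"
          using card_seteq[of "{..<B}" X] X(2) that by simp
        then have "closed_under inp n b f X" using X(4) by (auto simp: closed_under_def B_def)
        then show ?thesis unfolding K_def using X by blast
      qed
    qed auto
    define Q where "Q s \<longleftrightarrow> (\<exists>X. (s 0 \<noteq> 0 \<longleftrightarrow> fval inp X (init_env n 0) g) \<and> closed_under inp n b f X \<and>
      (\<forall>Y. closed_under inp n b f Y \<longrightarrow> X \<subseteq> Y))" for s :: memory
    have run5: "runs (Seq (compile_fm R (q + 2) g) (Assign (Const 0) (reg (q + 2)))) s (poly pg M + 10) Q"
      if Ks: "K s" for s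
    proof -
      obtain X where st: "lfp_state inp l q R n 0 0 B X s" and X: "closed_under inp n b f X"
        "\<forall>Y. closed_under inp n b f Y \<longrightarrow> X \<subseteq> Y" using Ks unfolding K_def by blast
      have eM: "\<forall>j<q. init_env n 0 j \<le> M" using nM by (auto simp: init_env_def)
      have st': "s 0 = l" "input_ok inp s" "holds_env q (init_env n 0) s" "table R s = X"
        using st unfolding lfp_state_def by auto
      have "runs (compile_fm R (q + 2) g) s (poly pg M)
        (\<lambda>s'. (s' (l + Suc (q + 2)) \<noteq> 0 \<longleftrightarrow> fval inp X (init_env n 0) g) \<and> unchanged_outside (q + 2) (fheight g) s s')"
        using fm_timeD[OF pg st'(2,3) eM _ Rq(3)] unfolding st'(1,4) by simp
      then show ?thesis
      proof (rule runs_Seq)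
        fix s' assume s': "(s' (l + Suc (q + 2)) \<noteq> 0 \<longleftrightarrow> fval inp X (init_env n 0) g) \<and> unchanged_outside (q + 2) (fheight g) s s'"
        then have "s' 0 = l" using unchanged_outside_0 st'(1) by metis
        then show "runs (Assign (Const 0) (reg (q + 2))) s' 10 Q"
          using s' X by (intro runs_Assign) (auto simp: Q_def)
      qed simp
    qed
    have "runs c inp ((21 * l + 21) + (poly pb l + (10 + (Suc B * (28 + Suc B * (poly pf M + 46)) + (poly pg M + 10))))) Q"
      unfolding c_def lfp_prog_def
    proof (rule runs_Seq[OF run1])
      fix s assume s: "s = ?s1"
      show "runs (Seq (compile_tm (q + 1) b) (Seq (set_reg q (reg (q + 1))) (Seq (WhileNZ (reg q) (lfp_round q R f))
         (Seq (compile_fm R (q + 2) g) (Assign (Const 0) (reg (q + 2))))))) s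
         (poly pb l + (10 + (Suc B * (28 + Suc B * (poly pf M + 46)) + (poly pg M + 10)))) Q"
        unfolding s
        by (rule runs_Seq[OF run2], rule runs_Seq[OF run3], assumption, rule runs_Seq[OF run4], assumption,
            rule run5, assumption, (rule order_refl)+)
    qed simp
    then obtain t s where ts: "ram_exec c inp t s" "Q s"
      "t \<le> (21 * l + 21) + (poly pb l + (10 + (Suc B * (28 + Suc B * (poly pf M + 46)) + (poly pg M + 10))))"
      unfolding runs_def by blast
    have "Suc B * (28 + Suc B * (poly pf M + 46)) \<le> Suc M * (40 + Suc M * (poly pf M + 46))"
      using BM by (intro mult_mono add_mono) auto
    then have "t \<le> poly P l"
      using ts(3) unfolding P_def by (simp add: poly_pcompose M_def[symmetric])
    then show ?thesis using ts(1,2) unfolding Q_def inp_def l_def by blast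
  qed
  show ?thesis by (rule exI[of _ c], rule exI[of _ P], intro allI impI, rule main; assumption)
qed

section \<open>Colours compatible with a coloured odd closed walk\<close>

text \<open>There is a walk of length \<open>d\<close> from \<open>x\<close> to \<open>y\<close> in
  the cycle of residues modulo \<open>m\<close>: \<open>h\<close> is its signed displacement, the
  number of forward steps minus the number of backward steps.\<close>

definition has_walk :: "nat \<Rightarrow> nat \<Rightarrow> int \<Rightarrow> int \<Rightarrow> bool" where
  "has_walk m d x y \<longleftrightarrow> (\<exists>h::int. \<bar>h\<bar> \<le> int d \<and> even (h - int d) \<and> int m dvd y - x - h)"

definition step_mod :: "nat \<Rightarrow> int \<Rightarrow> int \<Rightarrow> bool" where
  "step_mod m x y \<longleftrightarrow> int m dvd y - x - 1 \<or> int m dvd y - x + 1"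

lemma small_dvd_eq_0: "int m dvd x \<Longrightarrow> \<bar>x\<bar> < int m \<Longrightarrow> x = 0"
  using zdvd_not_zless[of "\<bar>x\<bar>" "int m"] by fastforce

lemma dvd_congruent_iff:
  fixes x y m :: int
  assumes "m dvd x - y"
  shows "m dvd x \<longleftrightarrow> m dvd y"
  using dvd_add_right_iff[OF assms, of y] by simp

text \<open>Three distinct residues within distance one of \<open>z\<close> are z - 1, z and z + 1,
  and since m >= 5 only the middle one is adjacent to both others. Hence which of them equals
  \<open>z\<close> can be told from the triple alone; this allows different values of
  \<open>z\<close> to be compared.\<close>

lemma centre_iff_adjacent:
  fixes a b c z :: int
  assumes m: "5 \<le> m"
    and distinct: "\<not> int m dvd a - b" "\<not> int m dvd a - c" "\<not> int m dvd b - c"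
    and near: "\<And>x. x \<in> {a, b, c} \<Longrightarrow> int m dvd x - z \<or> int m dvd x - z - 1 \<or> int m dvd x - z + 1"
  shows "int m dvd a - z \<longleftrightarrow> step_mod m a b \<and> step_mod m a c"
proof -
  have ex: "\<exists>e\<in>{-1, 0, 1}. int m dvd x - z - e" if "x \<in> {a, b, c}" for x
    using near[OF that] by auto
  obtain e1 where e1: "e1 \<in> {-1, 0, 1}" "int m dvd a - z - e1" using ex[of a] by blast
  obtain e2 where e2: "e2 \<in> {-1, 0, 1}" "int m dvd b - z - e2" using ex[of b] by blast
  obtain e3 where e3: "e3 \<in> {-1, 0, 1}" "int m dvd c - z - e3" using ex[of c] by blast
  note e = e1(1) e2(1) e3(1) and d = e1(2) e2(2) e3(2)
  have ab: "int m dvd b - a + h \<longleftrightarrow> int m dvd e2 - e1 + h" for h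
  proof -
    have "int m dvd (b - a + h) - (e2 - e1 + h)"
      using dvd_diff[OF d(2) d(1)] by (simp add: algebra_simps)
    then show ?thesis by (rule dvd_congruent_iff)
  qed
  have ac: "int m dvd c - a + h \<longleftrightarrow> int m dvd e3 - e1 + h" for h
  proof -
    have "int m dvd (c - a + h) - (e3 - e1 + h)"
      using dvd_diff[OF d(3) d(1)] by (simp add: algebra_simps)
    then show ?thesis by (rule dvd_congruent_iff)
  qed
  have bc: "int m dvd c - b + h \<longleftrightarrow> int m dvd e3 - e2 + h" for h
  proof -
    have "int m dvd (c - b + h) - (e3 - e2 + h)"
      using dvd_diff[OF d(3) d(2)] by (simp add: algebra_simps)
    then show ?thesis by (rule dvd_congruent_iff)
  qed
  have small: "int m dvd h \<longleftrightarrow> h = 0" if "\<bar>h\<bar> \<le> 4" for h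
    using small_dvd_eq_0[of m h] that m by auto
  have az: "int m dvd a - z \<longleftrightarrow> e1 = 0"
  proof -
    have "int m dvd a - z \<longleftrightarrow> int m dvd e1" using dvd_congruent_iff[OF d(1)] .
    then show ?thesis using small[of e1] e(1) by auto
  qed
  have "e1 \<noteq> e2" "e1 \<noteq> e3" "e2 \<noteq> e3"
    using ab[of 0] ac[of 0] bc[of 0] distinct by (auto simp: dvd_diff_commute)
  then have 1: "e1 = 0 \<longleftrightarrow> (e2 - e1 - 1 = 0 \<or> e2 - e1 + 1 = 0) \<and> (e3 - e1 - 1 = 0 \<or> e3 - e1 + 1 = 0)"
    using e by auto
  have 2: "step_mod m a b \<longleftrightarrow> e2 - e1 - 1 = 0 \<or> e2 - e1 + 1 = 0"
    unfolding step_mod_def using ab[of "-1"] ab[of 1] small[of "e2 - e1 - 1"] small[of "e2 - e1 + 1"] e by auto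
  have 3: "step_mod m a c \<longleftrightarrow> e3 - e1 - 1 = 0 \<or> e3 - e1 + 1 = 0"
    unfolding step_mod_def using ac[of "-1"] ac[of 1] small[of "e3 - e1 - 1"] small[of "e3 - e1 + 1"] e by auto
  show ?thesis unfolding az 1 2 3 ..
qed

lemma small_multiple_cases:
  "int m dvd x \<Longrightarrow> \<bar>x\<bar> < 2 * int m \<Longrightarrow> x = 0 \<or> x = int m \<or> x = - int m"
proof -
  assume "int m dvd x" and b: "\<bar>x\<bar> < 2 * int m"
  then obtain q where q: "x = int m * q" by blast
  have "\<bar>q\<bar> * int m < 2 * int m" using b by (simp add: q abs_mult mult.commute)
  then have "\<bar>q\<bar> < 2" by (simp add: mult_less_cancel_right)
  then have "q = 0 \<or> q = 1 \<or> q = -1" by auto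
  then show ?thesis using q by auto
qed

text \<open>Since \<open>m\<close> is odd, parity rules out m and -m. This is the source of the
  uniqueness of offsets.\<close>

lemma even_small_multiple_eq_0:
  "int m dvd x \<Longrightarrow> odd m \<Longrightarrow> even x \<Longrightarrow> \<bar>x\<bar> < 2 * int m \<Longrightarrow> x = 0"
  using small_multiple_cases[of m x] by auto

text \<open>\<open>\<Phi>\<close> is the lift to the integers of a closed walk in the cycle, \<open>s\<close> its steps and \<open>d i\<close> the
  distance of a fixed vertex to the \<open>i\<close>-th vertex of the walk. A colour \<open>a\<close> of the fixed vertex is
  lifted to \<open>p i\<close> close to \<open>\<Phi> i\<close>; the lift jumps by \<open>\<plusminus>m\<close> exactly where \<open>d\<close> is stationary.\<close>

lemma lifted_colour_jumps:
  fixes \<Phi> s :: "nat \<Rightarrow> int" and d :: "nat \<Rightarrow> nat" and k l m :: nat and a :: int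
  assumes k: "2 \<le> k" and m: "m = 2 * k + 1"
    and s: "\<And>i. i < l \<Longrightarrow> s i = 1 \<or> s i = -1"
    and \<Phi>: "\<And>i. i < l \<Longrightarrow> \<Phi> (Suc i) = \<Phi> i + s i"
    and closed: "int m dvd \<Phi> l - \<Phi> 0"
    and d: "\<And>i. i \<le> l \<Longrightarrow> d i \<le> k + 1" "\<And>i. i < l \<Longrightarrow> d (Suc i) \<le> Suc (d i) \<and> d i \<le> Suc (d (Suc i))" "d l = d 0"
    and a: "\<And>i. i \<le> l \<Longrightarrow> has_walk m (d i) (\<Phi> i) a"
  shows "\<exists>\<delta>. (\<Sum>i<l. \<delta> i) = \<Phi> l - \<Phi> 0 \<and> (\<forall>i<l. d (Suc i) \<noteq> d i \<longrightarrow> \<delta> i = 0) \<and>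
    (\<forall>i<l. d (Suc i) = d i \<longrightarrow>
       (let z = (if s i = 1 then \<Phi> i - int k else \<Phi> i - int k - 1) in
         (d i = k \<and> int m dvd a - z) \<or>
         (d i = k + 1 \<and> int m dvd a - z \<and> \<delta> i = - s i * int m) \<or>
         (d i = k + 1 \<and> (int m dvd a - z - 1 \<or> int m dvd a - z + 1) \<and> \<delta> i = s i * int m)))"
proof -
  have "\<forall>i\<in>{..l}. \<exists>h. \<bar>h\<bar> \<le> int (d i) \<and> even (h - int (d i)) \<and> int m dvd a - \<Phi> i - h"
    using a unfolding has_walk_def by auto
  then obtain h where h: "\<And>i. i \<le> l \<Longrightarrow> \<bar>h i\<bar> \<le> int (d i)" "\<And>i. i \<le> l \<Longrightarrow> even (h i - int (d i))"
    "\<And>i. i \<le> l \<Longrightarrow> int m dvd a - \<Phi> i - h i"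
    by (metis atMost_iff)
  define p where "p i = \<Phi> i + h i" for i
  define \<delta> where "\<delta> i = p (Suc i) - p i" for i
  have oddm: "odd m" using m by simp
  \<comment> \<open>After one turn around the closed walk the offset returns to its initial value,
    so the lift \<open>p\<close> of the colour advances exactly as far as the lift
    \<open>\<Phi>\<close> of the walk.\<close>
  have "h l = h 0"
  proof -
    have "int m dvd (h l - h 0)"
    proof -
      have "int m dvd (a - \<Phi> 0 - h 0) - (a - \<Phi> l - h l) - (\<Phi> l - \<Phi> 0)"
        by (intro dvd_diff[OF dvd_diff] h(3) closed) simp_all
      then show ?thesis by simp
    qed
    moreover have "even (h l - h 0)" using h(2)[of 0] h(2)[of l] d(3) by auto
    moreover have "\<bar>h l - h 0\<bar> < 2 * int m" using h(1)[of 0] h(1)[of l] d(1)[of 0] d(3) m k by auto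
    ultimately show ?thesis using even_small_multiple_eq_0[of m "h l - h 0"] oddm by auto
  qed
  moreover have "(\<Sum>i<l. \<delta> i) = p l - p 0" unfolding \<delta>_def by (rule sum_lessThan_telescope)
  ultimately have sum: "(\<Sum>i<l. \<delta> i) = \<Phi> l - \<Phi> 0" by (simp add: p_def)
  have \<delta>h: "\<delta> i = s i + h (Suc i) - h i" if "i < l" for i
    using \<Phi>[OF that] by (simp add: \<delta>_def p_def)
  have \<delta>: "\<delta> i = 0 \<or> \<delta> i = int m \<or> \<delta> i = - int m" if i: "i < l" for i
  proof (rule small_multiple_cases)
    have "int m dvd (a - \<Phi> i - h i) - (a - \<Phi> (Suc i) - h (Suc i))"
      by (intro dvd_diff h(3)) (use i in auto)
    then show "int m dvd \<delta> i" by (simp add: \<delta>_def p_def algebra_simps)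
    show "\<bar>\<delta> i\<bar> < 2 * int m"
      using \<delta>h[OF i] s[OF i] h(1)[of i] h(1)[of "Suc i"] d(1)[of i] d(1)[of "Suc i"] i m k by auto
  qed
  \<comment> \<open>The step of the walk is odd and each offset has the parity of its distance, so
    the jump is odd exactly where the distance does not change. With \<open>\<delta> i\<close> in
    {0, m, -m} and m odd, this decides whether there is a jump.\<close>
  have par: "even (\<delta> i) \<longleftrightarrow> d (Suc i) \<noteq> d i" if i: "i < l" for i
  proof -
    have "d (Suc i) = d i \<or> d (Suc i) = Suc (d i) \<or> d i = Suc (d (Suc i))" using d(2)[OF i] by linarith
    moreover have "even (\<delta> i) \<longleftrightarrow> odd (int (d (Suc i)) + int (d i))"
      using \<delta>h[OF i] s[OF i] h(2)[of i] h(2)[of "Suc i"] i by auto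
    ultimately show ?thesis by auto
  qed
  \<comment> \<open>\<open>z\<close> is the vertex of the cycle opposite the walk edge, at distance
    k from both its ends: modulo m, \<open>\<Phi> i - k\<close> equals
    \<open>\<Phi> i + 1 + k\<close>, and \<open>\<Phi> i - k - 1\<close> equals
    \<open>\<Phi> i + k\<close>.\<close>
  have "let z = (if s i = 1 then \<Phi> i - int k else \<Phi> i - int k - 1) in
         (d i = k \<and> int m dvd a - z) \<or>
         (d i = k + 1 \<and> int m dvd a - z \<and> \<delta> i = - s i * int m) \<or>
         (d i = k + 1 \<and> (int m dvd a - z - 1 \<or> int m dvd a - z + 1) \<and> \<delta> i = s i * int m)"
    if i: "i < l" and di: "d (Suc i) = d i" for i
  proof -
    have odd: "odd (\<delta> i)" using par[OF i] di by simp
    then have \<delta>i: "\<delta> i = int m \<or> \<delta> i = - int m" using \<delta>[OF i] by auto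
    have h1: "\<bar>h i\<bar> \<le> int (d i)" "\<bar>h (Suc i)\<bar> \<le> int (d i)" "d i \<le> k + 1"
      using h(1)[of i] h(1)[of "Suc i"] d(1)[of i] i di by auto
    have ev: "even (h i - int (d i))" using h(2)[of i] i by simp
    have dv: "int m dvd a - \<Phi> i - h i" using h(3)[of i] i by simp
    have dv2: "int m dvd a - \<Phi> i - h i + int m" using dv by simp
    \<comment> \<open>A jump has size at most 1 + 2 \<open>d i\<close>, so a jump of size 2k + 1
      forces \<open>d i\<close> to be at least k; the assumed bound on distances leaves two
      values.\<close>
    have dk: "d i = k \<or> d i = k + 1" using h1 \<delta>h[OF i] s[OF i] \<delta>i m by linarith
    show ?thesis
    proof (cases "s i = 1")
      case True
      consider "d i = k" "\<delta> i = int m" "h i = - int k"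
        | "d i = k + 1" "\<delta> i = int m" "h i = - int k - 1 \<or> h i = - int k + 1"
        | "d i = k + 1" "\<delta> i = - int m" "h i = int k + 1"
      proof -
        have "d i = k \<Longrightarrow> \<delta> i = int m \<and> h i = - int k"
          using h1 \<delta>h[OF i] True \<delta>i m by linarith
        moreover have "d i = k + 1 \<Longrightarrow> \<delta> i = - int m \<Longrightarrow> h i = int k + 1"
          using h1 \<delta>h[OF i] True m by linarith
        moreover have "h i = - int k - 1 \<or> h i = - int k + 1" if "d i = k + 1" "\<delta> i = int m"
        proof -
          have "- int k - 1 \<le> h i" "h i \<le> - int k + 1" using h1 \<delta>h[OF i] True m that by linarith+
          moreover have "h i \<noteq> - int k" using ev that by auto
          ultimately show ?thesis by linarith
        qed
        ultimately show thesis using that dk \<delta>i by blast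
      qed
      then show ?thesis
      proof cases
        case 1
        then have eq: "a - (\<Phi> i - int k) = a - \<Phi> i - h i" by simp
        have "int m dvd a - (\<Phi> i - int k)" unfolding eq by (rule dv)
        then show ?thesis using 1 True unfolding Let_def by simp
      next
        case 2
        then have "a - (\<Phi> i - int k) + 1 = a - \<Phi> i - h i \<or> a - (\<Phi> i - int k) - 1 = a - \<Phi> i - h i" by auto
        then have "int m dvd a - (\<Phi> i - int k) - 1 \<or> int m dvd a - (\<Phi> i - int k) + 1"
          using dv by presburger
        then show ?thesis using 2 True unfolding Let_def by simp
      next
        case 3
        then have eq: "a - (\<Phi> i - int k) = a - \<Phi> i - h i + int m" using m by simp
        have "int m dvd a - (\<Phi> i - int k)" unfolding eq by (rule dv2)
        then show ?thesis using 3 True unfolding Let_def by simp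
      qed
    next
      case False
      then have sm: "s i = -1" using s[OF i] by simp
      consider "d i = k" "\<delta> i = - int m" "h i = int k"
        | "d i = k + 1" "\<delta> i = - int m" "h i = int k - 1 \<or> h i = int k + 1"
        | "d i = k + 1" "\<delta> i = int m" "h i = - int k - 1"
      proof -
        have "d i = k \<Longrightarrow> \<delta> i = - int m \<and> h i = int k"
          using h1 \<delta>h[OF i] sm \<delta>i m by linarith
        moreover have "d i = k + 1 \<Longrightarrow> \<delta> i = int m \<Longrightarrow> h i = - int k - 1"
          using h1 \<delta>h[OF i] sm m by linarith
        moreover have "h i = int k - 1 \<or> h i = int k + 1" if "d i = k + 1" "\<delta> i = - int m"
        proof -
          have "int k - 1 \<le> h i" "h i \<le> int k + 1" using h1 \<delta>h[OF i] sm m that by linarith+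
          moreover have "h i \<noteq> int k" using ev that by auto
          ultimately show ?thesis by linarith
        qed
        ultimately show thesis using that dk \<delta>i by blast
      qed
      then show ?thesis
      proof cases
        case 1
        then have eq: "a - (\<Phi> i - int k - 1) = a - \<Phi> i - h i + int m" using m by simp
        have "int m dvd a - (\<Phi> i - int k - 1)" unfolding eq by (rule dv2)
        then show ?thesis using 1 sm unfolding Let_def by simp
      next
        case 2
        then have "a - (\<Phi> i - int k - 1) + 1 = a - \<Phi> i - h i + int m \<or> a - (\<Phi> i - int k - 1) - 1 = a - \<Phi> i - h i + int m"
          using m by auto
        then have "int m dvd a - (\<Phi> i - int k - 1) - 1 \<or> int m dvd a - (\<Phi> i - int k - 1) + 1"
          using dv2 by presburger
        then show ?thesis using 2 sm unfolding Let_def by simp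
      next
        case 3
        then have eq: "a - (\<Phi> i - int k - 1) = a - \<Phi> i - h i" by simp
        have "int m dvd a - (\<Phi> i - int k - 1)" unfolding eq by (rule dv)
        then show ?thesis using 3 sm unfolding Let_def by simp
      qed
    qed
  qed
  moreover have "\<delta> i = 0" if "i < l" "d (Suc i) \<noteq> d i" for i
    using \<delta>[OF that(1)] par[OF that(1)] that(2) m by auto
  ultimately show ?thesis using sum by blast
qed

text \<open>Suppose there are three distinct colours. At each stationary edge of the walk all three
  are within distance one of the opposite vertex \<open>w i\<close>, so exactly one equals it, and
  by \<open>centre_iff_adjacent\<close> it is the same colour at every such edge. Summing the jumps
  gives T = -m S for this central colour and T = m S for the other two, where T is the total advance
  of the lifted walk and S the sum of its steps over the stationary edges. So T = -T, but T has the
  parity of the odd length \<open>l\<close>.\<close>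

lemma at_most_two_colours:
  fixes c :: "nat \<Rightarrow> int" and d :: "nat \<Rightarrow> nat" and k l m :: nat and x y z :: int
  assumes k: "2 \<le> k" and m: "m = 2 * k + 1" and l: "odd l"
    and c: "\<And>i. i < l \<Longrightarrow> step_mod m (c i) (c (Suc i))" "c l = c 0"
    and d: "\<And>i. i \<le> l \<Longrightarrow> d i \<le> k + 1" "\<And>i. i < l \<Longrightarrow> d (Suc i) \<le> Suc (d i) \<and> d i \<le> Suc (d (Suc i))" "d l = d 0"
    and walks: "\<And>i a. i \<le> l \<Longrightarrow> a \<in> {x, y, z} \<Longrightarrow> has_walk m (d i) (c i) a"
  shows "int m dvd x - y \<or> int m dvd x - z \<or> int m dvd y - z"
proof (rule ccontr)
  assume "\<not> ?thesis"
  then have dist: "\<not> int m dvd x - y" "\<not> int m dvd x - z" "\<not> int m dvd y - z" by auto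
  define s where "s i = (if int m dvd c (Suc i) - c i - 1 then 1 else - 1 :: int)" for i
  define \<Phi> where "\<Phi> i = c 0 + (\<Sum>j<i. s j)" for i
  have lift: "int m dvd \<Phi> i - c i" if "i \<le> l" for i
    using that
  proof (induction i)
    case (Suc i)
    have "int m dvd c (Suc i) - c i - s i" using c(1)[of i] Suc.prems by (auto simp: s_def step_mod_def)
    moreover have "int m dvd \<Phi> i - c i" using Suc by simp
    ultimately have "int m dvd (\<Phi> i - c i) - (c (Suc i) - c i - s i)" by (rule dvd_diff[rotated])
    then show ?case by (simp add: \<Phi>_def algebra_simps)
  qed (simp add: \<Phi>_def)
  define T where "T = \<Phi> l - \<Phi> 0"
  have closed: "int m dvd \<Phi> l - \<Phi> 0" using lift[of l] lift[of 0] c(2) by (auto simp: \<Phi>_def)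
  \<comment> \<open>All steps are odd, so the advance of the lift has the parity of the number of
    steps; an odd closed walk therefore has nonzero winding number.\<close>
  have "odd (\<Sum>j<i. s j) \<longleftrightarrow> odd i" for i by (induction i) (auto simp: s_def)
  then have "odd T" using l by (simp add: T_def \<Phi>_def)
  then have T0: "T \<noteq> 0" by auto
  have walk: "has_walk m (d i) (\<Phi> i) a" if ia: "i \<le> l" "a \<in> {x, y, z}" for i a
  proof -
    obtain h where h: "\<bar>h\<bar> \<le> int (d i)" "even (h - int (d i))" "int m dvd a - c i - h"
      using walks[OF ia] by (auto simp: has_walk_def)
    have "int m dvd a - \<Phi> i - h" using dvd_diff[OF h(3) lift[OF ia(1)]] by (simp add: algebra_simps)
    then show ?thesis using h unfolding has_walk_def by blast
  qed
  define w where "w i = (if s i = 1 then \<Phi> i - int k else \<Phi> i - int k - 1)" for i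
  define J where "J = {i. i < l \<and> d (Suc i) = d i}"
  have jumps: "\<exists>\<delta>. (\<Sum>i<l. \<delta> i) = T \<and> (\<forall>i<l. d (Suc i) \<noteq> d i \<longrightarrow> \<delta> i = 0) \<and>
    (\<forall>i<l. d (Suc i) = d i \<longrightarrow>
         (d i = k \<and> int m dvd a - w i) \<or>
         (d i = k + 1 \<and> int m dvd a - w i \<and> \<delta> i = - s i * int m) \<or>
         (d i = k + 1 \<and> (int m dvd a - w i - 1 \<or> int m dvd a - w i + 1) \<and> \<delta> i = s i * int m))"
    if "a \<in> {x, y, z}" for a
    unfolding T_def w_def
    by (rule lifted_colour_jumps[OF k m _ _ closed d walk[OF _ that], unfolded Let_def])
      (simp_all add: s_def \<Phi>_def)
  have near: "int m dvd a - w i \<or> int m dvd a - w i - 1 \<or> int m dvd a - w i + 1"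
    if a: "a \<in> {x, y, z}" and i: "i \<in> J" for a i
  proof -
    obtain \<delta> where "\<forall>i<l. d (Suc i) = d i \<longrightarrow>
         (d i = k \<and> int m dvd a - w i) \<or>
         (d i = k + 1 \<and> int m dvd a - w i \<and> \<delta> i = - s i * int m) \<or>
         (d i = k + 1 \<and> (int m dvd a - w i - 1 \<or> int m dvd a - w i + 1) \<and> \<delta> i = s i * int m)"
      using jumps[OF a] by metis
    from this[rule_format, of i] i show ?thesis unfolding J_def by blast
  qed
  \<comment> \<open>At distance k the jump would force every one of the three colours to be
    \<open>w i\<close>.\<close>
  have dJ: "d i = k + 1" if "i \<in> J" for i
  proof (rule ccontr)
    assume "d i \<noteq> k + 1"
    have *: "int m dvd a - w i" if a: "a \<in> {x, y, z}" for a
    proof -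
      obtain \<delta> where "\<forall>i<l. d (Suc i) = d i \<longrightarrow>
         (d i = k \<and> int m dvd a - w i) \<or>
         (d i = k + 1 \<and> int m dvd a - w i \<and> \<delta> i = - s i * int m) \<or>
         (d i = k + 1 \<and> (int m dvd a - w i - 1 \<or> int m dvd a - w i + 1) \<and> \<delta> i = s i * int m)"
        using jumps[OF a] by metis
      from this[rule_format, of i] \<open>i \<in> J\<close> \<open>d i \<noteq> k + 1\<close> show ?thesis unfolding J_def by blast
    qed
    have "int m dvd (x - w i) - (y - w i)" by (intro dvd_diff[OF * *]) simp_all
    then show False using dist by simp
  qed
  define centre where "centre a \<longleftrightarrow> (\<forall>i\<in>J. int m dvd a - w i)" for a
  \<comment> \<open>The hypothesis \<open>un\<close> makes the sign of the jump relative to the step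
    the same at all stationary edges, so the jumps sum to plus or minus m times the sum of the
    steps.\<close>
  have sumJ: "(\<Sum>i\<in>J. s i) * int m = (if centre a then - T else T)"
    if a: "a \<in> {x, y, z}" and un: "centre a \<or> (\<forall>i\<in>J. \<not> int m dvd a - w i)" for a
  proof -
    obtain \<delta> where \<delta>: "(\<Sum>i<l. \<delta> i) = T" "\<forall>i<l. d (Suc i) \<noteq> d i \<longrightarrow> \<delta> i = 0"
      "\<forall>i<l. d (Suc i) = d i \<longrightarrow>
         (d i = k \<and> int m dvd a - w i) \<or>
         (d i = k + 1 \<and> int m dvd a - w i \<and> \<delta> i = - s i * int m) \<or>
         (d i = k + 1 \<and> (int m dvd a - w i - 1 \<or> int m dvd a - w i + 1) \<and> \<delta> i = s i * int m)"
      using jumps[OF a] by blast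
    have "(\<Sum>i<l. \<delta> i) = (\<Sum>i\<in>J. \<delta> i)"
      by (rule sum.mono_neutral_right) (use \<delta>(2) in \<open>auto simp: J_def\<close>)
    also have "\<dots> = (\<Sum>i\<in>J. (if centre a then - s i else s i) * int m)"
    proof (rule sum.cong)
      fix i assume i: "i \<in> J"
      have 1: "\<not> int m dvd 1" using k m small_dvd_eq_0[of m 1] by auto
      have "\<not> int m dvd a - w i - 1" "\<not> int m dvd a - w i + 1" if a: "int m dvd a - w i"
        using 1 dvd_diff[OF a, of "a - w i - 1"] dvd_diff[OF a, of "a - w i + 1"] by auto
      then show "\<delta> i = (if centre a then - s i else s i) * int m"
        using \<delta>(3)[rule_format, of i] i dJ[OF i] un by (auto simp: J_def centre_def)
    qed simp
    finally have "T = (\<Sum>i\<in>J. (if centre a then - s i else s i) * int m)" using \<delta>(1) by simp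
    then show ?thesis by (cases "centre a") (simp_all add: sum_distrib_right sum_negf)
  qed
  have "J \<noteq> {}"
  proof
    assume J: "J = {}"
    then have "centre x" by (simp add: centre_def)
    then show False using sumJ[of x] J T0 by simp
  qed
  then obtain i0 where i0: "i0 \<in> J" by blast
  have m5: "5 \<le> m" using k m by simp
  have uniform: "int m dvd a - w i \<longleftrightarrow> int m dvd a - w i0" if a: "a \<in> {x, y, z}" and i: "i \<in> J" for a i
  proof -
    have nx: "int m dvd a - w i \<longleftrightarrow> step_mod m a b \<and> step_mod m a c" if "{a, b, c} = {x, y, z}"
      "\<not> int m dvd a - b" "\<not> int m dvd a - c" "\<not> int m dvd b - c" "i \<in> J" for a b c i
      by (rule centre_iff_adjacent[OF m5 that(2-4)]) (use near that(1,5) in blast)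
    have dist': "\<not> int m dvd y - x" "\<not> int m dvd z - x" "\<not> int m dvd z - y"
      using dist by (auto simp: dvd_diff_commute)
    consider "a = x" | "a = y" | "a = z" using a by blast
    then show ?thesis
    proof cases
      case 1 then show ?thesis using nx[of x y z] dist i i0 by simp
    next
      case 2 then show ?thesis using nx[of y x z] dist dist' i i0 by (simp add: insert_commute)
    next
      case 3 then show ?thesis using nx[of z x y] dist dist' i i0 by (simp add: insert_commute)
    qed
  qed
  have un: "centre a \<or> (\<forall>i\<in>J. \<not> int m dvd a - w i)" if "a \<in> {x, y, z}" for a
    using uniform[OF that] i0 unfolding centre_def by blast
  have same: "\<not> (centre a \<and> centre b)" if "\<not> int m dvd a - b" for a b
  proof
    assume "centre a \<and> centre b"
    then have "int m dvd (a - w i0) - (b - w i0)" using i0 unfolding centre_def by (metis dvd_diff)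
    then show False using that by simp
  qed
  \<comment> \<open>Otherwise three distinct colours would have to share the two neighbours of
    \<open>w i0\<close>.\<close>
  have "\<exists>a\<in>{x, y, z}. centre a"
  proof (rule ccontr)
    assume "\<not> ?thesis"
    then have n: "\<not> int m dvd a - w i0" if "a \<in> {x, y, z}" for a using un[OF that] i0 that by blast
    have two: "\<not> (int m dvd a - w i0 + h \<and> int m dvd b - w i0 + h)" if "\<not> int m dvd a - b" for a b h
      using dvd_diff[of "int m" "a - w i0 + h" "b - w i0 + h"] that by auto
    show False
      using near[of x i0] near[of y i0] near[of z i0] n[of x] n[of y] n[of z] i0
        two[OF dist(1), of "-1"] two[OF dist(2), of "-1"] two[OF dist(3), of "-1"]
        two[OF dist(1), of 1] two[OF dist(2), of 1] two[OF dist(3), of 1]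
      by auto
  qed
  then obtain a where a: "a \<in> {x, y, z}" "centre a" by blast
  moreover obtain b where b: "b \<in> {x, y, z}" "\<not> centre b"
    using same[OF dist(1)] by blast
  ultimately have "T = - T" using sumJ[OF a(1) un[OF a(1)]] sumJ[OF b(1) un[OF b(1)]] by simp
  then show False using T0 by simp
qed

section \<open>Path consistency and majority operations\<close>

text \<open>\<open>N u x v y\<close> means that the pair of assignments has not been refuted, and
  the condition says that no surviving pair can be refuted in one more step. The empty relation
  qualifies, so acceptance always asks for some surviving pair.\<close>

definition path_consistent ::
  "'v set \<Rightarrow> ('v \<Rightarrow> 'c \<Rightarrow> bool) \<Rightarrow> ('v \<times> 'v) set \<Rightarrow> ('c \<Rightarrow> 'c \<Rightarrow> bool) \<Rightarrow> ('v \<Rightarrow> 'c \<Rightarrow> 'v \<Rightarrow> 'c \<Rightarrow> bool) \<Rightarrow> bool" where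
  "path_consistent V U E H N \<longleftrightarrow> (\<forall>u x v y. N u x v y \<longrightarrow>
     u \<in> V \<and> v \<in> V \<and> U u x \<and> (u = v \<longrightarrow> x = y) \<and> ((u, v) \<in> E \<longrightarrow> H x y) \<and>
     (\<forall>w\<in>V. \<exists>z. N u x w z \<and> N w z v y))"

lemma path_consistentD:
  assumes "path_consistent V U E H N" "N u x v y"
  shows "u \<in> V" "v \<in> V" "U u x" "u = v \<Longrightarrow> x = y" "(u, v) \<in> E \<Longrightarrow> H x y"
    "w \<in> V \<Longrightarrow> \<exists>z. N u x w z \<and> N w z v y"
  using assms unfolding path_consistent_def by blast+

text \<open>Interposing an end of the pair itself forces the intermediate colour to be the colour of
  that end.\<close>

lemma path_consistent_diag:
  assumes "path_consistent V U E H N" "N u x v y"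
  shows "N u x u x" "N v y v y" "U v y"
proof -
  note pc = path_consistentD[OF assms(1)]
  show "N u x u x" using pc(6)[OF assms(2) pc(1)[OF assms(2)]] pc(4) by metis
  show *: "N v y v y" using pc(6)[OF assms(2) pc(2)[OF assms(2)]] pc(4) by metis
  show "U v y" using pc(3)[OF *] .
qed

lemma path_consistent_converse:
  assumes "path_consistent V U E H N" "sym E" "\<And>x y. H x y \<Longrightarrow> H y x"
  shows "path_consistent V U E H (\<lambda>u x v y. N v y u x)"
  unfolding path_consistent_def
proof (intro allI impI)
  note pc = path_consistentD[OF assms(1)]
  fix u x v y assume N: "N v y u x"
  show "u \<in> V \<and> v \<in> V \<and> U u x \<and> (u = v \<longrightarrow> x = y) \<and> ((u, v) \<in> E \<longrightarrow> H x y) \<and>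
     (\<forall>w\<in>V. \<exists>z. N w z u x \<and> N v y w z)"
    using pc(1,2)[OF N] path_consistent_diag(3)[OF assms(1) N] pc(4)[OF N] pc(5)[OF N] pc(6)[OF N]
      assms(2,3) unfolding sym_def by metis
qed

text \<open>The union of all path consistent relations is again one, so this is the outcome of
  running path consistency to the end.\<close>

definition largest_pc :: "'v set \<Rightarrow> ('v \<Rightarrow> 'c \<Rightarrow> bool) \<Rightarrow> ('v \<times> 'v) set \<Rightarrow> ('c \<Rightarrow> 'c \<Rightarrow> bool) \<Rightarrow> 'v \<Rightarrow> 'c \<Rightarrow> 'v \<Rightarrow> 'c \<Rightarrow> bool" where
  "largest_pc V U E H u x v y \<longleftrightarrow> (\<exists>N. path_consistent V U E H N \<and> N u x v y)"

lemma path_consistent_largest_pc: "path_consistent V U E H (largest_pc V U E H)"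
  unfolding path_consistent_def
proof (intro allI impI)
  fix u x v y assume "largest_pc V U E H u x v y"
  then obtain N where pc: "path_consistent V U E H N" and N: "N u x v y"
    unfolding largest_pc_def by blast
  have le: "largest_pc V U E H u x v y" if "N u x v y" for u x v y
    using pc that unfolding largest_pc_def by blast
  show "u \<in> V \<and> v \<in> V \<and> U u x \<and> (u = v \<longrightarrow> x = y) \<and> ((u, v) \<in> E \<longrightarrow> H x y) \<and>
     (\<forall>w\<in>V. \<exists>z. largest_pc V U E H u x w z \<and> largest_pc V U E H w z v y)"
    using path_consistentD[OF pc N] le by meson
qed

lemma largest_pc_sym:
  assumes "sym E" "\<And>x y. H x y \<Longrightarrow> H y x" "largest_pc V U E H u x v y"
  shows "largest_pc V U E H v y u x"
proof -
  obtain N where "path_consistent V U E H N" "N u x v y" using assms(3) unfolding largest_pc_def by blast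
  then have "path_consistent V U E H (\<lambda>u x v y. N v y u x)" "(\<lambda>u x v y. N v y u x) v y u x"
    using path_consistent_converse assms(1,2) by blast+
  then show ?thesis unfolding largest_pc_def by blast
qed

text \<open>The image of triples of surviving pairs under an operation that preserves lists and
  edges is itself path consistent, with the images of the intermediate colours as intermediate
  colours. Maximality then puts it inside \<open>N\<close>.\<close>

lemma largest_pc_closed_under_majority:
  fixes V :: "'v set" and U :: "'v \<Rightarrow> 'c \<Rightarrow> bool" and E H and g :: "'v \<Rightarrow> 'c \<Rightarrow> 'c \<Rightarrow> 'c \<Rightarrow> 'c"
  defines "N \<equiv> largest_pc V U E H"
  assumes U: "\<And>u x1 x2 x3. U u x1 \<Longrightarrow> U u x2 \<Longrightarrow> U u x3 \<Longrightarrow> U u (g u x1 x2 x3)"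
    and edge: "\<And>u v x1 x2 x3 y1 y2 y3. (u, v) \<in> E \<Longrightarrow> N u x1 v y1 \<Longrightarrow> N u x2 v y2 \<Longrightarrow> N u x3 v y3 \<Longrightarrow>
       H (g u x1 x2 x3) (g v y1 y2 y3)"
    and "N u x1 v y1" "N u x2 v y2" "N u x3 v y3"
  shows "N u (g u x1 x2 x3) v (g v y1 y2 y3)"
proof -
  define N' where "N' u x v y \<longleftrightarrow> (\<exists>x1 x2 x3 y1 y2 y3. N u x1 v y1 \<and> N u x2 v y2 \<and> N u x3 v y3 \<and>
    x = g u x1 x2 x3 \<and> y = g v y1 y2 y3)" for u x v y
  note pc = path_consistentD[OF path_consistent_largest_pc[of V U E H], folded N_def]
  have "path_consistent V U E H N'"
    unfolding path_consistent_def
  proof (intro allI impI)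
    fix u x v y assume "N' u x v y"
    then obtain x1 x2 x3 y1 y2 y3 where N: "N u x1 v y1" "N u x2 v y2" "N u x3 v y3"
      and x: "x = g u x1 x2 x3" and y: "y = g v y1 y2 y3" unfolding N'_def by blast
    have "\<exists>z. N' u x w z \<and> N' w z v y" if w: "w \<in> V" for w
    proof -
      obtain z1 z2 z3 where z: "N u x1 w z1" "N w z1 v y1" "N u x2 w z2" "N w z2 v y2" "N u x3 w z3" "N w z3 v y3"
        using pc(6)[OF N(1) w] pc(6)[OF N(2) w] pc(6)[OF N(3) w] by blast
      then have "N' u x w (g w z1 z2 z3)" "N' w (g w z1 z2 z3) v y" unfolding N'_def x y by blast+
      then show ?thesis by blast
    qed
    moreover have "u = v \<Longrightarrow> x = y" using pc(4)[OF N(1)] pc(4)[OF N(2)] pc(4)[OF N(3)] x y by simp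
    moreover have "(u, v) \<in> E \<Longrightarrow> H x y" using edge[OF _ N] x y by simp
    moreover have "U u x" unfolding x using U pc(3)[OF N(1)] pc(3)[OF N(2)] pc(3)[OF N(3)] by blast
    ultimately show "u \<in> V \<and> v \<in> V \<and> U u x \<and> (u = v \<longrightarrow> x = y) \<and> ((u, v) \<in> E \<longrightarrow> H x y) \<and>
     (\<forall>w\<in>V. \<exists>z. N' u x w z \<and> N' w z v y)"
      using pc(1,2)[OF N(1)] by blast
  qed
  moreover have "N' u (g u x1 x2 x3) v (g v y1 y2 y3)" unfolding N'_def using assms(4-6) by blast
  ultimately show ?thesis unfolding N_def largest_pc_def by blast
qed

text \<open>The argument of Baker and Pixley: with a majority operation, a partial solution that is
  pairwise consistent extends to any further vertex.\<close>

lemma majority_common_extension: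
  assumes sym: "\<And>u x v y. N u x v y \<Longrightarrow> N v y u x"
    and ext: "\<And>u x v y w. N u x v y \<Longrightarrow> w \<in> V \<Longrightarrow> \<exists>z. N u x w z \<and> N w z v y"
    and maj: "\<And>u x y. g u x x y = x" "\<And>u x y. g u x y x = x" "\<And>u x y. g u y x x = x"
    and closed: "\<And>u v x1 x2 x3 y1 y2 y3. N u x1 v y1 \<Longrightarrow> N u x2 v y2 \<Longrightarrow> N u x3 v y3 \<Longrightarrow>
       N u (g u x1 x2 x3) v (g v y1 y2 y3)"
    and T: "finite T" "T \<subseteq> V" "T \<noteq> {}" and w: "w \<in> V"
    and f: "\<And>s t. s \<in> T \<Longrightarrow> t \<in> T \<Longrightarrow> N s (f s) t (f t)"
  shows "\<exists>z. \<forall>t\<in>T. N t (f t) w z"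
  using T f
proof (induction "card T" arbitrary: T rule: less_induct)
  case less
  consider s t where "T = {s, t}" "s \<in> T" "t \<in> T"
    | t1 t2 t3 where "t1 \<in> T" "t2 \<in> T" "t3 \<in> T" "t1 \<noteq> t2" "t1 \<noteq> t3" "t2 \<noteq> t3"
    using less.prems(3) by blast
  then show ?case
  proof cases
    case 1
    then obtain z where "N s (f s) w z" "N w z t (f t)"
      using ext[OF less.prems(4)[OF 1(2,3)] w] by blast
    then show ?thesis using sym 1(1) by blast
  next
    case 2
    have ex: "\<exists>z. \<forall>t\<in>T - {t0}. N t (f t) w z" if "t0 \<in> T" "T - {t0} \<noteq> {}" for t0
      by (rule less.hyps[OF card_Diff1_less[OF less.prems(1) that(1)]]) (use less.prems that in auto)
    obtain z1 where z1: "\<forall>t\<in>T - {t1}. N t (f t) w z1" using ex[of t1] 2 by blast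
    obtain z2 where z2: "\<forall>t\<in>T - {t2}. N t (f t) w z2" using ex[of t2] 2 by blast
    obtain z3 where z3: "\<forall>t\<in>T - {t3}. N t (f t) w z3" using ex[of t3] 2 by blast
    \<comment> \<open>Each \<open>z\<close> obtained by omitting one vertex may clash with the
      colour of that vertex only. There an arbitrary compatible colour \<open>y\<close> is paired
      with it, and the majority operation outvotes \<open>y\<close> by the two good entries.\<close>
    have some: "\<exists>y. N t y w z" if "t \<in> T" "N s x w z" for t s x z
    proof -
      have "t \<in> V" using that(1) less.prems(2) by blast
      then show ?thesis using ext[OF that(2)] by blast
    qed
    obtain y1 where y1: "N t1 y1 w z1" using some[OF 2(1), of t2 "f t2" z1] z1 2 by blast
    obtain y2 where y2: "N t2 y2 w z2" using some[OF 2(2), of t1 "f t1" z2] z2 2 by blast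
    obtain y3 where y3: "N t3 y3 w z3" using some[OF 2(3), of t2 "f t2" z3] z3 2 by blast
    have "N t (f t) w (g w z1 z2 z3)" if t: "t \<in> T" for t
    proof -
      consider "t = t1" | "t = t2" | "t = t3" | "t \<noteq> t1" "t \<noteq> t2" "t \<noteq> t3" by blast
      then show ?thesis
      proof cases
        case 1
        then have "N t (g t y1 (f t) (f t)) w (g w z1 z2 z3)"
          using y1 z2 z3 2 t by (intro closed) auto
        then show ?thesis by (simp add: maj)
      next
        case 2
        then have "N t (g t (f t) y2 (f t)) w (g w z1 z2 z3)"
          using y2 z1 z3 \<open>t1 \<noteq> t2\<close> \<open>t2 \<noteq> t3\<close> t by (intro closed) auto
        then show ?thesis by (simp add: maj)
      next
        case 3
        then have "N t (g t (f t) (f t) y3) w (g w z1 z2 z3)"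
          using y3 z1 z2 \<open>t1 \<noteq> t3\<close> \<open>t2 \<noteq> t3\<close> t by (intro closed) auto
        then show ?thesis by (simp add: maj)
      next
        case 4
        then have "N t (g t (f t) (f t) (f t)) w (g w z1 z2 z3)"
          using z1 z2 z3 t by (intro closed) auto
        then show ?thesis by (simp add: maj)
      qed
    qed
    then show ?thesis by blast
  qed
qed

text \<open>The predicate \<open>A\<close> over-approximates the colours that survive path
  consistency. Compatibility of \<open>g\<close> with the edges is required for colours in
  \<open>A\<close> only, which is where the precoloured vertices pay off: on all colours of the
  cycle such an operation is not at hand.\<close>

lemma majority_solution:
  fixes g :: "'v \<Rightarrow> 'c \<Rightarrow> 'c \<Rightarrow> 'c \<Rightarrow> 'c"
  assumes E: "sym E" "E \<subseteq> V \<times> V" and H: "\<And>x y. H x y \<Longrightarrow> H y x" and V: "finite V"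
    and nonempty: "path_consistent V U E H N0" "N0 u0 x0 v0 y0"
    and maj: "\<And>u x y. g u x x y = x" "\<And>u x y. g u x y x = x" "\<And>u x y. g u y x x = x"
    and U: "\<And>u x1 x2 x3. U u x1 \<Longrightarrow> U u x2 \<Longrightarrow> U u x3 \<Longrightarrow> U u (g u x1 x2 x3)"
    and A: "\<And>N u x. path_consistent V U E H N \<Longrightarrow> N u x u x \<Longrightarrow> A u x"
    and edge: "\<And>u v x1 x2 x3 y1 y2 y3. (u, v) \<in> E \<Longrightarrow> A u x1 \<Longrightarrow> A u x2 \<Longrightarrow> A u x3 \<Longrightarrow>
       A v y1 \<Longrightarrow> A v y2 \<Longrightarrow> A v y3 \<Longrightarrow> H x1 y1 \<Longrightarrow> H x2 y2 \<Longrightarrow> H x3 y3 \<Longrightarrow>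
       H (g u x1 x2 x3) (g v y1 y2 y3)"
  shows "\<exists>f. (\<forall>v\<in>V. U v (f v)) \<and> (\<forall>(u, v)\<in>E. H (f u) (f v))"
proof -
  define N where "N = largest_pc V U E H"
  note pcN = path_consistent_largest_pc[of V U E H, folded N_def]
  note pc = path_consistentD[OF pcN] and diag = path_consistent_diag[OF pcN]
  have sym: "N v y u x" if "N u x v y" for u x v y
    using largest_pc_sym[of E H V U u x v y] E(1) H that unfolding N_def by blast
  have edge': "H (g u x1 x2 x3) (g v y1 y2 y3)"
    if uv: "(u, v) \<in> E" and N: "N u x1 v y1" "N u x2 v y2" "N u x3 v y3" for u v x1 x2 x3 y1 y2 y3
    using diag(1,2)[OF N(1)] diag(1,2)[OF N(2)] diag(1,2)[OF N(3)]
      pc(5)[OF N(1) uv] pc(5)[OF N(2) uv] pc(5)[OF N(3) uv]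
    by (intro edge[OF uv] A[OF pcN])
  note closed = largest_pc_closed_under_majority[where g = g and V = V and U = U and E = E and H = H,
      folded N_def, OF U edge']
  have N0: "N u0 x0 v0 y0" using nonempty unfolding N_def largest_pc_def by blast
  have "\<exists>f. \<forall>s\<in>T. \<forall>t\<in>T. N s (f s) t (f t)" if "T \<subseteq> V" for T
    using finite_subset[OF that V] that
  proof (induction T rule: finite_induct)
    case (insert w T)
    then obtain f where f: "\<forall>s\<in>T. \<forall>t\<in>T. N s (f s) t (f t)" by auto
    have w: "w \<in> V" using insert by simp
    obtain z where z: "N w z w z" "\<forall>t\<in>T. N t (f t) w z"
    proof (cases "T = {}")
      case True
      then show ?thesis using that pc(6)[OF N0 w] diag by blast
    next
      case False
      then obtain z where z: "\<forall>t\<in>T. N t (f t) w z"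
        using majority_common_extension[where N = N and g = g, OF sym pc(6) maj closed, of V T w f]
          insert f w by auto
      then show ?thesis using that False diag(2) by blast
    qed
    have "\<forall>s\<in>insert w T. \<forall>t\<in>insert w T. N s ((f(w := z)) s) t ((f(w := z)) t)"
      using z f insert.hyps(2) sym by auto
    then show ?case by blast
  qed simp
  then obtain f where f: "\<forall>s\<in>V. \<forall>t\<in>V. N s (f s) t (f t)" by blast
  have "\<forall>v\<in>V. U v (f v)" using f pc(3) by blast
  moreover have "\<forall>(u, v)\<in>E. H (f u) (f v)"
    using f pc(5) E(2) by fast
  ultimately show ?thesis by blast
qed

section \<open>List homomorphisms to odd cycles\<close>

definition cycle_adj :: "nat \<Rightarrow> nat \<Rightarrow> nat \<Rightarrow> bool" where
  "cycle_adj m x y \<longleftrightarrow> x < m \<and> y < m \<and> step_mod m (int x) (int y)"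

lemma step_mod_sym:
  assumes "step_mod m x y"
  shows "step_mod m y x"
proof -
  have "y - x - 1 = - (x - y + 1)" "y - x + 1 = - (x - y - 1)" by simp_all
  then show ?thesis using assms unfolding step_mod_def by (metis dvd_minus_iff)
qed

lemma cycle_adj_sym: "cycle_adj m x y \<Longrightarrow> cycle_adj m y x"
  unfolding cycle_adj_def using step_mod_sym by blast

lemma has_walk_step:
  assumes "has_walk m d x y" "step_mod m y z"
  shows "has_walk m (Suc d) x z"
proof -
  obtain h where h: "\<bar>h\<bar> \<le> int d" "even (h - int d)" "int m dvd y - x - h"
    using assms(1) unfolding has_walk_def by blast
  consider "int m dvd z - y - 1" | "int m dvd z - y + 1" using assms(2) unfolding step_mod_def by blast
  then show ?thesis
  proof cases
    case 1
    have "int m dvd z - x - (h + 1)" using dvd_add[OF h(3) 1] by (simp add: algebra_simps)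
    then show ?thesis unfolding has_walk_def using h by (intro exI[of _ "h + 1"]) auto
  next
    case 2
    have "int m dvd z - x - (h - 1)" using dvd_add[OF h(3) 2] by (simp add: algebra_simps)
    then show ?thesis unfolding has_walk_def using h by (intro exI[of _ "h - 1"]) auto
  qed
qed

text \<open>Interposing the vertices of a walk in the input graph one after the other yields
  surviving colours that form a walk of the same length in the cycle.\<close>

lemma path_consistent_has_walk:
  assumes pc: "path_consistent V U E (cycle_adj m) N" and E: "E \<subseteq> V \<times> V"
  shows "(u, v) \<in> E ^^ d \<Longrightarrow> N u x v y \<Longrightarrow> has_walk m d (int x) (int y)"
proof (induction d arbitrary: v y)
  case 0
  then have "x = y" using path_consistentD(4)[OF pc] by auto
  then show ?case by (auto simp: has_walk_def)
next
  case (Suc d)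
  then obtain w where w: "(u, w) \<in> E ^^ d" "(w, v) \<in> E" by auto
  obtain z where z: "N u x w z" "N w z v y" using path_consistentD(6)[OF pc Suc.prems(2), of w] w(2) E by blast
  have "step_mod m (int z) (int y)" using path_consistentD(5)[OF pc z(2) w(2)] by (simp add: cycle_adj_def)
  then show ?case using has_walk_step[OF Suc.IH[OF w(1) z(1)]] by simp
qed

definition gdist :: "('v \<times> 'v) set \<Rightarrow> 'v \<Rightarrow> 'v \<Rightarrow> nat" where
  "gdist E u v = (LEAST d. (u, v) \<in> E ^^ d)"

lemma gdist_le: "(u, v) \<in> E ^^ d \<Longrightarrow> gdist E u v \<le> d"
  unfolding gdist_def by (rule Least_le)

lemma gdist_relpow: "(u, v) \<in> E ^^ d \<Longrightarrow> (u, v) \<in> E ^^ gdist E u v"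
  unfolding gdist_def by (rule LeastI)

lemma gdist_step: "(u, v) \<in> E ^^ d \<Longrightarrow> (v, w) \<in> E \<Longrightarrow> gdist E u w \<le> Suc (gdist E u v)"
  by (rule gdist_le) (auto intro: gdist_relpow)

lemma gdist_step_left: "(v, u) \<in> E ^^ d \<Longrightarrow> (w, v) \<in> E \<Longrightarrow> gdist E w u \<le> Suc (gdist E v u)"
  by (rule gdist_le) (rule relpow_Suc_I2, assumption, rule gdist_relpow)

lemma relpow_sym: "sym E \<Longrightarrow> (u, v) \<in> E ^^ d \<Longrightarrow> (v, u) \<in> E ^^ d"
proof (induction d arbitrary: v)
  case (Suc d)
  then obtain w where "(u, w) \<in> E ^^ d" "(w, v) \<in> E" by auto
  then have "(v, w) \<in> E" "(w, u) \<in> E ^^ d" using Suc by (auto dest: symD)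
  then show ?case by (rule relpow_Suc_I2)
qed simp

section \<open>Medians of integer offsets\<close>

text \<open>The equality tests come first so that the majority identities hold between the colours
  themselves, even where \<open>h\<close> is not injective; the offset of the result is the median
  in every case.\<close>

definition median_by :: "('c \<Rightarrow> int) \<Rightarrow> 'c \<Rightarrow> 'c \<Rightarrow> 'c \<Rightarrow> 'c" where
  "median_by h x y z =
    (if x = y \<or> x = z then x else if y = z then y
     else if h x \<le> h y \<and> h y \<le> h z \<or> h z \<le> h y \<and> h y \<le> h x then y
     else if h y \<le> h x \<and> h x \<le> h z \<or> h z \<le> h x \<and> h x \<le> h y then x else z)"

lemma median_by_value: "h (median_by h x y z) = max (min (h x) (h y)) (min (max (h x) (h y)) (h z))"
  unfolding median_by_def by auto

lemma median_by_in: "median_by h x y z = x \<or> median_by h x y z = y \<or> median_by h x y z = z"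
  unfolding median_by_def by auto

text \<open>The median is monotone and commutes with shifts, hence is 1-Lipschitz in the maximum
  norm.\<close>

lemma median_close:
  fixes a b c a' b' c' :: int
  assumes "\<bar>a - a'\<bar> \<le> 1" "\<bar>b - b'\<bar> \<le> 1" "\<bar>c - c'\<bar> \<le> 1"
  shows "\<bar>max (min a b) (min (max a b) c) - max (min a' b') (min (max a' b') c')\<bar> \<le> 1"
  using assms by (auto simp: min_def max_def abs_if split: if_splits)

text \<open>The offsets have opposite parity, so h' - h + 1 and h' - h - 1 are even and smaller than
  2m in size; they are divisible by the odd number m only if they vanish. Adjacency modulo m thus
  becomes adjacency in the integers.\<close>

lemma adjacent_offsets:
  fixes h h' c :: int and x y d d' k m :: nat
  assumes m: "m = 2 * k + 1" "2 \<le> k" and d: "d \<le> k + 1" "d' \<le> k + 1" "d' = Suc d \<or> d = Suc d'"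
    and h: "\<bar>h\<bar> \<le> int d" "even (h - int d)" "int m dvd int x - c - h"
    and h': "\<bar>h'\<bar> \<le> int d'" "even (h' - int d')" "int m dvd int y - c - h'"
    and xy: "x < m" "y < m"
  shows "cycle_adj m x y \<longleftrightarrow> \<bar>h - h'\<bar> \<le> 1"
proof -
  have odd: "odd (h' - h)" using h(2) h'(2) d(3) by auto
  have e: "int m dvd int y - int x + t \<longleftrightarrow> int m dvd h' - h + t" for t
    by (rule dvd_congruent_iff) (use dvd_diff[OF h'(3) h(3)] in \<open>simp add: algebra_simps\<close>)
  have zero: "int m dvd h' - h + t \<longleftrightarrow> h' - h + t = 0" if "\<bar>t\<bar> = 1" for t
  proof -
    have "t = 1 \<or> t = -1" using that by linarith
    then have "even (h' - h + t)" using odd by auto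
    moreover have "\<bar>h' - h + t\<bar> < 2 * int m" using that h(1) h'(1) d(1,2) m by linarith
    ultimately show ?thesis using even_small_multiple_eq_0[of m "h' - h + t"] m(1) by auto
  qed
  have "cycle_adj m x y \<longleftrightarrow> h' - h - 1 = 0 \<or> h' - h + 1 = 0"
    unfolding cycle_adj_def step_mod_def using e[of "-1"] e[of 1] zero[of "-1"] zero[of 1] xy by simp
  also have "\<dots> \<longleftrightarrow> \<bar>h - h'\<bar> \<le> 1" using odd by (cases "h' = h") auto
  finally show ?thesis .
qed

text \<open>A guess may repeat a vertex; if it gives it two different colours, no colour of that
  vertex is admissible and the guess is refuted.\<close>

definition guess_ok :: "nat \<Rightarrow> nat \<Rightarrow> ('v \<Rightarrow> nat set) \<Rightarrow> (nat \<Rightarrow> 'v) \<Rightarrow> (nat \<Rightarrow> nat) \<Rightarrow> 'v \<Rightarrow> nat \<Rightarrow> bool" where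
  "guess_ok m r L Vs Cs u x \<longleftrightarrow> x \<in> L u \<and> x < m \<and> (\<forall>i<r. u = Vs i \<longrightarrow> x = Cs i)"

lemma solution_if_path_consistent:
  fixes E :: "('v \<times> 'v) set" and k m :: nat
  assumes k: "2 \<le> k" and m: "m = 2 * k + 1" and V: "finite V" and E: "sym E" "E \<subseteq> V \<times> V"
    and diam: "\<And>u v. u \<in> V \<Longrightarrow> v \<in> V \<Longrightarrow> \<exists>d\<le>k + 1. (u, v) \<in> E ^^ d"
    and accept: "\<And>Vs. (\<And>i. i < 2 * k + 3 \<Longrightarrow> Vs i \<in> V) \<Longrightarrow>
      \<exists>Cs N. path_consistent V (guess_ok m (2 * k + 3) L Vs Cs) E (cycle_adj m) N \<and> N (Vs 0) (Cs 0) (Vs 0) (Cs 0)"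
  shows "\<exists>f. (\<forall>v\<in>V. f v \<in> L v \<and> f v < m) \<and> (\<forall>(u, v)\<in>E. cycle_adj m (f u) (f v))"
proof (cases "V = {}")
  case True
  then show ?thesis using E(2) by auto
next
  case False
  then obtain v0 where v0: "v0 \<in> V" by blast
  define D where "D = gdist E"
  have Dpow: "(u, v) \<in> E ^^ D u v" and Dle: "D u v \<le> k + 1" if "u \<in> V" "v \<in> V" for u v
    using diam[OF that] gdist_relpow gdist_le unfolding D_def by (metis order_trans)+
  have Dstep: "D u w \<le> Suc (D u v)" and Dstep': "D w u \<le> Suc (D v u)" if "u \<in> V" "(v, w) \<in> E" for u v w
  proof -
    have "v \<in> V" "(w, v) \<in> E" using that(2) E by (auto dest: symD)
    then show "D u w \<le> Suc (D u v)" "D w u \<le> Suc (D v u)"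
      using diam[of u v] diam[of v u] that gdist_step gdist_step_left unfolding D_def by metis+
  qed
  show ?thesis
  proof (cases "\<exists>a b. (a, b) \<in> E \<and> D v0 a = D v0 b")
    case True
    then obtain a b where ab: "(a, b) \<in> E" "D v0 a = D v0 b" by blast
    \<comment> \<open>A shortest path to \<open>a\<close>, the edge to \<open>b\<close> and a
      shortest path back: the length is odd and at most 2(k + 1) + 1.\<close>
    define l where "l = Suc (D v0 a + D v0 a)"
    have abV: "a \<in> V" "b \<in> V" using ab(1) E(2) by auto
    have "(v0, b) \<in> E ^^ Suc (D v0 a)" using Dpow[OF v0 abV(1)] ab(1) by auto
    moreover have "(b, v0) \<in> E ^^ D v0 a" using relpow_sym[OF E(1) Dpow[OF v0 abV(2)]] ab(2) by simp
    ultimately have "(v0, v0) \<in> E ^^ (Suc (D v0 a) + D v0 a)" unfolding relpow_add by blast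
    then have "(v0, v0) \<in> E ^^ l" by (simp add: l_def)
    then obtain c where c: "c 0 = v0" "c l = v0" "\<And>i. i < l \<Longrightarrow> (c i, c (Suc i)) \<in> E"
      unfolding relpow_fun_conv by blast
    have l: "odd l" "l \<le> 2 * k + 3" "0 < l" using Dle[OF v0 abV(1)] by (auto simp: l_def)
    \<comment> \<open>The tuple is padded with \<open>v0\<close> if the walk is shorter than 2k +
      3.\<close>
    define Vs where "Vs i = (if i < l then c i else v0)" for i
    have cV: "c i \<in> V" if "i \<le> l" for i
    proof (cases "i = l")
      case False
      then show ?thesis using c(3)[of i] that E(2) by auto
    qed (use c(2) v0 in simp)
    have "Vs i \<in> V" for i using cV[of i] v0 by (simp add: Vs_def)
    then obtain Cs N where pcN: "path_consistent V (guess_ok m (2 * k + 3) L Vs Cs) E (cycle_adj m) N"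
      and N: "N (Vs 0) (Cs 0) (Vs 0) (Cs 0)" using accept[of Vs] by blast
    define U where "U = guess_ok m (2 * k + 3) L Vs Cs"
    note pcN = pcN[folded U_def]
    define col where "col i = Cs (if i < l then i else 0)" for i
    have U: "z = col i" if "U (c i) z" "i \<le> l" for i z
    proof (cases "i < l")
      case True
      then show ?thesis using that l unfolding U_def guess_ok_def col_def Vs_def by auto
    next
      case False
      then have "c i = c 0" using that(2) c by (metis le_neq_implies_less)
      then show ?thesis using that(1) False l unfolding U_def guess_ok_def col_def Vs_def by auto
    qed
    define A where "A u x \<longleftrightarrow> (\<exists>N'. path_consistent V U E (cycle_adj m) N' \<and> N' u x u x)" for u x
    have lt: "x < m" if Ax: "A u x" for u x
    proof -
      obtain N' where "path_consistent V U E (cycle_adj m) N'" "N' u x u x"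
        using Ax unfolding A_def by blast
      from path_consistentD(3)[OF this] show ?thesis unfolding U_def guess_ok_def by simp
    qed
    have two: "x = y \<or> x = z \<or> y = z" if xyz: "A u x" "A u y" "A u z" for u x y z
    proof -
      have uV: "u \<in> V" using xyz(1) path_consistentD(1) unfolding A_def by metis
      have walks: "has_walk m (D (c i) u) (int (col i)) (int x)" if i: "i \<le> l" and "A u x" for i x
      proof -
        obtain N' where pc: "path_consistent V U E (cycle_adj m) N'" and N': "N' u x u x"
          using \<open>A u x\<close> unfolding A_def by blast
        obtain w where w: "N' (c i) w u x" using path_consistentD(6)[OF pc N' cV[OF i]] by blast
        have "w = col i" using U[OF path_consistentD(3)[OF pc w] i] .
        then show ?thesis using path_consistent_has_walk[OF pc E(2) Dpow[OF cV[OF i] uV] w] by simp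
      qed
      \<comment> \<open>Starting from the surviving pair at \<open>Vs 0\<close>, path consistency
        yields surviving pairs at every edge of the walk, and these can carry only the guessed
        colours. So the guess itself is a closed walk in the cycle.\<close>
      have step: "step_mod m (int (col i)) (int (col (Suc i)))" if i: "i < l" for i
      proof -
        have i': "i \<le> l" "Suc i \<le> l" using i by auto
        obtain z where "N (c i) z (Vs 0) (Cs 0)" using path_consistentD(6)[OF pcN N cV[OF i'(1)]] by blast
        from path_consistent_diag(1)[OF pcN this]
        obtain z' where z': "N (c i) z (c (Suc i)) z'" using path_consistentD(6)[OF pcN _ cV[OF i'(2)]] by blast
        have "z = col i" "z' = col (Suc i)"
          using U[OF path_consistentD(3)[OF pcN z'] i'(1)] U[OF path_consistent_diag(3)[OF pcN z'] i'(2)] .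
        then show ?thesis using path_consistentD(5)[OF pcN z' c(3)[OF i]] by (simp add: cycle_adj_def)
      qed
      have close: "D (c (Suc i)) u \<le> Suc (D (c i) u) \<and> D (c i) u \<le> Suc (D (c (Suc i)) u)" if "i < l" for i
        using Dstep'[OF uV c(3)[OF that]] Dstep'[OF uV symD[OF E(1) c(3)[OF that]]] by simp
      have "int m dvd int x - int y \<or> int m dvd int x - int z \<or> int m dvd int y - int z"
      proof (rule at_most_two_colours[OF k m l(1), where c = "\<lambda>i. int (col i)" and d = "\<lambda>i. D (c i) u"])
        show "has_walk m (D (c i) u) (int (col i)) w" if "i \<le> l" "w \<in> {int x, int y, int z}" for i w
          using walks[OF that(1) xyz(1)] walks[OF that(1) xyz(2)] walks[OF that(1) xyz(3)] that(2) by blast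
      qed (use step close Dle[OF cV uV] c(1,2) in \<open>simp_all add: col_def\<close>)
      moreover have "x < m" "y < m" "z < m" using lt xyz by blast+
      moreover have "p = q" if "int m dvd int p - int q" "p < m" "q < m" for p q
        using small_dvd_eq_0[OF that(1)] that(2,3) by auto
      ultimately show ?thesis by blast
    qed
    \<comment> \<open>Among at most two colours, the third argument breaks the tie when the first
      two differ. On an edge where one end takes the first argument and the other the third, the
      third equals one of its first two, so an adjacent pair is still selected.\<close>
    define g where "g u x y z = (if x = y then x else z)" for u :: 'v and x y z :: nat
    have "\<exists>f. (\<forall>v\<in>V. U v (f v)) \<and> (\<forall>(u, v)\<in>E. cycle_adj m (f u) (f v))"
    proof (rule majority_solution[where g = g and A = A, OF E cycle_adj_sym V pcN N])
      show "U u x1 \<Longrightarrow> U u x2 \<Longrightarrow> U u x3 \<Longrightarrow> U u (g u x1 x2 x3)" for u x1 x2 x3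
        by (simp add: g_def)
      show "path_consistent V U E (cycle_adj m) N' \<Longrightarrow> N' u x u x \<Longrightarrow> A u x" for N' u x
        unfolding A_def by blast
      show "cycle_adj m (g u x1 x2 x3) (g v y1 y2 y3)"
        if "A u x1" "A u x2" "A u x3" "A v y1" "A v y2" "A v y3"
          and "cycle_adj m x1 y1" "cycle_adj m x2 y2" "cycle_adj m x3 y3" for u v x1 x2 x3 y1 y2 y3
        using two[OF that(1-3)] two[OF that(4-6)] that(7-9) unfolding g_def by auto
    qed (auto simp: g_def)
    then show ?thesis unfolding U_def guess_ok_def by blast
  next
    case False
    obtain Cs N where pcN: "path_consistent V (guess_ok m (2 * k + 3) L (\<lambda>_. v0) Cs) E (cycle_adj m) N"
      and N: "N v0 (Cs 0) v0 (Cs 0)" using accept[of "\<lambda>_. v0"] v0 by blast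
    define U where "U = guess_ok m (2 * k + 3) L (\<lambda>_. v0) Cs"
    note pcN = pcN[folded U_def]
    define A where "A u x \<longleftrightarrow> u \<in> V \<and> x < m \<and> has_walk m (D v0 u) (int (Cs 0)) (int x)" for u x
    define h where "h u x = (SOME h. \<bar>h\<bar> \<le> int (D v0 u) \<and> even (h - int (D v0 u)) \<and> int m dvd int x - int (Cs 0) - h)"
      for u and x :: nat
    have h: "\<bar>h u x\<bar> \<le> int (D v0 u)" "even (h u x - int (D v0 u))" "int m dvd int x - int (Cs 0) - h u x"
      if "A u x" for u x
      using someI_ex[of "\<lambda>h. \<bar>h\<bar> \<le> int (D v0 u) \<and> even (h - int (D v0 u)) \<and> int m dvd int x - int (Cs 0) - h"] that
      unfolding A_def has_walk_def h_def by blast+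
    have adj: "cycle_adj m x y \<longleftrightarrow> \<bar>h u x - h v y\<bar> \<le> 1" if uv: "(u, v) \<in> E" and A: "A u x" "A v y" for u v x y
    proof (rule adjacent_offsets[OF m k _ _ _ h[OF A(1)] h[OF A(2)]])
      have vu: "(v, u) \<in> E" using uv E(1) by (auto dest: symD)
      have "D v0 u \<noteq> D v0 v" using False uv by blast
      then show "D v0 v = Suc (D v0 u) \<or> D v0 u = Suc (D v0 v)"
        using Dstep[OF v0 uv] Dstep[OF v0 vu] by linarith
    qed (use A Dle v0 in \<open>auto simp: A_def\<close>)
    define g where "g u = median_by (h u)" for u
    have gA: "A u (g u x1 x2 x3)" if "A u x1" "A u x2" "A u x3" for u x1 x2 x3
      using median_by_in[of "h u" x1 x2 x3] that unfolding g_def by metis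
    have "\<exists>f. (\<forall>v\<in>V. U v (f v)) \<and> (\<forall>(u, v)\<in>E. cycle_adj m (f u) (f v))"
    proof (rule majority_solution[where g = g and A = A, OF E cycle_adj_sym V pcN N])
      show "U u x1 \<Longrightarrow> U u x2 \<Longrightarrow> U u x3 \<Longrightarrow> U u (g u x1 x2 x3)" for u x1 x2 x3
        using median_by_in[of "h u" x1 x2 x3] unfolding g_def by metis
      show "A u x" if pc: "path_consistent V U E (cycle_adj m) N'" and N': "N' u x u x" for N' u x
      proof -
        have u: "u \<in> V" using path_consistentD(1)[OF pc N'] .
        obtain w where w: "N' v0 w u x" using path_consistentD(6)[OF pc N' v0] by blast
        have "w = Cs 0" using path_consistentD(3)[OF pc w] unfolding U_def guess_ok_def by auto
        then have "has_walk m (D v0 u) (int (Cs 0)) (int x)"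
          using path_consistent_has_walk[OF pc E(2) Dpow[OF v0 u] w] by simp
        moreover have "x < m" using path_consistentD(3)[OF pc N'] unfolding U_def guess_ok_def by simp
        ultimately show ?thesis unfolding A_def using u by simp
      qed
      show "cycle_adj m (g u x1 x2 x3) (g v y1 y2 y3)"
        if uv: "(u, v) \<in> E" and A: "A u x1" "A u x2" "A u x3" "A v y1" "A v y2" "A v y3"
          and H: "cycle_adj m x1 y1" "cycle_adj m x2 y2" "cycle_adj m x3 y3" for u v x1 x2 x3 y1 y2 y3
      proof -
        have "\<bar>h u (g u x1 x2 x3) - h v (g v y1 y2 y3)\<bar> \<le> 1"
          unfolding g_def median_by_value
          by (rule median_close) (use adj[OF uv] A H in blast)+
        then show ?thesis using adj[OF uv gA[OF A(1-3)] gA[OF A(4-6)]] by simp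
      qed
    qed (auto simp: g_def median_by_def)
    then show ?thesis unfolding U_def guess_ok_def by blast
  qed
qed

section \<open>The fixed point as a formula\<close>

text \<open>\<open>\<mu>\<close> is an infimum, so a walk is extracted from the strict bound by k +
  2; as its cost is the natural number of its edges, it has at most k + 1 of them.\<close>

lemma short_walk_if_small_diameter:
  assumes "pair_graph G" "graph_diameter G \<le> ereal (real (k + 1))" "u \<in> pverts G" "v \<in> pverts G"
  shows "\<exists>d\<le>k + 1. (u, v) \<in> parcs G ^^ d"
proof -
  interpret pair_graph G by fact
  have "\<mu> (\<lambda>_. 1) u v \<le> graph_diameter G"
    unfolding graph_diameter_def by (rule SUP_upper2[OF assms(3)], rule SUP_upper[OF assms(4)])
  also have "\<dots> \<le> ereal (real (k + 1))" by fact
  also have "\<dots> < ereal (real (k + 2))" by simp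
  finally obtain p where p: "awalk u p v" "ereal (awalk_cost (\<lambda>_. 1) p) < ereal (real (k + 2))"
    unfolding \<mu>_def INF_less_iff by blast
  have "awalk_cost (\<lambda>_. 1) p = real (length p)" by (induction p) auto
  then have "length p \<le> k + 1" using p(2) by simp
  moreover have "awalk u p v \<Longrightarrow> (u, v) \<in> parcs G ^^ length p" for u
  proof (induction p arbitrary: u)
    case Nil
    then show ?case by (simp add: awalk_Nil_iff)
  next
    case (Cons e p)
    then have "(u, snd e) \<in> parcs G" "(snd e, v) \<in> parcs G ^^ length p" by (auto simp: awalk_Cons_iff)
    then show ?case using relpow_Suc_I2 by fastforce
  qed
  ultimately show ?thesis using p(1) by blast
qed

lemma cycle_graph_simps:
  "pverts (cycle_graph m) = {..<m}" "card (pverts (cycle_graph m)) = m"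
  by (simp_all add: cycle_graph_def)

text \<open>Adjacency in the form that the formula language can express, which has addition and
  multiplication but no remainders.\<close>

lemma step_mod_iff:
  assumes m: "3 \<le> m" and xy: "x < m" "y < m"
  shows "step_mod m (int x) (int y) \<longleftrightarrow> y = x + 1 \<or> x = y + 1 \<or> x = 0 \<and> y = m - 1 \<or> y = 0 \<and> x = m - 1"
proof
  assume "step_mod m (int x) (int y)"
  then consider "int m dvd int y - int x - 1" | "int m dvd int y - int x + 1" unfolding step_mod_def by blast
  then show "y = x + 1 \<or> x = y + 1 \<or> x = 0 \<and> y = m - 1 \<or> y = 0 \<and> x = m - 1"
  proof cases
    case 1
    have "\<bar>int y - int x - 1\<bar> < 2 * int m" using assms by linarith
    from small_multiple_cases[OF 1 this] show ?thesis using assms by arith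
  next
    case 2
    have "\<bar>int y - int x + 1\<bar> < 2 * int m" using assms by linarith
    from small_multiple_cases[OF 2 this] show ?thesis using assms by arith
  qed
next
  assume "y = x + 1 \<or> x = y + 1 \<or> x = 0 \<and> y = m - 1 \<or> y = 0 \<and> x = m - 1"
  then show "step_mod m (int x) (int y)" unfolding step_mod_def using m by (auto simp: of_nat_diff)
qed

lemma cycle_graph_arc_iff:
  assumes "3 \<le> m"
  shows "(x, y) \<in> parcs (cycle_graph m) \<longleftrightarrow> cycle_adj m x y"
proof -
  have Suc_mod: "y = Suc x mod m \<longleftrightarrow> y = x + 1 \<or> y = 0 \<and> x = m - 1" if "x < m" "y < m" for x y
    using that by (cases "Suc x = m") auto
  show ?thesis
    using step_mod_iff[OF assms, of x y] Suc_mod[of x y] Suc_mod[of y x]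
    unfolding cycle_graph_def cycle_adj_def by auto
qed

section \<open>Coding of tuples as numbers\<close>

definition code :: "nat \<Rightarrow> nat list \<Rightarrow> nat" where
  "code b ds = foldr (\<lambda>d c. c * b + d) ds 0"

lemma code_simps [simp]: "code b [] = 0" "code b (d # ds) = code b ds * b + d"
  by (simp_all add: code_def)

lemma code_less: "\<forall>d\<in>set ds. d < b \<Longrightarrow> code b ds < b ^ length ds"
proof (induction ds)
  case (Cons d ds)
  then have "code b ds * b + d < (code b ds + 1) * b" by simp
  also have "\<dots> \<le> b ^ length ds * b" using Cons by (intro mult_right_mono) auto
  finally show ?case by (simp add: mult.commute)
qed simp

lemma code_inject:
  "length ds = length ds' \<Longrightarrow> \<forall>d\<in>set ds. d < b \<Longrightarrow> \<forall>d\<in>set ds'. d < b \<Longrightarrow> code b ds = code b ds' \<Longrightarrow> ds = ds'"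
proof (induction ds ds' rule: list_induct2)
  case (Cons d ds d' ds')
  have d: "d < b" "d' < b" and eq: "code b ds * b + d = code b ds' * b + d'" using Cons.prems by auto
  have "(code b ds * b + d) mod b = d" "(code b ds' * b + d') mod b = d'" using d by simp_all
  then have "d = d'" using eq by simp
  moreover have "code b ds = code b ds'" using eq \<open>d = d'\<close> d by simp
  ultimately show ?case using Cons by simp
qed simp

section \<open>Derived connectives and quantifier blocks\<close>

definition Disj :: "fm \<Rightarrow> fm \<Rightarrow> fm" where
  "Disj f g = Neg (Conj (Neg f) (Neg g))"

definition Disjs :: "fm list \<Rightarrow> fm" where
  "Disjs fs = foldr Disj fs (Eq (Cst 0) (Cst 1))"

definition Forall :: "nat \<Rightarrow> tm \<Rightarrow> fm \<Rightarrow> fm" where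
  "Forall j b f = Neg (Exists j b (Neg f))"

definition Exs :: "nat list \<Rightarrow> tm \<Rightarrow> fm \<Rightarrow> fm" where
  "Exs js b f = foldr (\<lambda>j. Exists j b) js f"

lemma fval_Disj [simp]: "fval inp X e (Disj f g) \<longleftrightarrow> fval inp X e f \<or> fval inp X e g"
  by (simp add: Disj_def)

lemma fval_Disjs [simp]: "fval inp X e (Disjs fs) \<longleftrightarrow> (\<exists>f\<in>set fs. fval inp X e f)"
  unfolding Disjs_def by (induction fs) simp_all

lemma fval_Forall [simp]: "fval inp X e (Forall j b f) \<longleftrightarrow> (\<forall>x<tval e b. fval inp X (e(j := x)) f)"
  by (simp add: Forall_def)

lemma fvars_below_Disj [simp]: "fvars_below q (Disj f g) \<longleftrightarrow> fvars_below q f \<and> fvars_below q g"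
  by (simp add: Disj_def)

lemma fvars_below_Disjs [simp]: "fvars_below q (Disjs fs) \<longleftrightarrow> (\<forall>f\<in>set fs. fvars_below q f)"
  unfolding Disjs_def by (induction fs) simp_all

lemma fvars_below_Forall [simp]: "fvars_below q (Forall j b f) \<longleftrightarrow> j < q \<and> tvars_below q b \<and> fvars_below q f"
  by (simp add: Forall_def)

lemma fvars_below_Exs:
  "\<forall>j\<in>set js. j < q \<Longrightarrow> tvars_below q b \<Longrightarrow> fvars_below q f \<Longrightarrow> fvars_below q (Exs js b f)"
  by (induction js) (auto simp: Exs_def)

text \<open>The bound depends on variable 0 only, which the block does not bind, so it stays
  constant while the quantifiers are unfolded and their witnesses merge into one function.\<close>

lemma fval_Exs:
  assumes b: "\<forall>e e'. e 0 = e' 0 \<longrightarrow> tval e b = tval e' b"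
  shows "0 \<notin> set js \<Longrightarrow> fval inp X e (Exs js b f) \<longleftrightarrow>
    (\<exists>h. (\<forall>j\<in>set js. h j < tval e b) \<and> fval inp X (override_on e h (set js)) f)"
proof (induction js arbitrary: e)
  case Nil
  then show ?case by (simp add: Exs_def)
next
  case (Cons j js)
  have b': "tval (e(j := x)) b = tval e b" for x
    by (rule b[rule_format]) (use Cons.prems in auto)
  have IH: "fval inp X (e(j := x)) (Exs js b f) \<longleftrightarrow>
    (\<exists>h. (\<forall>j\<in>set js. h j < tval e b) \<and> fval inp X (override_on (e(j := x)) h (set js)) f)" for x
  proof -
    have "0 \<notin> set js" using Cons.prems by simp
    from Cons.IH[OF this, of "e(j := x)"] show ?thesis unfolding b' .
  qed
  have upd: "override_on (e(j := x)) h (set js) = override_on e (\<lambda>i. if i \<in> set js then h i else x) (set (j # js))" for x h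
    by (auto simp: override_on_def)
  have upd': "override_on e h (set (j # js)) = override_on (e(j := h j)) h (set js)" for h
    by (auto simp: override_on_def)
  show ?case
  proof
    assume "fval inp X e (Exs (j # js) b f)"
    then obtain x h where "x < tval e b" "\<forall>j\<in>set js. h j < tval e b"
      "fval inp X (override_on (e(j := x)) h (set js)) f"
      unfolding Exs_def foldr.simps o_def using IH[unfolded Exs_def] by auto
    then show "\<exists>h. (\<forall>j\<in>set (j # js). h j < tval e b) \<and> fval inp X (override_on e h (set (j # js))) f"
      unfolding upd by (intro exI[of _ "\<lambda>i. if i \<in> set js then h i else x"]) auto
  next
    assume "\<exists>h. (\<forall>j\<in>set (j # js). h j < tval e b) \<and> fval inp X (override_on e h (set (j # js))) f"
    then obtain h where h: "h j < tval e b" "\<forall>j\<in>set js. h j < tval e b"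
      "fval inp X (override_on (e(j := h j)) h (set js)) f" unfolding upd' by auto
    then have "fval inp X (e(j := h j)) (Exs js b f)" using IH by blast
    then show "fval inp X e (Exs (j # js) b f)" using h(1) by (auto simp: Exs_def)
  qed
qed

text \<open>Variable \<open>0\<close> holds the number of vertices and variable \<open>1\<close> the table index under
  consideration. A position of the game consists of two coloured vertices \<open>u, x\<close> and \<open>v, y\<close> and of
  \<open>r\<close> guessed vertices \<open>Vs\<close> with colours \<open>Cs\<close>; these digits are coded in base \<open>n + m\<close>.\<close>

definition base_tm :: "nat \<Rightarrow> tm" where
  "base_tm m = Add (Var 0) (Cst m)"

primrec code_tm :: "nat \<Rightarrow> nat list \<Rightarrow> tm" where
  "code_tm m [] = Cst 0"
| "code_tm m (j # js) = Add (Mul (code_tm m js) (base_tm m)) (Var j)"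

primrec bound_tm :: "nat \<Rightarrow> nat \<Rightarrow> tm" where
  "bound_tm m 0 = Cst 1"
| "bound_tm m (Suc i) = Mul (base_tm m) (bound_tm m i)"

lemma tval_base_tm [simp]: "tval e (base_tm m) = e 0 + m"
  by (simp add: base_tm_def)

lemma tval_code_tm [simp]: "tval e (code_tm m js) = code (e 0 + m) (map e js)"
  by (induction js) auto

lemma tval_bound_tm [simp]: "tval e (bound_tm m i) = (e 0 + m) ^ i"
  by (induction i) auto

lemma tvars_below_base_tm [simp]: "tvars_below q (base_tm m) \<longleftrightarrow> 0 < q"
  by (simp add: base_tm_def)

lemma tvars_below_code_tm: "0 < q \<Longrightarrow> \<forall>j\<in>set js. j < q \<Longrightarrow> tvars_below q (code_tm m js)"
  by (induction js) auto

lemma tvars_below_bound_tm: "0 < q \<Longrightarrow> tvars_below q (bound_tm m i)"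
  by (induction i) auto

text \<open>The operator never changes the guess \<open>Vs\<close>, \<open>Cs\<close>, so the fixed
  points for the different guesses evolve independently within one table.\<close>

definition position :: "nat \<Rightarrow> nat \<Rightarrow> (nat \<Rightarrow> nat) \<Rightarrow> (nat \<Rightarrow> nat) \<Rightarrow> nat \<Rightarrow> nat \<Rightarrow> nat \<Rightarrow> nat \<Rightarrow> nat" where
  "position b r Vs Cs u x v y = code b ([u, x, v, y] @ map Vs [0..<r] @ map Cs [0..<r])"

text \<open>The shift n + 2 skips the length in cell 0, the n ones and the separator. The adjacency
  matrix starts there, and the lists n * n cells later.\<close>

definition conflict :: "(nat \<Rightarrow> nat) \<Rightarrow> nat \<Rightarrow> nat \<Rightarrow> nat \<Rightarrow> (nat \<Rightarrow> nat) \<Rightarrow> (nat \<Rightarrow> nat) \<Rightarrow> nat \<Rightarrow> nat \<Rightarrow> nat \<Rightarrow> nat \<Rightarrow> bool" where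
  "conflict inp m n r Vs Cs u x v y \<longleftrightarrow>
     inp (n + 2 + n * n + u * m + x) = 0 \<or> (u = v \<and> x \<noteq> y) \<or>
     (inp (n + 2 + u * n + v) \<noteq> 0 \<and>
       \<not> (y = x + 1 \<or> x = y + 1 \<or> x = 0 \<and> y = m - 1 \<or> y = 0 \<and> x = m - 1)) \<or>
     (\<exists>i<r. u = Vs i \<and> x \<noteq> Cs i)"

definition position_tm :: "nat \<Rightarrow> nat \<Rightarrow> nat \<Rightarrow> nat \<Rightarrow> nat \<Rightarrow> nat \<Rightarrow> tm" where
  "position_tm m r u x v y = code_tm m ([u, x, v, y] @ [2..<2 + r] @ [2 + r..<2 + 2 * r])"

definition conflict_fm :: "nat \<Rightarrow> nat \<Rightarrow> fm" where
  "conflict_fm m r = (let u = Var (2 + 2 * r); x = Var (3 + 2 * r); v = Var (4 + 2 * r); y = Var (5 + 2 * r) in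
     Disjs ([Neg (Bit (Add (Add (Add (Add (Var 0) (Cst 2)) (Mul (Var 0) (Var 0))) (Mul u (Cst m))) x)),
       Conj (Eq u v) (Neg (Eq x y)),
       Conj (Bit (Add (Add (Add (Var 0) (Cst 2)) (Mul u (Var 0))) v))
         (Neg (Disjs [Eq y (Add x (Cst 1)), Eq x (Add y (Cst 1)),
            Conj (Eq x (Cst 0)) (Eq y (Cst (m - 1))), Conj (Eq y (Cst 0)) (Eq x (Cst (m - 1)))]))] @
       map (\<lambda>i. Conj (Eq u (Var (2 + i))) (Neg (Eq x (Var (2 + r + i))))) [0..<r]))"

text \<open>The index in variable 1 is decoded by guessing its digits. The pair it codes is refuted
  if it conflicts outright or if, for some vertex \<open>w\<close>, every colour \<open>z\<close>
  has one of its two pairs already in the table. Variables from 2 on hold the guessed vertices,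
  their colours, u, x, v, y, and finally w and z.\<close>

definition step_fm :: "nat \<Rightarrow> nat \<Rightarrow> fm" where
  "step_fm m r = Exs [2..<6 + 2 * r] (base_tm m)
     (Conj (Eq (Var 1) (position_tm m r (2 + 2 * r) (3 + 2 * r) (4 + 2 * r) (5 + 2 * r)))
       (Disj (conflict_fm m r)
         (Exists (6 + 2 * r) (Var 0) (Forall (7 + 2 * r) (Cst m)
           (Disj (Tab (position_tm m r (2 + 2 * r) (3 + 2 * r) (6 + 2 * r) (7 + 2 * r)))
             (Tab (position_tm m r (6 + 2 * r) (7 + 2 * r) (4 + 2 * r) (5 + 2 * r))))))))"

text \<open>It suffices to inspect the first guessed vertex: it can only carry its guessed colour,
  so its diagonal pair survives whenever any pair does.\<close>

definition accept_fm :: "nat \<Rightarrow> nat \<Rightarrow> fm" where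
  "accept_fm m r = Neg (Exs [2..<2 + r] (Var 0) (Neg (Exs [2 + r..<2 + 2 * r] (Cst m)
     (Neg (Tab (position_tm m r 2 (2 + r) 2 (2 + r)))))))"

lemma map_upt_shift: "map e [a..<a + r] = map (\<lambda>i. e (a + i)) [0..<r]"
  by (rule nth_equalityI) auto

lemma tval_position_tm:
  "tval e (position_tm m r u x v y) =
     position (e 0 + m) r (\<lambda>i. e (2 + i)) (\<lambda>i. e (2 + r + i)) (e u) (e x) (e v) (e y)"
proof -
  have "map e [2 + r..<2 + 2 * r] = map (\<lambda>i. e (2 + r + i)) [0..<r]"
    using map_upt_shift[of e "2 + r" r] by (simp add: mult_2)
  then show ?thesis unfolding position_tm_def position_def
    by (simp only: tval_code_tm map_append list.map map_upt_shift)
qed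

lemma fval_conflict_fm:
  "fval inp X e (conflict_fm m r) \<longleftrightarrow>
     conflict inp m (e 0) r (\<lambda>i. e (2 + i)) (\<lambda>i. e (2 + r + i))
       (e (2 + 2 * r)) (e (3 + 2 * r)) (e (4 + 2 * r)) (e (5 + 2 * r))"
proof -
  have split: "(\<exists>f\<in>set (fs @ map g [0..<r]). P f) \<longleftrightarrow> (\<exists>f\<in>set fs. P f) \<or> (\<exists>i<r. P (g i))"
    for P :: "fm \<Rightarrow> bool" and fs g by auto
  show ?thesis
    unfolding conflict_fm_def conflict_def Let_def
    by (simp only: fval_Disj fval_Disjs fval_Forall split list.set bex_simps fval.simps tval.simps not_not simp_thms disj_assoc)
qed

lemma position_cong:
  "(\<And>i. i < r \<Longrightarrow> Vs i = Vs' i) \<Longrightarrow> (\<And>i. i < r \<Longrightarrow> Cs i = Cs' i) \<Longrightarrow>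
    position b r Vs Cs u x v y = position b r Vs' Cs' u x v y"
  unfolding position_def by (metis (no_types, lifting) atLeastLessThan_iff atLeastLessThan_upt map_cong)

lemma conflict_cong:
  "(\<And>i. i < r \<Longrightarrow> Vs i = Vs' i) \<Longrightarrow> (\<And>i. i < r \<Longrightarrow> Cs i = Cs' i) \<Longrightarrow>
    conflict inp m n r Vs Cs u x v y = conflict inp m n r Vs' Cs' u x v y"
  unfolding conflict_def by auto

lemma position_inject:
  assumes "position b r Vs Cs u x v y = position b r Vs' Cs' u' x' v' y'"
    and "\<And>i. i < r \<Longrightarrow> Vs i < b \<and> Cs i < b \<and> Vs' i < b \<and> Cs' i < b"
    and "u < b" "x < b" "v < b" "y < b" "u' < b" "x' < b" "v' < b" "y' < b"
  shows "u = u'" "x = x'" "v = v'" "y = y'" "\<And>i. i < r \<Longrightarrow> Vs i = Vs' i" "\<And>i. i < r \<Longrightarrow> Cs i = Cs' i"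
proof -
  have "[u, x, v, y] @ map Vs [0..<r] @ map Cs [0..<r] = [u', x', v', y'] @ map Vs' [0..<r] @ map Cs' [0..<r]"
    by (rule code_inject[OF _ _ _ assms(1)[unfolded position_def]]) (use assms(2-) in auto)
  then show "u = u'" "x = x'" "v = v'" "y = y'" "\<And>i. i < r \<Longrightarrow> Vs i = Vs' i" "\<And>i. i < r \<Longrightarrow> Cs i = Cs' i"
    by simp_all
qed

lemma fval_step_matrix:
  "fval inp X e (Conj (Eq (Var 1) (position_tm m r (2 + 2 * r) (3 + 2 * r) (4 + 2 * r) (5 + 2 * r)))
       (Disj (conflict_fm m r)
         (Exists (6 + 2 * r) (Var 0) (Forall (7 + 2 * r) (Cst m)
           (Disj (Tab (position_tm m r (2 + 2 * r) (3 + 2 * r) (6 + 2 * r) (7 + 2 * r)))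
             (Tab (position_tm m r (6 + 2 * r) (7 + 2 * r) (4 + 2 * r) (5 + 2 * r)))))))) \<longleftrightarrow>
    e 1 = position (e 0 + m) r (\<lambda>i. e (2 + i)) (\<lambda>i. e (2 + r + i)) (e (2 + 2 * r)) (e (3 + 2 * r)) (e (4 + 2 * r)) (e (5 + 2 * r)) \<and>
    (conflict inp m (e 0) r (\<lambda>i. e (2 + i)) (\<lambda>i. e (2 + r + i)) (e (2 + 2 * r)) (e (3 + 2 * r)) (e (4 + 2 * r)) (e (5 + 2 * r)) \<or>
     (\<exists>w<e 0. \<forall>z<m. position (e 0 + m) r (\<lambda>i. e (2 + i)) (\<lambda>i. e (2 + r + i)) (e (2 + 2 * r)) (e (3 + 2 * r)) w z \<in> X \<or>
        position (e 0 + m) r (\<lambda>i. e (2 + i)) (\<lambda>i. e (2 + r + i)) w z (e (4 + 2 * r)) (e (5 + 2 * r)) \<in> X))"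
proof -
  let ?e = "\<lambda>w z. e(6 + 2 * r := w, 7 + 2 * r := z)"
  have upd: "?e w z 0 = e 0" "?e w z (2 + 2 * r) = e (2 + 2 * r)" "?e w z (3 + 2 * r) = e (3 + 2 * r)"
    "?e w z (4 + 2 * r) = e (4 + 2 * r)" "?e w z (5 + 2 * r) = e (5 + 2 * r)"
    "?e w z (6 + 2 * r) = w" "?e w z (7 + 2 * r) = z" for w z
    by auto
  have pos: "position b r (\<lambda>i. ?e w z (2 + i)) (\<lambda>i. ?e w z (2 + r + i)) =
     position b r (\<lambda>i. e (2 + i)) (\<lambda>i. e (2 + r + i))" for b w z
    by (intro ext position_cong) auto
  show ?thesis
    by (simp only: fval.simps fval_Disj fval_Disjs fval_Forall tval_position_tm fval_conflict_fm tval.simps upd pos)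
qed

lemma fval_step_fm:
  fixes inp X n p m r
  shows "fval inp X (init_env n p) (step_fm m r) \<longleftrightarrow>
    (\<exists>Vs Cs u x v y. (\<forall>i<r. Vs i < n + m \<and> Cs i < n + m) \<and> u < n + m \<and> x < n + m \<and> v < n + m \<and> y < n + m \<and>
       p = position (n + m) r Vs Cs u x v y \<and>
       (conflict inp m n r Vs Cs u x v y \<or>
        (\<exists>w<n. \<forall>z<m. position (n + m) r Vs Cs u x w z \<in> X \<or> position (n + m) r Vs Cs w z v y \<in> X)))"
    (is "?L \<longleftrightarrow> ?R")
proof -
  let ?S = "set [2..<6 + 2 * r]"
  let ?e = "\<lambda>h. override_on (init_env n p) h ?S"
  have L: "?L \<longleftrightarrow> (\<exists>h. (\<forall>j\<in>?S. h j < n + m) \<and>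
      p = position (n + m) r (\<lambda>i. ?e h (2 + i)) (\<lambda>i. ?e h (2 + r + i)) (?e h (2 + 2 * r)) (?e h (3 + 2 * r)) (?e h (4 + 2 * r)) (?e h (5 + 2 * r)) \<and>
      (conflict inp m n r (\<lambda>i. ?e h (2 + i)) (\<lambda>i. ?e h (2 + r + i)) (?e h (2 + 2 * r)) (?e h (3 + 2 * r)) (?e h (4 + 2 * r)) (?e h (5 + 2 * r)) \<or>
       (\<exists>w<n. \<forall>z<m. position (n + m) r (\<lambda>i. ?e h (2 + i)) (\<lambda>i. ?e h (2 + r + i)) (?e h (2 + 2 * r)) (?e h (3 + 2 * r)) w z \<in> X \<or>
          position (n + m) r (\<lambda>i. ?e h (2 + i)) (\<lambda>i. ?e h (2 + r + i)) w z (?e h (4 + 2 * r)) (?e h (5 + 2 * r)) \<in> X)))"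
  proof -
    have e0: "?e h 0 = n" "?e h 1 = p" for h by (simp_all add: override_on_def)
    have nz: "0 \<notin> ?S" by simp
    have dep: "\<forall>e e'. e 0 = e' 0 \<longrightarrow> tval e (base_tm m) = tval e' (base_tm m)" by simp
    show ?thesis
      unfolding step_fm_def fval_Exs[OF dep nz] fval_step_matrix e0 tval_base_tm init_env_simps ..
  qed
  show ?thesis
  proof
    assume ?L
    then obtain h where h: "\<forall>j\<in>?S. h j < n + m"
      and *: "p = position (n + m) r (\<lambda>i. ?e h (2 + i)) (\<lambda>i. ?e h (2 + r + i)) (?e h (2 + 2 * r)) (?e h (3 + 2 * r)) (?e h (4 + 2 * r)) (?e h (5 + 2 * r))"
      "conflict inp m n r (\<lambda>i. ?e h (2 + i)) (\<lambda>i. ?e h (2 + r + i)) (?e h (2 + 2 * r)) (?e h (3 + 2 * r)) (?e h (4 + 2 * r)) (?e h (5 + 2 * r)) \<or>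
       (\<exists>w<n. \<forall>z<m. position (n + m) r (\<lambda>i. ?e h (2 + i)) (\<lambda>i. ?e h (2 + r + i)) (?e h (2 + 2 * r)) (?e h (3 + 2 * r)) w z \<in> X \<or>
          position (n + m) r (\<lambda>i. ?e h (2 + i)) (\<lambda>i. ?e h (2 + r + i)) w z (?e h (4 + 2 * r)) (?e h (5 + 2 * r)) \<in> X)"
      unfolding L by blast
    have lt: "?e h j < n + m" if "2 \<le> j" "j < 6 + 2 * r" for j
      using h that by (simp add: override_on_def)
    have c: "\<forall>i<r. ?e h (2 + i) < n + m \<and> ?e h (2 + r + i) < n + m" by (intro allI impI conjI lt) simp_all
    have c': "?e h (2 + 2 * r) < n + m" "?e h (3 + 2 * r) < n + m" "?e h (4 + 2 * r) < n + m" "?e h (5 + 2 * r) < n + m"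
      by (rule lt; simp)+
    show ?R
      by (rule exI[of _ "\<lambda>i. ?e h (2 + i)"], rule exI[of _ "\<lambda>i. ?e h (2 + r + i)"], rule exI[of _ "?e h (2 + 2 * r)"],
          rule exI[of _ "?e h (3 + 2 * r)"], rule exI[of _ "?e h (4 + 2 * r)"], rule exI[of _ "?e h (5 + 2 * r)"],
          intro conjI c c' *)
  next
    assume ?R
    then obtain Vs Cs u x v y where lt: "\<forall>i<r. Vs i < n + m \<and> Cs i < n + m" "u < n + m" "x < n + m" "v < n + m" "y < n + m"
      and *: "p = position (n + m) r Vs Cs u x v y"
       "conflict inp m n r Vs Cs u x v y \<or>
        (\<exists>w<n. \<forall>z<m. position (n + m) r Vs Cs u x w z \<in> X \<or> position (n + m) r Vs Cs w z v y \<in> X)"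
      by blast
    define h where "h j = (if j < 2 + r then Vs (j - 2) else if j < 2 + 2 * r then Cs (j - 2 - r)
      else if j = 2 + 2 * r then u else if j = 3 + 2 * r then x else if j = 4 + 2 * r then v else y)" for j
    have e: "?e h (2 + 2 * r) = u" "?e h (3 + 2 * r) = x" "?e h (4 + 2 * r) = v" "?e h (5 + 2 * r) = y"
      by (auto simp: h_def override_on_def)
    have eV: "?e h (2 + i) = Vs i" "?e h (2 + r + i) = Cs i" if "i < r" for i
      using that by (auto simp: h_def override_on_def)
    have pos: "position (n + m) r (\<lambda>i. ?e h (2 + i)) (\<lambda>i. ?e h (2 + r + i)) = position (n + m) r Vs Cs"
      by (intro ext position_cong eV)
    have con: "conflict inp m n r (\<lambda>i. ?e h (2 + i)) (\<lambda>i. ?e h (2 + r + i)) = conflict inp m n r Vs Cs"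
      by (intro ext conflict_cong eV)
    have hS: "\<forall>j\<in>?S. h j < n + m" using lt by (auto simp: h_def)
    show ?L unfolding L by (rule exI[of _ h], unfold e pos con, intro conjI hS *)
  qed
qed

text \<open>The table occurs only positively in the formula.\<close>

lemma fval_step_fm_mono:
  assumes "X \<subseteq> Y" "fval inp X (init_env n p) (step_fm m r)"
  shows "fval inp Y (init_env n p) (step_fm m r)"
proof -
  obtain Vs Cs u x v y where pos: "\<forall>i<r. Vs i < n + m \<and> Cs i < n + m" "u < n + m" "x < n + m" "v < n + m" "y < n + m"
     "p = position (n + m) r Vs Cs u x v y"
    and "conflict inp m n r Vs Cs u x v y \<or>
      (\<exists>w<n. \<forall>z<m. position (n + m) r Vs Cs u x w z \<in> X \<or> position (n + m) r Vs Cs w z v y \<in> X)"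
    using assms(2) unfolding fval_step_fm by (elim exE conjE) blast
  then have "conflict inp m n r Vs Cs u x v y \<or>
      (\<exists>w<n. \<forall>z<m. position (n + m) r Vs Cs u x w z \<in> Y \<or> position (n + m) r Vs Cs w z v y \<in> Y)"
    using assms(1) by blast
  then show ?thesis unfolding fval_step_fm using pos by blast
qed

lemma fval_accept_fm:
  assumes "0 < r"
  shows "fval inp X (init_env n p) (accept_fm m r) \<longleftrightarrow>
    (\<forall>Vs. (\<forall>i<r. Vs i < n) \<longrightarrow> (\<exists>Cs. (\<forall>i<r. Cs i < m) \<and>
       position (n + m) r Vs Cs (Vs 0) (Cs 0) (Vs 0) (Cs 0) \<notin> X))" (is "?L \<longleftrightarrow> ?R")
proof -
  let ?S = "set [2..<2 + r]" and ?T = "set [2 + r..<2 + 2 * r]"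
  let ?e = "\<lambda>h h'. override_on (override_on (init_env n p) h ?S) h' ?T"
  have L: "?L \<longleftrightarrow> (\<forall>h. (\<forall>j\<in>?S. h j < n) \<longrightarrow> (\<exists>h'. (\<forall>j\<in>?T. h' j < m) \<and>
    tval (?e h h') (position_tm m r 2 (2 + r) 2 (2 + r)) \<notin> X))"
  proof -
    have nz: "0 \<notin> ?S" "0 \<notin> ?T" by simp_all
    have dep: "\<forall>e e'. e 0 = e' 0 \<longrightarrow> tval e (Var 0) = tval e' (Var 0)"
      "\<forall>e e'. e 0 = e' 0 \<longrightarrow> tval e (Cst m) = tval e' (Cst m)"
      by simp_all
    show ?thesis
      unfolding accept_fm_def fval.simps fval_Exs[OF dep(1) nz(1)] fval_Exs[OF dep(2) nz(2)] tval.simps init_env_simps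
      by blast
  qed
  have pos: "tval (?e h h') (position_tm m r 2 (2 + r) 2 (2 + r)) =
    position (n + m) r Vs Cs (Vs 0) (Cs 0) (Vs 0) (Cs 0)"
    if "\<And>i. i < r \<Longrightarrow> h (2 + i) = Vs i" "\<And>i. i < r \<Longrightarrow> h' (2 + r + i) = Cs i" for h h' Vs Cs
  proof -
    have e: "?e h h' (2 + i) = Vs i" "?e h h' (2 + r + i) = Cs i" if "i < r" for i
      using that \<open>\<And>i. i < r \<Longrightarrow> h (2 + i) = Vs i\<close> \<open>\<And>i. i < r \<Longrightarrow> h' (2 + r + i) = Cs i\<close> by (auto simp: override_on_def)
    have "?e h h' 0 = n" by (auto simp: override_on_def)
    moreover have "position (n + m) r (\<lambda>i. ?e h h' (2 + i)) (\<lambda>i. ?e h h' (2 + r + i)) = position (n + m) r Vs Cs"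
      by (intro ext position_cong e)
    ultimately show ?thesis unfolding tval_position_tm using e[of 0] assms by simp
  qed
  show ?thesis
  proof
    assume ?L
    show ?R
    proof (intro allI impI)
      fix Vs :: "nat \<Rightarrow> nat" assume Vs: "\<forall>i<r. Vs i < n"
      then have "\<forall>j\<in>?S. (\<lambda>j. Vs (j - 2)) j < n" by auto
      then obtain h' where h': "\<forall>j\<in>?T. h' j < m"
        "tval (?e (\<lambda>j. Vs (j - 2)) h') (position_tm m r 2 (2 + r) 2 (2 + r)) \<notin> X"
        using L[THEN iffD1, OF \<open>?L\<close>, THEN spec, of "\<lambda>j. Vs (j - 2)"] by blast
      have "tval (?e (\<lambda>j. Vs (j - 2)) h') (position_tm m r 2 (2 + r) 2 (2 + r)) =
        position (n + m) r Vs (\<lambda>i. h' (2 + r + i)) (Vs 0) (h' (2 + r + 0)) (Vs 0) (h' (2 + r + 0))"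
        by (rule pos) simp_all
      moreover have "\<forall>i<r. h' (2 + r + i) < m"
        by (intro allI impI bspec[OF h'(1)]) (simp only: set_upt atLeastLessThan_iff, arith)
      ultimately show "\<exists>Cs. (\<forall>i<r. Cs i < m) \<and> position (n + m) r Vs Cs (Vs 0) (Cs 0) (Vs 0) (Cs 0) \<notin> X"
        using h'(2) by (intro exI[of _ "\<lambda>i. h' (2 + r + i)"]) simp
    qed
  next
    assume R: ?R
    show ?L unfolding L
    proof (intro allI impI)
      fix h assume "\<forall>j\<in>?S. h j < n"
      then have "\<forall>i<r. h (2 + i) < n" by (auto simp del: upt_Suc upt_rec_numeral)
      then obtain Cs where Cs: "\<forall>i<r. Cs i < m"
        "position (n + m) r (\<lambda>i. h (2 + i)) Cs (h (2 + 0)) (Cs 0) (h (2 + 0)) (Cs 0) \<notin> X"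
        using R[rule_format, of "\<lambda>i. h (2 + i)"] by blast
      have "tval (?e h (\<lambda>j. Cs (j - 2 - r))) (position_tm m r 2 (2 + r) 2 (2 + r)) =
        position (n + m) r (\<lambda>i. h (2 + i)) Cs (h (2 + 0)) (Cs 0) (h (2 + 0)) (Cs 0)"
        by (rule pos) simp_all
      moreover have "\<forall>j\<in>?T. (\<lambda>j. Cs (j - 2 - r)) j < m" using Cs(1) by auto
      ultimately show "\<exists>h'. (\<forall>j\<in>?T. h' j < m) \<and> tval (?e h h') (position_tm m r 2 (2 + r) 2 (2 + r)) \<notin> X"
        using Cs(2) by (intro exI[of _ "\<lambda>j. Cs (j - 2 - r)"] conjI) (simp_all only: not_False_eq_True)
    qed
  qed
qed

lemma length_concat_map_upt: "length (concat (map (\<lambda>u. map (f u) [0..<b]) [0..<a])) = a * b"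
  by (induction a) auto

lemma nth_concat_map_upt:
  "u < a \<Longrightarrow> v < b \<Longrightarrow> concat (map (\<lambda>u. map (f u) [0..<b]) [0..<a]) ! (u * b + v) = f u v"
proof (induction a)
  case (Suc a)
  show ?case
  proof (cases "u = a")
    case True
    then show ?thesis using Suc.prems by (simp add: nth_append length_concat_map_upt)
  next
    case False
    then have "u < a" using Suc.prems by simp
    then have "Suc u * b \<le> a * b" by (intro mult_right_mono) auto
    then have "u * b + v < a * b" using Suc.prems(2) by simp
    then show ?thesis using Suc False by (simp add: nth_append length_concat_map_upt)
  qed
qed simp

lemma lhom_encoding_facts:
  fixes G L m
  defines "n \<equiv> card (pverts G)" and "w \<equiv> lhom_encoding (cycle_graph m) (G, L)"
  shows "n < length w" "i < n \<Longrightarrow> w ! i" "\<not> w ! n"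
    "u < n \<Longrightarrow> v < n \<Longrightarrow> initial_memory w (n + 2 + u * n + v) \<noteq> 0 \<longleftrightarrow> (u, v) \<in> parcs G"
    "u < n \<Longrightarrow> x < m \<Longrightarrow> initial_memory w (n + 2 + n * n + u * m + x) \<noteq> 0 \<longleftrightarrow> x \<in> L u"
proof -
  let ?A = "concat (map (\<lambda>u. map (\<lambda>v. (u, v) \<in> parcs G) [0..<n]) [0..<n])"
  let ?B = "concat (map (\<lambda>v. map (\<lambda>a. a \<in> L v) [0..<m]) [0..<n])"
  have w: "w = replicate n True @ [False] @ ?A @ ?B"
    by (simp add: w_def lhom_encoding_def n_def cycle_graph_simps Let_def)
  have len: "length w = n + 1 + n * n + n * m"
    unfolding w by (simp add: length_concat_map_upt)
  show "n < length w" "i < n \<Longrightarrow> w ! i" "\<not> w ! n" by (simp_all add: w nth_append)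
  have in_range: "u * b + v < a * b" if "u < a" "v < b" for u v a b :: nat
  proof -
    have "Suc u * b \<le> a * b" using that by (intro mult_right_mono) auto
    then show ?thesis using that by simp
  qed
  show "initial_memory w (n + 2 + u * n + v) \<noteq> 0 \<longleftrightarrow> (u, v) \<in> parcs G" if "u < n" "v < n"
  proof -
    have lt: "u * n + v < n * n" using in_range that by blast
    have "w ! (n + 1 + (u * n + v)) = ?A ! (u * n + v)"
      using lt by (simp add: w nth_append length_concat_map_upt)
    also have "\<dots> \<longleftrightarrow> (u, v) \<in> parcs G" using nth_concat_map_upt[OF that, of "\<lambda>u v. (u, v) \<in> parcs G"] by simp
    finally show ?thesis using lt by (simp add: initial_memory_def len algebra_simps)
  qed
  show "initial_memory w (n + 2 + n * n + u * m + x) \<noteq> 0 \<longleftrightarrow> x \<in> L u" if "u < n" "x < m"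
  proof -
    have lt: "u * m + x < n * m" using in_range that by blast
    have "w ! (n + 1 + n * n + (u * m + x)) = ?B ! (u * m + x)"
      using lt by (simp add: w nth_append length_concat_map_upt)
    also have "\<dots> \<longleftrightarrow> x \<in> L u" using nth_concat_map_upt[OF that, of "\<lambda>u x. x \<in> L u"] by simp
    finally show ?thesis using lt by (simp add: initial_memory_def len algebra_simps)
  qed
qed

text \<open>If the formula accepts, the complement of the closed set \<open>X\<close> is a path
  consistent relation for each guess. Conversely, for a solution \<open>\<phi>\<close> the indices
  not of the form given by \<open>\<phi>\<close> form a closed set, so the least closed set
  \<open>X\<close> contains no index that agrees with \<open>\<phi>\<close>.\<close>

lemma accept_iff_list_homomorphism:
  fixes G :: "nat pair_pre_digraph" and L k
  defines "m \<equiv> 2 * k + 1" and "r \<equiv> 2 * k + 3" and "n \<equiv> card (pverts G)"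
  defines "inp \<equiv> initial_memory (lhom_encoding (cycle_graph m) (G, L))"
  assumes k: "2 \<le> k" and G: "pair_graph G" "pverts G = {..<n}"
    and diam: "graph_diameter G \<le> ereal (real (k + 1))"
    and closed: "closed_under inp n (bound_tm m (4 + 2 * r)) (step_fm m r) X"
    and least: "\<And>Y. closed_under inp n (bound_tm m (4 + 2 * r)) (step_fm m r) Y \<Longrightarrow> X \<subseteq> Y"
  shows "fval inp X (init_env n 0) (accept_fm m r) \<longleftrightarrow> (\<exists>\<phi>. list_homomorphism (cycle_graph m) G L \<phi>)"
proof -
  interpret pair_graph G by fact
  have m: "3 \<le> m" "0 < r" using k by (simp_all add: m_def r_def)
  have adj: "inp (n + 2 + u * n + v) \<noteq> 0 \<longleftrightarrow> (u, v) \<in> parcs G" if "u < n" "v < n" for u v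
    using lhom_encoding_facts(4)[of u G v m L] that by (simp add: inp_def n_def)
  have lst: "inp (n + 2 + n * n + u * m + x) \<noteq> 0 \<longleftrightarrow> x \<in> L u" if "u < n" "x < m" for u x
    using lhom_encoding_facts(5)[of u G x m L] that by (simp add: inp_def n_def)
  have E: "sym (parcs G)" "parcs G \<subseteq> pverts G \<times> pverts G"
    using sym_arcs by (auto simp: symmetric_def with_proj_def arcs_ends_conv dest: in_arcsD1 in_arcsD2)
  have conf: "conflict inp m n r Vs Cs u x v y \<longleftrightarrow>
     x \<notin> L u \<or> (u = v \<and> x \<noteq> y) \<or> ((u, v) \<in> parcs G \<and> \<not> cycle_adj m x y) \<or> (\<exists>i<r. u = Vs i \<and> x \<noteq> Cs i)"
    if "u < n" "v < n" "x < m" "y < m" for Vs Cs u x v y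
  proof -
    have "(y = x + 1 \<or> x = y + 1 \<or> x = 0 \<and> y = m - 1 \<or> y = 0 \<and> x = m - 1) \<longleftrightarrow> cycle_adj m x y"
      using step_mod_iff[OF m(1) that(3,4)] that by (simp add: cycle_adj_def)
    moreover have "inp (n + 2 + n * n + u * m + x) = 0 \<longleftrightarrow> x \<notin> L u" using lst that by blast
    ultimately show ?thesis unfolding conflict_def using adj[OF that(1,2)] by simp
  qed
  show ?thesis
  proof
    assume "fval inp X (init_env n 0) (accept_fm m r)"
    then have acc: "\<exists>Cs. (\<forall>i<r. Cs i < m) \<and> position (n + m) r Vs Cs (Vs 0) (Cs 0) (Vs 0) (Cs 0) \<notin> X"
      if "\<forall>i<r. Vs i < n" for Vs
      using that unfolding fval_accept_fm[OF m(2)] by blast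
    have "\<exists>f. (\<forall>v\<in>pverts G. f v \<in> L v \<and> f v < m) \<and> (\<forall>(u, v)\<in>parcs G. cycle_adj m (f u) (f v))"
    proof (rule solution_if_path_consistent[OF k m_def[THEN meta_eq_to_obj_eq] _ E short_walk_if_small_diameter[OF G(1) diam]])
      fix Vs assume "\<And>i. i < 2 * k + 3 \<Longrightarrow> Vs i \<in> pverts G"
      then have Vs: "\<forall>i<r. Vs i < n" using G(2) by (auto simp: r_def)
      obtain Cs where Cs: "\<forall>i<r. Cs i < m" "position (n + m) r Vs Cs (Vs 0) (Cs 0) (Vs 0) (Cs 0) \<notin> X"
        using acc[OF Vs] by blast
      define N where "N u x v y \<longleftrightarrow> u < n \<and> v < n \<and> x < m \<and> y < m \<and> position (n + m) r Vs Cs u x v y \<notin> X" for u x v y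
      have VC: "\<forall>i<r. Vs i < n + m \<and> Cs i < n + m" using Vs Cs(1) by auto
      have notin: "\<not> conflict inp m n r Vs Cs u x v y \<and>
        (\<forall>w<n. \<exists>z<m. position (n + m) r Vs Cs u x w z \<notin> X \<and> position (n + m) r Vs Cs w z v y \<notin> X)"
        if Nuv: "N u x v y" for u x v y
      proof (rule ccontr)
        let ?p = "position (n + m) r Vs Cs u x v y"
        have lt: "u < n + m" "x < n + m" "v < n + m" "y < n + m" using Nuv by (auto simp: N_def)
        assume "\<not> ?thesis"
        then have "conflict inp m n r Vs Cs u x v y \<or>
          (\<exists>w<n. \<forall>z<m. position (n + m) r Vs Cs u x w z \<in> X \<or> position (n + m) r Vs Cs w z v y \<in> X)" by blast
        then have "fval inp X (init_env n ?p) (step_fm m r)"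
          unfolding fval_step_fm using VC lt by blast
        \<comment> \<open>Closedness speaks only of indices below the bound; all 4 + 2r digits are
          below n + m, so the index of the pair is one of them.\<close>
        moreover have "?p < tval (init_env n 0) (bound_tm m (4 + 2 * r))"
        proof -
          let ?ds = "[u, x, v, y] @ map Vs [0..<r] @ map Cs [0..<r]"
          have len: "length ?ds = 4 + 2 * r" by simp
          have "\<forall>d\<in>set ?ds. d < n + m" using lt VC by auto
          from code_less[OF this] show ?thesis
            unfolding position_def len by (simp only: tval_bound_tm init_env_simps)
        qed
        ultimately have "?p \<in> X" using closed unfolding closed_under_def by blast
        then show False using Nuv by (simp add: N_def)
      qed
      have "path_consistent (pverts G) (guess_ok m (2 * k + 3) L Vs Cs) (parcs G) (cycle_adj m) N"
        unfolding path_consistent_def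
      proof (intro allI impI)
        fix u x v y assume Nuv: "N u x v y"
        have lt: "u < n" "v < n" "x < m" "y < m" using Nuv by (auto simp: N_def)
        have nc: "\<not> conflict inp m n r Vs Cs u x v y"
          and ex: "\<And>w. w < n \<Longrightarrow> \<exists>z<m. position (n + m) r Vs Cs u x w z \<notin> X \<and> position (n + m) r Vs Cs w z v y \<notin> X"
          using notin[OF Nuv] by blast+
        have "\<exists>z. N u x w z \<and> N w z v y" if "w < n" for w
          using ex[OF that] that lt unfolding N_def by blast
        then show "u \<in> pverts G \<and> v \<in> pverts G \<and> guess_ok m (2 * k + 3) L Vs Cs u x \<and> (u = v \<longrightarrow> x = y) \<and>
          ((u, v) \<in> parcs G \<longrightarrow> cycle_adj m x y) \<and> (\<forall>w\<in>pverts G. \<exists>z. N u x w z \<and> N w z v y)"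
          using nc[unfolded conf[OF lt], unfolded r_def] lt unfolding guess_ok_def G(2) by auto
      qed
      moreover have "N (Vs 0) (Cs 0) (Vs 0) (Cs 0)" using Cs Vs m(2) by (simp add: N_def)
      ultimately show "\<exists>Cs N. path_consistent (pverts G) (guess_ok m (2 * k + 3) L Vs Cs) (parcs G) (cycle_adj m) N \<and>
        N (Vs 0) (Cs 0) (Vs 0) (Cs 0)" by blast
    qed (use G(2) in simp_all)
    then obtain f where "\<forall>v\<in>pverts G. f v \<in> L v \<and> f v < m" "\<forall>(u, v)\<in>parcs G. cycle_adj m (f u) (f v)" by blast
    then have "list_homomorphism (cycle_graph m) G L f"
      unfolding list_homomorphism_def cycle_graph_arc_iff[OF m(1)] cycle_graph_simps by auto
    then show "\<exists>\<phi>. list_homomorphism (cycle_graph m) G L \<phi>" by blast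
  next
    assume "\<exists>\<phi>. list_homomorphism (cycle_graph m) G L \<phi>"
    then obtain \<phi> where "list_homomorphism (cycle_graph m) G L \<phi>" by blast
    then have \<phi>: "\<phi> v < m" "\<phi> v \<in> L v" "(u, v) \<in> parcs G \<Longrightarrow> cycle_adj m (\<phi> u) (\<phi> v)" if "v < n" for u v
      using that G(2) unfolding list_homomorphism_def cycle_graph_arc_iff[OF m(1)] cycle_graph_simps by auto
    \<comment> \<open>Indices that do not decode to a sensible position belong to \<open>Y\<close>
      as well, so closedness has to be checked only at indices consistent with
      \<open>\<phi>\<close>.\<close>
    define Y where "Y = {p. \<not> (\<exists>Vs u v. (\<forall>i<r. Vs i < n) \<and> u < n \<and> v < n \<and>
      p = position (n + m) r Vs (\<lambda>i. \<phi> (Vs i)) u (\<phi> u) v (\<phi> v))}"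
    have good: "position (n + m) r Vs (\<lambda>i. \<phi> (Vs i)) u (\<phi> u) v (\<phi> v) \<notin> Y"
      if "\<forall>i<r. Vs i < n" "u < n" "v < n" for Vs u v
      using that unfolding Y_def by blast
    have "p \<in> Y" if st: "fval inp Y (init_env n p) (step_fm m r)" for p
    proof (rule ccontr)
      assume "p \<notin> Y"
      then obtain Vs u v where Vs: "\<forall>i<r. Vs i < n" and uv: "u < n" "v < n"
        and p: "p = position (n + m) r Vs (\<lambda>i. \<phi> (Vs i)) u (\<phi> u) v (\<phi> v)" unfolding Y_def by blast
      obtain Vs' Cs' u' x' v' y' where lt': "\<forall>i<r. Vs' i < n + m \<and> Cs' i < n + m" "u' < n + m" "x' < n + m" "v' < n + m" "y' < n + m"
        and p': "p = position (n + m) r Vs' Cs' u' x' v' y'"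
        and bad: "conflict inp m n r Vs' Cs' u' x' v' y' \<or>
          (\<exists>w<n. \<forall>z<m. position (n + m) r Vs' Cs' u' x' w z \<in> Y \<or> position (n + m) r Vs' Cs' w z v' y' \<in> Y)"
        using st unfolding fval_step_fm by blast
      have b: "Vs' i < n + m \<and> Cs' i < n + m \<and> Vs i < n + m \<and> \<phi> (Vs i) < n + m" if "i < r" for i
        using lt'(1) Vs \<phi>(1)[of "Vs i"] that by auto
      \<comment> \<open>The formula finds some digits for the index; by injectivity of the coding
        they are the intended ones. The intermediate colour that defeats its vertex \<open>w\<close>
        is then \<open>\<phi> w\<close>.\<close>
      note inj = position_inject[OF p'[symmetric, unfolded p] b lt'(2-5)]
      have eq: "u' = u" "x' = \<phi> u" "v' = v" "y' = \<phi> v" "\<And>i. i < r \<Longrightarrow> Vs' i = Vs i" "\<And>i. i < r \<Longrightarrow> Cs' i = \<phi> (Vs i)"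
        using inj uv \<phi>(1)[OF uv(1)] \<phi>(1)[OF uv(2)] by (simp_all add: trans_less_add1 trans_less_add2)
      have pos: "position (n + m) r Vs' Cs' = position (n + m) r Vs (\<lambda>i. \<phi> (Vs i))"
        by (intro ext position_cong eq)
      have con: "conflict inp m n r Vs' Cs' = conflict inp m n r Vs (\<lambda>i. \<phi> (Vs i))"
        by (intro ext conflict_cong eq)
      have "\<not> conflict inp m n r Vs (\<lambda>i. \<phi> (Vs i)) u (\<phi> u) v (\<phi> v)"
        unfolding conf[OF uv \<phi>(1)[OF uv(1)] \<phi>(1)[OF uv(2)]] using \<phi>(2)[OF uv(1)] \<phi>(3)[OF uv(2)] by auto
      then obtain w where w: "w < n" "\<forall>z<m. position (n + m) r Vs (\<lambda>i. \<phi> (Vs i)) u (\<phi> u) w z \<in> Y \<or>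
          position (n + m) r Vs (\<lambda>i. \<phi> (Vs i)) w z v (\<phi> v) \<in> Y"
        using bad unfolding eq(1-4) pos con by blast
      then show False using good[OF Vs uv(1) w(1)] good[OF Vs w(1) uv(2)] \<phi>(1)[OF w(1)] by blast
    qed
    then have "closed_under inp n (bound_tm m (4 + 2 * r)) (step_fm m r) Y" unfolding closed_under_def by blast
    then have "X \<subseteq> Y" by (rule least)
    show "fval inp X (init_env n 0) (accept_fm m r)"
      unfolding fval_accept_fm[OF m(2)]
    proof (intro allI impI)
      fix Vs assume Vs: "\<forall>i<r. Vs i < n"
      then have "position (n + m) r Vs (\<lambda>i. \<phi> (Vs i)) (Vs 0) (\<phi> (Vs 0)) (Vs 0) (\<phi> (Vs 0)) \<notin> X"
        using good[OF Vs, of "Vs 0" "Vs 0"] m(2) \<open>X \<subseteq> Y\<close> by blast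
      then show "\<exists>Cs. (\<forall>i<r. Cs i < m) \<and> position (n + m) r Vs Cs (Vs 0) (Cs 0) (Vs 0) (Cs 0) \<notin> X"
        using Vs \<phi>(1) by (intro exI[of _ "\<lambda>i. \<phi> (Vs i)"]) auto
    qed
  qed
qed

theorem theorem1:
  fixes k :: nat
  assumes "k \<ge> 2"
  shows "poly_time_solvable (lhom_encoding (cycle_graph (2 * k + 1)))
           {(G, L). (G, L) \<in> lhom_inputs (cycle_graph (2 * k + 1)) \<and> graph_diameter G \<le> ereal (real (k + 1))}
           (lhom_yes (cycle_graph (2 * k + 1)))"
proof -
  define m where "m = 2 * k + 1"
  define r where "r = 2 * k + 3"
  let ?b = "bound_tm m (4 + 2 * r)" and ?f = "step_fm m r" and ?g = "accept_fm m r"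
  \<comment> \<open>The largest variable in the formulas is 7 + 2r, holding the intermediate
    colour.\<close>
  define q where "q = 8 + 2 * r"
  have q: "2 \<le> q" and b: "tvars_below q ?b" by (simp_all add: q_def tvars_below_bound_tm)
  have pos: "tvars_below q (position_tm m r u x v y)" if "u < q" "x < q" "v < q" "y < q" for u x v y
    unfolding position_tm_def by (rule tvars_below_code_tm) (use that in \<open>auto simp: q_def\<close>)
  have "fvars_below q (conflict_fm m r)"
    unfolding conflict_fm_def Let_def by (auto simp: q_def)
  then have f: "fvars_below q ?f"
    unfolding step_fm_def by (intro fvars_below_Exs) (auto simp: q_def intro!: pos[unfolded q_def])
  have g: "fvars_below q ?g"
    unfolding accept_fm_def fvars_below.simps
    by (intro fvars_below_Exs) (auto simp: q_def intro!: fvars_below_Exs pos[unfolded q_def])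
  obtain c P where "\<forall>w n. n < length w \<longrightarrow> (\<forall>i<n. w ! i) \<longrightarrow> \<not> w ! n \<longrightarrow>
    (\<forall>X Y p. X \<subseteq> Y \<longrightarrow> fval (initial_memory w) X (init_env n p) ?f \<longrightarrow> fval (initial_memory w) Y (init_env n p) ?f) \<longrightarrow>
    (\<exists>t s X. ram_exec c (initial_memory w) t s \<and> t \<le> poly P (length w) \<and>
       (s 0 \<noteq> 0 \<longleftrightarrow> fval (initial_memory w) X (init_env n 0) ?g) \<and>
       closed_under (initial_memory w) n ?b ?f X \<and>
       (\<forall>Y. closed_under (initial_memory w) n ?b ?f Y \<longrightarrow> X \<subseteq> Y))"
    using lfp_poly_time[OF q b f g] by (elim exE)
  note cP = this[THEN spec, THEN spec, THEN mp, THEN mp, THEN mp, THEN mp]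
  have "\<exists>t s. ram_exec c (initial_memory (lhom_encoding (cycle_graph m) (G, L))) t s \<and>
      t \<le> poly P (length (lhom_encoding (cycle_graph m) (G, L))) \<and>
      (s 0 \<noteq> 0 \<longleftrightarrow> (G, L) \<in> lhom_yes (cycle_graph m))"
    if GL: "(G, L) \<in> lhom_inputs (cycle_graph m)" and diam: "graph_diameter G \<le> ereal (real (k + 1))" for G L
  proof -
    let ?n = "card (pverts G)" and ?w = "lhom_encoding (cycle_graph m) (G, L)"
    have G: "pair_graph G" "pverts G = {..<?n}"
      using GL by (auto simp: lhom_inputs_def)
    obtain t s X where ts: "ram_exec c (initial_memory ?w) t s" "t \<le> poly P (length ?w)"
       "s 0 \<noteq> 0 \<longleftrightarrow> fval (initial_memory ?w) X (init_env ?n 0) ?g"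
       and X: "closed_under (initial_memory ?w) ?n ?b ?f X"
       "\<And>Y. closed_under (initial_memory ?w) ?n ?b ?f Y \<Longrightarrow> X \<subseteq> Y"
    proof -
      have "\<exists>t s X. ram_exec c (initial_memory ?w) t s \<and> t \<le> poly P (length ?w) \<and>
         (s 0 \<noteq> 0 \<longleftrightarrow> fval (initial_memory ?w) X (init_env ?n 0) ?g) \<and>
         closed_under (initial_memory ?w) ?n ?b ?f X \<and>
         (\<forall>Y. closed_under (initial_memory ?w) ?n ?b ?f Y \<longrightarrow> X \<subseteq> Y)"
        by (rule cP) (use lhom_encoding_facts(1-3)[where G = G and m = m and L = L] fval_step_fm_mono in blast)+
      then show ?thesis using that by (elim exE conjE) blast
    qed
    have "fval (initial_memory ?w) X (init_env ?n 0) ?g \<longleftrightarrow> (\<exists>\<phi>. list_homomorphism (cycle_graph m) G L \<phi>)"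
      unfolding m_def r_def
      by (rule accept_iff_list_homomorphism[OF assms G diam]) (use X in \<open>simp_all add: m_def r_def\<close>)
    then show ?thesis using ts unfolding lhom_yes_def by blast
  qed
  then show ?thesis unfolding poly_time_solvable_def m_def[symmetric]
    by (intro exI[of _ c] exI[of _ P]) auto
qed

end
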